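(* Let $\Omega\subset\mathbb{R}^N$ be a bounded domain of class $\mathcal{C}^2$. Let $F:\mathcal{S}\to\mathbb{R}$ be continuous, uniformly elliptic and positively $1$-homogeneous (as specified in the context) and, for $\lambda\ge0$, $\alpha>-1$ and $\beta>\alpha+1$, let $u$ be a continuous solution of $$-|\nabla u|^\alpha F(D^2u)+|\nabla u|^\beta+\lambda|u|^\alpha u=f\quad\text{in }\Omega,$$ with $f$ Lipschitz continuous in $\Omega$. Then $u$ is locally Lipschitz continuous in $\Omega$ and there exists a positive constant $M$, depending only on $\alpha,\beta,a,A,N$, $\|f-\lambda|u|^\alpha u\|_\infty$ and on the Lipschitz constant of $f$, such that at any differentiability point $x\in\Omega$ of $u$ one has $$|\nabla u(x)|\le\frac{M}{\mathrm{dist}_{\partial\Omega}(x)^{\frac1{\beta-\alpha-1}}}.$$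
   Context: $\mathcal{S}$ is the space of symmetric $N\times N$ real matrices. The assumption on $F$ is: there exist $0<a<A$ such that for all $M,N\in\mathcal{S}$ with $N\ge0$ and all $t>0$, $a\,\mathrm{tr}(N)\le F(M+N)-F(M)\le A\,\mathrm{tr}(N)$ and $F(tM)=tF(M)$. $\mathrm{dist}_{\partial\Omega}(x)$ is the distance of $x$ from $\partial\Omega$, and $\|\cdot\|_\infty$ is the sup norm on $\Omega$. By convention $|s|^\alpha s=0$ for $s=0$. Solutions are in the viscosity sense. For $\alpha\ge0$ this is the standard notion. For $\alpha<0$: an upper semicontinuous $u$ is a sub solution of the equation if for every $x_0\in\Omega$ either $u$ is equal to a constant $k$ in a ball around $x_0$ and $\lambda|k|^\alpha k\le f(x)$ in that ball, or for every $\psi\in\mathcal{C}^2$ such that $u-\psi$ has a local maximum at $x_0$ and $\nabla\psi(x_0)\ne0$ one has $-|\nabla\psi(x_0)|^\alpha F(D^2\psi(x_0))+|\nabla\psi(x_0)|^\beta+\lambda|u(x_0)|^\alpha u(x_0)\le f(x_0)$. Super solutions (lower semicontinuous) are defined symmetrically with local minima and reversed inequalities; a solution is both.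
   Formalization: The constant M is also allowed to depend on the diameter of Ω; without this the bound fails, e.g. for α=0, β=2, λ=0, F a multiple of the trace, f=1, u=x₁ on balls of large radius. *)

theory Defs
  imports "HOL-Analysis.Analysis"
begin

text \<open>The unguarded power satisfies \<open>0 powr 0 = 0\<close>; below, a gradient term with exponent \<open>0\<close>
  has to be the constant \<open>1\<close>, also where the gradient vanishes.\<close>

definition rpow :: "real \<Rightarrow> real \<Rightarrow> real" where
  "rpow s p = (if p = 0 then 1 else s powr p)"

text \<open>The function \<open>|s|\<^sup>\<alpha> s\<close>; it is \<open>0\<close> at \<open>s = 0\<close> for negative \<open>\<alpha>\<close> as well.\<close>

definition spow :: "real \<Rightarrow> real \<Rightarrow> real" where
  "spow \<alpha> s = rpow \<bar>s\<bar> \<alpha> * s"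

definition Sym :: "(real^'n^'n) set" where
  "Sym = {X. transpose X = X}"

definition psd :: "real^'n^'n \<Rightarrow> bool" where
  "psd X \<longleftrightarrow> X \<in> Sym \<and> (\<forall>v. 0 \<le> v \<bullet> (X *v v))"

text \<open>Only the values of \<open>F\<close> on \<^const>\<open>Sym\<close> are constrained (or used).\<close>

definition elliptic_operator :: "real \<Rightarrow> real \<Rightarrow> (real^'n^'n \<Rightarrow> real) \<Rightarrow> bool" where
  "elliptic_operator a A F \<longleftrightarrow>
     continuous_on Sym F \<and>
     (\<forall>X\<in>Sym. \<forall>Y\<in>Sym. psd Y \<longrightarrow>
        a * trace Y \<le> F (X + Y) - F X \<and> F (X + Y) - F X \<le> A * trace Y) \<and>
     (\<forall>X\<in>Sym. \<forall>t>0. F (t *\<^sub>R X) = t * F X)"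

text \<open>\<open>\<psi>\<close> is of class \<open>C\<^sup>2\<close> on the open set \<open>U\<close>, with gradient \<open>g\<close> and Hessian \<open>H\<close>.\<close>

definition C2_on :: "(real^'n) set \<Rightarrow> (real^'n \<Rightarrow> real) \<Rightarrow> (real^'n \<Rightarrow> real^'n)
    \<Rightarrow> (real^'n \<Rightarrow> real^'n^'n) \<Rightarrow> bool" where
  "C2_on U \<psi> g H \<longleftrightarrow>
     (\<forall>x\<in>U. (GDERIV \<psi> x :> g x) \<and> (g has_derivative (\<lambda>h. H x *v h)) (at x)) \<and>
     continuous_on U H"

text \<open>Near each boundary point, the domain is the strict epigraph, in some direction \<open>e\<close>, of a
  \<open>C\<^sup>2\<close> function of the \<open>N - 1\<close> variables orthogonal to \<open>e\<close>. Such a function is encoded as a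
  function \<open>\<gamma>\<close> on the whole space that is invariant under translations along \<open>e\<close>.\<close>

definition C2_domain :: "(real^'n) set \<Rightarrow> bool" where
  "C2_domain \<Omega> \<longleftrightarrow>
     open \<Omega> \<and> connected \<Omega> \<and> \<Omega> \<noteq> {} \<and>
     (\<forall>x0\<in>frontier \<Omega>. \<exists>r>0. \<exists>e \<gamma> g H.
        norm e = 1 \<and> C2_on UNIV \<gamma> g H \<and> (\<forall>x t. \<gamma> (x + t *\<^sub>R e) = \<gamma> x) \<and>
        \<Omega> \<inter> ball x0 r = {x \<in> ball x0 r. \<gamma> x < x \<bullet> e})"

definition usc_on :: "'a::topological_space set \<Rightarrow> ('a \<Rightarrow> real) \<Rightarrow> bool" where
  "usc_on \<Omega> u \<longleftrightarrow> (\<forall>c. openin (top_of_set \<Omega>) {x \<in> \<Omega>. u x < c})"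

definition lsc_on :: "'a::topological_space set \<Rightarrow> ('a \<Rightarrow> real) \<Rightarrow> bool" where
  "lsc_on \<Omega> u \<longleftrightarrow> (\<forall>c. openin (top_of_set \<Omega>) {x \<in> \<Omega>. c < u x})"

definition lhs :: "real \<Rightarrow> real \<Rightarrow> real \<Rightarrow> (real^'n^'n \<Rightarrow> real)
    \<Rightarrow> real \<Rightarrow> real^'n \<Rightarrow> real^'n^'n \<Rightarrow> real" where
  "lhs \<alpha> \<beta> lam F s p X = - (rpow (norm p) \<alpha> * F X) + rpow (norm p) \<beta> + lam * spow \<alpha> s"

text \<open>For \<open>\<alpha> < 0\<close> the alternative in the next two definitions is an inclusive one, as it is usually
  stated. Where \<open>u\<close> is locally constant, no test function touching \<open>u\<close> has a nonzero gradient, so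
  the second alternative holds there.\<close>

definition viscosity_subsolution :: "real \<Rightarrow> real \<Rightarrow> real \<Rightarrow> (real^'n^'n \<Rightarrow> real)
    \<Rightarrow> (real^'n \<Rightarrow> real) \<Rightarrow> (real^'n) set \<Rightarrow> (real^'n \<Rightarrow> real) \<Rightarrow> bool" where
  "viscosity_subsolution \<alpha> \<beta> lam F f \<Omega> u \<longleftrightarrow> usc_on \<Omega> u \<and>
     (\<forall>x0\<in>\<Omega>.
        (\<alpha> < 0 \<and> (\<exists>r>0. \<exists>k. ball x0 r \<subseteq> \<Omega> \<and>
           (\<forall>x\<in>ball x0 r. u x = k \<and> lam * spow \<alpha> k \<le> f x))) \<or>
        (\<forall>\<psi> g H. C2_on \<Omega> \<psi> g H \<and>
           (\<forall>\<^sub>F x in nhds x0. u x - \<psi> x \<le> u x0 - \<psi> x0) \<and> (\<alpha> < 0 \<longrightarrow> g x0 \<noteq> 0) \<longrightarrow>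
           lhs \<alpha> \<beta> lam F (u x0) (g x0) (H x0) \<le> f x0))"

definition viscosity_supersolution :: "real \<Rightarrow> real \<Rightarrow> real \<Rightarrow> (real^'n^'n \<Rightarrow> real)
    \<Rightarrow> (real^'n \<Rightarrow> real) \<Rightarrow> (real^'n) set \<Rightarrow> (real^'n \<Rightarrow> real) \<Rightarrow> bool" where
  "viscosity_supersolution \<alpha> \<beta> lam F f \<Omega> u \<longleftrightarrow> lsc_on \<Omega> u \<and>
     (\<forall>x0\<in>\<Omega>.
        (\<alpha> < 0 \<and> (\<exists>r>0. \<exists>k. ball x0 r \<subseteq> \<Omega> \<and>
           (\<forall>x\<in>ball x0 r. u x = k \<and> lam * spow \<alpha> k \<ge> f x))) \<or>
        (\<forall>\<psi> g H. C2_on \<Omega> \<psi> g H \<and>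
           (\<forall>\<^sub>F x in nhds x0. u x - \<psi> x \<ge> u x0 - \<psi> x0) \<and> (\<alpha> < 0 \<longrightarrow> g x0 \<noteq> 0) \<longrightarrow>
           lhs \<alpha> \<beta> lam F (u x0) (g x0) (H x0) \<ge> f x0))"

definition viscosity_solution :: "real \<Rightarrow> real \<Rightarrow> real \<Rightarrow> (real^'n^'n \<Rightarrow> real)
    \<Rightarrow> (real^'n \<Rightarrow> real) \<Rightarrow> (real^'n) set \<Rightarrow> (real^'n \<Rightarrow> real) \<Rightarrow> bool" where
  "viscosity_solution \<alpha> \<beta> lam F f \<Omega> u \<longleftrightarrow>
     viscosity_subsolution \<alpha> \<beta> lam F f \<Omega> u \<and> viscosity_supersolution \<alpha> \<beta> lam F f \<Omega> u"

text \<open>Meaningful only for functions that are bounded on the nonempty set \<open>\<Omega>\<close>.\<close>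

definition sup_norm_on :: "'a set \<Rightarrow> ('a \<Rightarrow> real) \<Rightarrow> real" where
  "sup_norm_on \<Omega> h = (SUP x\<in>\<Omega>. \<bar>h x\<bar>)"

definition locally_lipschitz_on :: "'a::metric_space set \<Rightarrow> ('a \<Rightarrow> real) \<Rightarrow> bool" where
  "locally_lipschitz_on \<Omega> u \<longleftrightarrow> (\<forall>x\<in>\<Omega>. \<exists>r>0. \<exists>C. C-lipschitz_on (cball x r \<inter> \<Omega>) u)"

end

theory Submission
  imports Defs
begin

text \<open>The equation is only used at second order upper jets of \<open>u\<close> and \<open>- u\<close> with nonzero gradient.
  Dividing by \<open>|p|\<^sup>\<alpha>\<close> there gives \<open>|p|\<^sup>\<gamma> - F X \<le> K |p|\<^sup>-\<^sup>\<alpha>\<close> for \<open>u\<close> and the reversed inequality for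
  the dual jets, with \<open>\<gamma> = \<beta> - \<alpha> > 1\<close> and \<open>K\<close> a bound of \<open>f - \<lambda> |u|\<^sup>\<alpha> u\<close>. With \<open>\<sigma> = 1 / (\<gamma> - 1)\<close>, the
  natural length belonging to a slope \<open>l\<close> is \<open>l\<^sup>1\<^sup>-\<^sup>\<gamma>\<close>. Suppose that \<open>u\<close> has slope at most
  \<open>T dist\<^sup>-\<^sup>\<sigma>\<close> in a ball, where \<open>dist\<close> is the distance from the boundary of the ball, and let \<open>T\<close> be large.
  The superlinear gradient term provides a radial barrier, which shows that beyond a fixed multiple of the
  natural length the slope is at most a quarter of that. Inside this range one doubles the variables and
  maximises \<open>u x - u y - l om (|x - y|) - m |x - x1|\<^sup>2\<close> with a concave profile \<open>om\<close>; the localisation error is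
  small because the natural length is small compared to the distance from the boundary. So \<open>T\<close>
  can be replaced by \<open>T / 2\<close>, down to a threshold that depends on the data only. The comparison of
  the jets of \<open>u\<close> at two points rests on the theorem on sums, which is obtained from
  sup-convolutions and Rademacher's theorem for the resolvent of a convex function.\<close>

section \<open>Rademacher's theorem\<close>

text \<open>The obstacle is that the constant may not depend on the size of \<open>u\<close>,
  whereas doubling the variables needs to know the oscillation of \<open>u\<close> at the edge of
  its range. The barrier supplies this, and in return it dictates the range: \<open>s0\<close> has
  to be a multiple of the natural length. On exactly this scale the gain
  \<open>2 * a * l / s0\<close> from ellipticity and the gradient term
  \<open>|p|\<^sup>\<gamma>\<close> are comparable. After division by \<open>l / s0\<close>, every
  error in the doubling argument therefore carries a positive power of the ratio \<open>k\<close> of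
  \<open>s0\<close> to the distance from the boundary, or a negative power of the slope, and both
  become small for large \<open>T\<close>.

  The slopes at the maximum stay between \<open>l / 8\<close> and \<open>2 * l\<close>. This makes
  the division by \<open>|p|\<^sup>\<alpha>\<close> harmless for either sign of \<alpha>, and it
  avoids zero gradients, where for negative \<alpha> the test functions give no information.\<close>

lemma lipschitz_real_differentiable_ae:
  fixes f :: "real \<Rightarrow> real"
  assumes "L-lipschitz_on UNIV f"
  obtains N where "negligible N" "\<And>x. x \<notin> N \<Longrightarrow> f differentiable (at x)"
proof -
  have L0: "L \<ge> 0" and lip: "\<bar>f x - f y\<bar> \<le> L * \<bar>x - y\<bar>" for x y
    using assms by (auto simp: lipschitz_on_def dist_real_def)
  \<comment> \<open>The added slope makes \<open>F\<close> increase at rate at least 1, so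
    \<open>F\<close> is a bi-Lipschitz homeomorphism of the line. Radon-Nikodym exhibits it as the
    integral of a density, and the differentiation theorem for integrals applies.\<close>
  define F where "F x = f x + (L + 1) * x" for x
  have lo: "y - x \<le> F y - F x" if "x \<le> y" for x y
    using lip[of x y] that unfolding F_def by (auto simp: algebra_simps abs_if split: if_splits)
  have up: "\<bar>F x - F y\<bar> \<le> (2 * L + 1) * \<bar>x - y\<bar>" for x y
    using lip[of x y] unfolding F_def
    by (auto simp: algebra_simps abs_if split: if_splits)
  have lipF: "(2 * L + 1)-lipschitz_on UNIV F"
    using up L0 by (auto simp: lipschitz_on_def dist_real_def)
  have contF: "continuous_on UNIV F"
    using lipF lipschitz_on_continuous_on by blast
  have strict: "strict_mono F"
    unfolding strict_mono_def
  proof (intro allI impI)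
    fix x y :: real assume "x < y" then show "F x < F y" using lo[of x y] by linarith
  qed
  have injF: "inj F" using strict strict_mono_imp_inj_on by blast
  have surjF: "surj F"
  proof -
    have "\<exists>x. F x = y" for y
    proof -
      let ?b = "\<bar>y - F 0\<bar>"
      have "F (- ?b) \<le> y" "y \<le> F ?b" using lo[of "-?b" 0] lo[of 0 ?b] by auto
      then show ?thesis
        using IVT'[of F "-?b" y ?b] contF continuous_on_subset by (metis abs_ge_minus_self abs_ge_zero minus_le_iff neg_le_0_iff_le order_trans top_greatest)
    qed
    then show ?thesis by (metis surjI)
  qed
  define G where "G = inv F"
  have GF: "G (F x) = x" and FG: "F (G x) = x" for x
    using injF surjF by (auto simp: G_def surj_f_inv_f)
  have contG: "continuous_on UNIV G"
  proof -
    have "1-lipschitz_on UNIV G"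
      unfolding lipschitz_on_def
    proof (intro conjI ballI)
      fix x y
      have "\<bar>G x - G y\<bar> \<le> \<bar>F (G x) - F (G y)\<bar>"
        using lo[of "G x" "G y"] lo[of "G y" "G x"] by linarith
      then show "dist (G x) (G y) \<le> 1 * dist x y" by (simp add: FG dist_real_def)
    qed simp
    then show ?thesis using lipschitz_on_continuous_on by blast
  qed
  have Gm: "G \<in> borel_measurable borel"
    using contG by (simp add: borel_measurable_continuous_onI)
  \<comment> \<open>As \<open>G\<close> inverts \<open>F\<close>, this measure gives a set the
    Lebesgue measure of its image under \<open>F\<close>. Null sets stay null because
    \<open>F\<close> is Lipschitz, and an interval receives the increment of
    \<open>F\<close>.\<close>
  define \<mu> where "\<mu> = distr lborel borel G"
  have vim: "G -` B = F ` B" for B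
    using GF FG by (auto simp: image_iff) metis
  have ac: "absolutely_continuous lborel \<mu>"
    unfolding absolutely_continuous_def
  proof
    fix B assume B: "B \<in> null_sets (lborel :: real measure)"
    then have Bm: "B \<in> sets borel" by auto
    have "negligible B" using B
      by (metis null_sets_completionI negligible_iff_null_sets)
    then have "negligible (F ` B)"
      using negligible_locally_Lipschitz_image[of B F] up
      by (metis Int_iff abs_minus_commute iso_tuple_UNIV_I open_UNIV order_refl real_norm_def)
    then have "emeasure lebesgue (F ` B) = 0"
      by (auto simp: negligible_iff_null_sets)
    moreover have "F ` B \<in> sets borel"
      using measurable_sets[OF Gm Bm] by (simp add: vim)
    ultimately have "emeasure lborel (F ` B) = 0" by simp
    then have "emeasure \<mu> B = 0"
      unfolding \<mu>_def using Bm Gm by (subst emeasure_distr) (auto simp: vim)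
    then show "B \<in> null_sets \<mu>"
      using Bm by (auto simp: null_sets_def \<mu>_def)
  qed
  have "sets \<mu> = sets lborel" by (simp add: \<mu>_def)
  then obtain q where q: "q \<in> borel_measurable lborel" and dq: "density lborel q = \<mu>"
    using sigma_finite_measure.Radon_Nikodym[OF sigma_finite_lborel ac] by auto
  have Fint: "(\<integral>\<^sup>+x. q x * indicator {a..b} x \<partial>lborel) = ennreal (F b - F a)" if "a \<le> b" for a b
  proof -
    have img: "F ` {a..b} = {F a..F b}"
    proof
      show "F ` {a..b} \<subseteq> {F a..F b}"
        using strict by (auto simp: strict_mono_less_eq)
      show "{F a..F b} \<subseteq> F ` {a..b}"
      proof
        fix y assume "y \<in> {F a..F b}"
        then have "F a \<le> F (G y)" "F (G y) \<le> F b" by (auto simp: FG)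
        then have "G y \<in> {a..b}" using strict by (auto simp: strict_mono_less_eq)
        then show "y \<in> F ` {a..b}" using FG by (metis image_eqI)
      qed
    qed
    have "(\<integral>\<^sup>+x. q x * indicator {a..b} x \<partial>lborel) = emeasure \<mu> {a..b}"
      using q by (simp add: dq[symmetric] emeasure_density)
    also have "\<dots> = emeasure lborel (F ` {a..b})"
      unfolding \<mu>_def using Gm by (subst emeasure_distr) (auto simp: vim)
    also have "\<dots> = ennreal (F b - F a)"
      using lo[OF that] that by (simp add: img)
    finally show ?thesis .
  qed
  define g where "g x = enn2real (q x)" for x
  have gm: "g \<in> borel_measurable borel" using q unfolding g_def[abs_def] by simp
  have gint: "(g has_integral (F b - F a)) {a..b}" if "a \<le> b" for a b
  proof -
    have fin: "(\<integral>\<^sup>+x. q x * indicator {a..b} x \<partial>lborel) \<noteq> \<infinity>"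
      using Fint[OF that] by simp
    have "AE x in lborel. q x * indicator {a..b} x \<noteq> \<infinity>"
      using nn_integral_PInf_AE[OF _ fin] q by simp
    then have "AE x in lborel. q x * indicator {a..b} x = ennreal (g x * indicator {a..b} x)"
      by (auto simp: g_def indicator_def ennreal_enn2real_if elim!: eventually_mono)
    then have nn: "(\<integral>\<^sup>+x. ennreal (g x * indicator {a..b} x) \<partial>lborel) = ennreal (F b - F a)"
      using Fint[OF that] nn_integral_cong_AE[of "\<lambda>x. q x * indicator {a..b} x" "\<lambda>x. ennreal (g x * indicator {a..b} x)" lborel] by simp
    have "((\<lambda>x. g x * indicator {a..b} x) has_integral (F b - F a)) UNIV"
    proof (rule nn_integral_has_integral[OF _ _ nn])
      show "(\<lambda>x. g x * indicator {a..b} x) \<in> borel_measurable borel"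
        using gm by measurable
      show "0 \<le> F b - F a" using lo[OF that] that by linarith
    qed (simp add: g_def)
    moreover have "(\<lambda>x. g x * indicator {a..b} x) = (\<lambda>x. if x \<in> {a..b} then g x else 0)"
      by (auto simp: indicator_def)
    ultimately show ?thesis
      by (simp only: has_integral_restrict_UNIV)
  qed
  have i1: "g integrable_on cbox a b" for a b
    using gint[of a b] by (cases "a \<le> b") (auto simp: integrable_on_def)
  \<comment> \<open>The averages in the differentiation theorem used below run over cubes with lower
    corner \<open>x\<close>, so they only see increments to the right. The reflected density
    provides those to the left.\<close>
  have gint2: "((\<lambda>x. g (- x)) has_integral (F (-a) - F (-b))) {a..b}" if "a \<le> b" for a b
    using gint[of "-b" "-a"] has_integral_reflect_real[where f=g and a="-b" and b="-a"] that by simp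
  have i2: "(\<lambda>x. g (- x)) integrable_on cbox a b" for a b
    using gint2[of a b] by (cases "a \<le> b") (auto simp: integrable_on_def)
  obtain N1 where N1: "negligible N1"
    "\<And>x e. \<lbrakk>x \<notin> N1; 0 < e\<rbrakk> \<Longrightarrow> \<exists>d>0. \<forall>h. 0 < h \<and> h < d \<longrightarrow>
       norm(integral (cbox x (x + h *\<^sub>R One)) g /\<^sub>R h ^ DIM(real) - g x) < e"
    using integrable_ccontinuous_explicit[of g] i1 by blast
  obtain N2 where N2: "negligible N2"
    "\<And>x e. \<lbrakk>x \<notin> N2; 0 < e\<rbrakk> \<Longrightarrow> \<exists>d>0. \<forall>h. 0 < h \<and> h < d \<longrightarrow>
       norm(integral (cbox x (x + h *\<^sub>R One)) (\<lambda>x. g (-x)) /\<^sub>R h ^ DIM(real) - g (-x)) < e"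
    using integrable_ccontinuous_explicit[of "\<lambda>x. g (-x)"] i2 by blast
  have N2': "negligible (uminus ` N2)"
  proof (rule negligible_locally_Lipschitz_image[OF order_refl N2(1)])
    fix x :: real
    show "\<exists>T B. open T \<and> x \<in> T \<and> (\<forall>y\<in>N2 \<inter> T. norm (- y - - x) \<le> B * norm (y - x))"
      by (rule exI[of _ UNIV], rule exI[of _ 1]) auto
  qed
  have "f differentiable (at x)" if x: "x \<notin> N1 \<union> uminus ` N2" for x
  proof -
    have x1: "x \<notin> N1" and x2: "-x \<notin> N2" using x by (auto simp: image_iff)
    have "((\<lambda>h. (F (x + h) - F x) / h) \<longlongrightarrow> g x) (at 0)"
      unfolding LIM_eq
    proof (intro allI impI)
      fix e :: real assume e: "0 < e"
      obtain d1 where d1: "d1 > 0" "\<And>h. 0 < h \<and> h < d1 \<Longrightarrow>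
           norm(integral (cbox x (x + h *\<^sub>R One)) g /\<^sub>R h ^ DIM(real) - g x) < e"
        using N1(2)[OF x1 e] by blast
      obtain d2 where d2: "d2 > 0" "\<And>h. 0 < h \<and> h < d2 \<Longrightarrow>
           norm(integral (cbox (-x) (-x + h *\<^sub>R One)) (\<lambda>x. g (-x)) /\<^sub>R h ^ DIM(real) - g x) < e"
        using N2(2)[OF x2 e] by auto
      show "\<exists>s>0. \<forall>h. h \<noteq> 0 \<and> norm (h - 0) < s \<longrightarrow> norm ((F (x + h) - F x) / h - g x) < e"
      proof (intro exI[of _ "min d1 d2"] conjI allI impI)
        show "0 < min d1 d2" using d1 d2 by simp
        fix h :: real assume h: "h \<noteq> 0 \<and> norm (h - 0) < min d1 d2"
        show "norm ((F (x + h) - F x) / h - g x) < e"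
        proof (cases "h > 0")
          case True
          have "integral (cbox x (x + h *\<^sub>R One)) g = F (x + h) - F x"
            using gint[of x "x + h"] True by (auto intro!: integral_unique)
          then show ?thesis using d1(2)[of h] h True by (simp add: divide_inverse_commute)
        next
          case False
          then have hn: "h < 0" using h by simp
          have "((\<lambda>x. g (- x)) has_integral (F x - F (x + h))) {-x..-x + (-h)}"
            using gint2[of "-x" "-x + (-h)"] hn by (simp add: add.commute)
          then have "integral (cbox (-x) (-x + (-h) *\<^sub>R One)) (\<lambda>x. g (-x)) = F x - F (x + h)"
            by (intro integral_unique) simp
          then have "norm (inverse (-h) * (F x - F (x + h)) - g x) < e"
            using d2(2)[of "-h"] h hn by simp
          moreover have "inverse (-h) * (F x - F (x + h)) = (F (x + h) - F x) / h"
            using hn by (simp add: field_simps)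
          ultimately show ?thesis by simp
        qed
      qed
    qed
    then have "(F has_real_derivative g x) (at x)" by (simp add: DERIV_def)
    then have "((\<lambda>x. F x - (L + 1) * x) has_real_derivative g x - (L + 1)) (at x)"
      by (auto intro!: derivative_eq_intros)
    moreover have "(\<lambda>x. F x - (L + 1) * x) = f" by (auto simp: F_def)
    ultimately show ?thesis by (metis real_differentiable_def)
  qed
  moreover have "negligible (N1 \<union> uminus ` N2)" using N1(1) N2' by auto
  ultimately show ?thesis using that by blast
qed


section \<open>Directional derivatives almost everywhere\<close>

text \<open>Integrate the indicator of \<open>N\<close> at \<open>x + t *\<^sub>R e\<close> over all
  \<open>x\<close> and over \<open>t\<close> in the unit interval. Doing \<open>x\<close> first
  gives the measure of \<open>N\<close> by translation invariance, doing \<open>t\<close> first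
  gives 0. No coordinates adapted to \<open>e\<close> are needed.\<close>

lemma negligible_if_null_on_lines:
  fixes N :: "'a::euclidean_space set"
  assumes N: "N \<in> sets borel"
    and line: "\<And>x. negligible {t::real. x + t *\<^sub>R e \<in> N}"
  shows "negligible N"
proof -
  let ?f = "\<lambda>(x::'a) (t::real). indicator N (x + t *\<^sub>R e) * indicator {0..1} t :: ennreal"
  have mline: "{t::real. x + t *\<^sub>R e \<in> N} \<in> sets borel" for x
  proof -
    have "(\<lambda>t::real. x + t *\<^sub>R e) \<in> borel_measurable borel" by measurable
    from measurable_sets[OF this N] show ?thesis by (simp add: vimage_def)
  qed
  have zero: "(\<integral>\<^sup>+t. ?f x t \<partial>lborel) = 0" for x
  proof -
    have "{t::real. x + t *\<^sub>R e \<in> N} \<in> null_sets lborel"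
      using line[of x] mline[of x]
      by (auto simp: negligible_iff_null_sets null_sets_def)
    then have "AE t in lborel. t \<notin> {t::real. x + t *\<^sub>R e \<in> N}"
      by (rule AE_not_in)
    then have "AE t in lborel. ?f x t = 0"
      by (rule eventually_mono) auto
    then show ?thesis
      by (subst nn_integral_cong_AE[where v="\<lambda>_. 0"]) auto
  qed
  have tr: "(\<integral>\<^sup>+x. ?f x t \<partial>lborel) = emeasure lborel N * indicator {0..1} t" for t
  proof -
    have "(\<lambda>x. x + t *\<^sub>R e) \<in> borel_measurable borel" by measurable
    then have m: "(\<lambda>x. indicator N (x + t *\<^sub>R e) :: ennreal) \<in> borel_measurable lborel"
      using N by measurable
    have "(\<integral>\<^sup>+x. ?f x t \<partial>lborel) = (\<integral>\<^sup>+x. indicator N (x + t *\<^sub>R e) \<partial>lborel) * indicator {0..1} t"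
      using m by (rule nn_integral_multc)
    also have "(\<integral>\<^sup>+x. indicator N (x + t *\<^sub>R e) \<partial>lborel)
        = (\<integral>\<^sup>+x. indicator N x \<partial>(distr lborel borel (\<lambda>x. t *\<^sub>R e + x)))"
      using N by (subst nn_integral_distr) (auto simp: add.commute)
    also have "\<dots> = emeasure lborel N"
      using N by (subst lborel_distr_plus) simp
    finally show ?thesis .
  qed
  have meas: "case_prod ?f \<in> borel_measurable (lborel \<Otimes>\<^sub>M lborel)"
  proof -
    have "(\<lambda>p::'a \<times> real. fst p + snd p *\<^sub>R e) \<in> borel_measurable (lborel \<Otimes>\<^sub>M lborel)"
      by measurable
    then have "(\<lambda>p::'a \<times> real. indicator N (fst p + snd p *\<^sub>R e) * indicator {0..1} (snd p) :: ennreal)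
       \<in> borel_measurable (lborel \<Otimes>\<^sub>M lborel)"
      using N by measurable
    then show ?thesis by (simp add: case_prod_beta')
  qed
  have "emeasure lborel N = (\<integral>\<^sup>+t. emeasure lborel N * indicator {0..1::real} t \<partial>lborel)"
    by (subst nn_integral_cmult_indicator) auto
  also have "\<dots> = (\<integral>\<^sup>+t. (\<integral>\<^sup>+x. ?f x t \<partial>lborel) \<partial>lborel)"
    by (simp only: tr)
  also have "\<dots> = (\<integral>\<^sup>+x. (\<integral>\<^sup>+t. ?f x t \<partial>lborel) \<partial>lborel)"
    using lborel_pair.Fubini'[of ?f, OF meas] .
  also have "\<dots> = 0" by (simp only: zero) simp
  finally have "N \<in> null_sets lborel" using N by (auto simp: null_sets_def)
  then show ?thesis
    using negligible_iff_null_sets null_sets_completionI by blast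
qed

text \<open>On each line in direction \<open>e\<close> the one-dimensional result applies. Putting
  the null sets together by Fubini requires a Borel exceptional set, which is why the existence of
  the limit is rewritten as a countable Cauchy condition.\<close>

lemma lipschitz_directional_derivative_ae:
  fixes f :: "'a::euclidean_space \<Rightarrow> real"
  assumes lip: "L-lipschitz_on UNIV f"
  obtains N where "negligible N"
    "\<And>x. x \<notin> N \<Longrightarrow> \<exists>c. ((\<lambda>t. (f (x + t *\<^sub>R e) - f x) / t) \<longlongrightarrow> c) (at 0)"
proof -
  have contf: "continuous_on UNIV f" using lip lipschitz_on_continuous_on by blast
  define q where "q x t = (f (x + t *\<^sub>R e) - f x) / t" for x t
  have contq: "continuous_on UNIV (\<lambda>x. q x t)" for t
    unfolding q_def divide_inverse
    by (intro continuous_intros continuous_on_compose2[OF contf]) auto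
  \<comment> \<open>One level of the Cauchy criterion for the quotients. As \<open>q\<close> is
    continuous in \<open>x\<close>, these sets are closed, and \<open>G\<close> below is exactly the
    set where the limit exists.\<close>
  define C where "C m k = {x. \<forall>s t. 0 < \<bar>s\<bar> \<and> \<bar>s\<bar> < 1 / real (Suc m) \<and> 0 < \<bar>t\<bar> \<and> \<bar>t\<bar> < 1 / real (Suc m)
        \<longrightarrow> \<bar>q x s - q x t\<bar> \<le> 1 / real (Suc k)}" for m k
  have closedC: "closed (C m k)" for m k
  proof -
    have "C m k = (\<Inter>(s, t) \<in> {(s, t). 0 < \<bar>s\<bar> \<and> \<bar>s\<bar> < 1 / real (Suc m) \<and> 0 < \<bar>t\<bar> \<and> \<bar>t\<bar> < 1 / real (Suc m)}.
       {x. \<bar>q x s - q x t\<bar> \<le> 1 / real (Suc k)})"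
      by (auto simp: C_def)
    moreover have "closed {x. \<bar>q x s - q x t\<bar> \<le> 1 / real (Suc k)}" for s t
      by (intro closed_Collect_le continuous_intros contq)
    ultimately show ?thesis by (auto intro!: closed_INT)
  qed
  define G where "G = (\<Inter>k. \<Union>m. C m k)"
  have Gb: "- G \<in> sets borel"
  proof -
    have "C m k \<in> sets borel" for m k using closedC by simp
    then have "G \<in> sets borel" unfolding G_def by auto
    then show ?thesis by (rule borel_comp)
  qed
  have G1: "x \<in> G" if lim: "(q x \<longlongrightarrow> c) (at 0)" for x c
  proof -
    have "\<exists>m. x \<in> C m k" for k
    proof -
      have "0 < 1 / real (Suc k) / 2" by simp
      then obtain d where d: "d > 0" "\<And>t. t \<noteq> 0 \<and> \<bar>t\<bar> < d \<Longrightarrow> \<bar>q x t - c\<bar> < 1 / real (Suc k) / 2"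
        using lim unfolding LIM_eq by (metis diff_zero real_norm_def)
      obtain m where m: "1 / real (Suc m) < d" using d(1) nat_approx_posE by blast
      have "\<bar>q x s - q x t\<bar> \<le> 1 / real (Suc k)"
        if "0 < \<bar>s\<bar>" "\<bar>s\<bar> < 1 / real (Suc m)" "0 < \<bar>t\<bar>" "\<bar>t\<bar> < 1 / real (Suc m)" for s t
      proof -
        have "\<bar>q x s - c\<bar> < 1 / real (Suc k) / 2" "\<bar>q x t - c\<bar> < 1 / real (Suc k) / 2"
          using d(2)[of s] d(2)[of t] that m by auto
        moreover have "\<bar>a - b\<bar> \<le> r" if "\<bar>a - c\<bar> < r / 2" "\<bar>b - c\<bar> < r / 2" for a b r :: real
          using that by linarith
        ultimately show ?thesis by blast
      qed
      then show ?thesis by (auto simp: C_def)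
    qed
    then show ?thesis by (auto simp: G_def)
  qed
  have G2: "\<exists>c. (q x \<longlongrightarrow> c) (at 0)" if "x \<in> G" for x
  proof -
    have cau: "\<exists>d>0. \<forall>s t. 0 < \<bar>s\<bar> \<and> \<bar>s\<bar> < d \<and> 0 < \<bar>t\<bar> \<and> \<bar>t\<bar> < d \<longrightarrow> \<bar>q x s - q x t\<bar> < r"
      if "r > 0" for r
    proof -
      obtain k where k: "1 / real (Suc k) < r" using \<open>r > 0\<close> nat_approx_posE by blast
      obtain m where "x \<in> C m k" using \<open>x \<in> G\<close> by (auto simp: G_def)
      then have le: "\<bar>q x s - q x t\<bar> \<le> 1 / real (Suc k)"
        if "0 < \<bar>s\<bar>" "\<bar>s\<bar> < 1 / real (Suc m)" "0 < \<bar>t\<bar>" "\<bar>t\<bar> < 1 / real (Suc m)" for s t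
        using that unfolding C_def by blast
      show ?thesis
      proof (intro exI[of _ "1 / real (Suc m)"] conjI allI impI)
        fix s t assume st: "0 < \<bar>s\<bar> \<and> \<bar>s\<bar> < 1 / real (Suc m) \<and> 0 < \<bar>t\<bar> \<and> \<bar>t\<bar> < 1 / real (Suc m)"
        show "\<bar>q x s - q x t\<bar> < r" by (rule order_le_less_trans[OF le k]) (use st in auto)
      qed simp
    qed
    define X where "X n = q x (1 / real (Suc n))" for n
    have small: "\<exists>M. \<forall>n\<ge>M. 0 < \<bar>1 / real (Suc n)\<bar> \<and> \<bar>1 / real (Suc n)\<bar> < d" if "d > 0" for d
    proof -
      obtain M where "1 / real (Suc M) < d" using \<open>d > 0\<close> nat_approx_posE by blast
      show ?thesis
      proof (intro exI[of _ M] allI impI)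
        fix n assume "n \<ge> M"
        then have "1 / real (Suc n) \<le> 1 / real (Suc M)" by (simp add: frac_le)
        then have "1 / real (Suc n) < d" using \<open>1 / real (Suc M) < d\<close> by linarith
        moreover have "0 < 1 / real (Suc n)" by simp
        ultimately show "0 < \<bar>1 / real (Suc n)\<bar> \<and> \<bar>1 / real (Suc n)\<bar> < d" by linarith
      qed
    qed
    have "Cauchy X"
    proof (rule metric_CauchyI)
      fix r :: real assume "0 < r"
      from cau[OF this] obtain d where d: "d > 0"
        "\<And>s t. 0 < \<bar>s\<bar> \<and> \<bar>s\<bar> < d \<and> 0 < \<bar>t\<bar> \<and> \<bar>t\<bar> < d \<Longrightarrow> \<bar>q x s - q x t\<bar> < r" by blast
      obtain M where M: "\<And>n. n \<ge> M \<Longrightarrow> 0 < \<bar>1 / real (Suc n)\<bar> \<and> \<bar>1 / real (Suc n)\<bar> < d"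
        using small[OF d(1)] by blast
      show "\<exists>M. \<forall>m\<ge>M. \<forall>n\<ge>M. dist (X m) (X n) < r"
      proof (intro exI[of _ M] allI impI)
        fix m n assume "m \<ge> M" "n \<ge> M"
        then show "dist (X m) (X n) < r"
          unfolding X_def dist_real_def using M[of m] M[of n] by (intro d(2)) blast
      qed
    qed
    then obtain c where c: "X \<longlonglongrightarrow> c" by (meson Cauchy_convergent_iff convergent_def)
    have "(q x \<longlongrightarrow> c) (at 0)"
      unfolding LIM_eq
    proof (intro allI impI)
      fix r :: real assume r: "0 < r"
      then have r2: "0 < r / 2" by simp
      from cau[OF this] obtain d where d: "d > 0"
        "\<And>s t. 0 < \<bar>s\<bar> \<and> \<bar>s\<bar> < d \<and> 0 < \<bar>t\<bar> \<and> \<bar>t\<bar> < d \<Longrightarrow> \<bar>q x s - q x t\<bar> < r / 2" by blast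
      obtain M where M: "\<And>n. n \<ge> M \<Longrightarrow> 0 < \<bar>1 / real (Suc n)\<bar> \<and> \<bar>1 / real (Suc n)\<bar> < d"
        using small[OF d(1)] by blast
      show "\<exists>s>0. \<forall>t. t \<noteq> 0 \<and> norm (t - 0) < s \<longrightarrow> norm (q x t - c) < r"
      proof (intro exI[of _ d] conjI allI impI d(1))
        fix t :: real assume t: "t \<noteq> 0 \<and> norm (t - 0) < d"
        have "\<bar>q x t - X n\<bar> \<le> r / 2" if "n \<ge> M" for n
          unfolding X_def using d(2)[of t "1 / real (Suc n)"] M[OF that] t
          by (intro less_imp_le) auto
        moreover have "(\<lambda>n. \<bar>q x t - X n\<bar>) \<longlonglongrightarrow> \<bar>q x t - c\<bar>"
          by (intro tendsto_intros c)
        ultimately have "\<bar>q x t - c\<bar> \<le> r / 2"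
          by (meson LIMSEQ_le_const2)
        then show "norm (q x t - c) < r" using r by simp
      qed
    qed
    then show ?thesis by blast
  qed
  have "negligible (- G)"
  proof (rule negligible_if_null_on_lines[OF Gb, of e])
    fix x
    have "(L * norm e)-lipschitz_on UNIV (\<lambda>t::real. f (x + t *\<^sub>R e))"
    proof (rule lipschitz_onI)
      fix s t :: real
      have "dist (f (x + s *\<^sub>R e)) (f (x + t *\<^sub>R e)) \<le> L * dist (x + s *\<^sub>R e) (x + t *\<^sub>R e)"
        by (intro lipschitz_onD[OF lip]) auto
      also have "dist (x + s *\<^sub>R e) (x + t *\<^sub>R e) = norm e * dist s t"
        by (simp add: dist_norm mult.commute flip: scaleR_diff_left)
      finally show "dist (f (x + s *\<^sub>R e)) (f (x + t *\<^sub>R e)) \<le> L * norm e * dist s t"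
        by (simp add: mult.assoc)
    qed (use lipschitz_on_nonneg[OF lip] in simp)
    from lipschitz_real_differentiable_ae[OF this] obtain N where N: "negligible N"
      "\<And>t. t \<notin> N \<Longrightarrow> (\<lambda>t::real. f (x + t *\<^sub>R e)) differentiable (at t)"
      by metis
    have "t \<in> N" if "x + t *\<^sub>R e \<in> - G" for t
    proof (rule ccontr)
      assume "t \<notin> N"
      from N(2)[OF this] obtain c where "((\<lambda>t::real. f (x + t *\<^sub>R e)) has_real_derivative c) (at t)"
        using real_differentiable_def by blast
      then have "(q (x + t *\<^sub>R e) \<longlongrightarrow> c) (at 0)"
        unfolding DERIV_def q_def by (simp add: scaleR_add_left add.assoc)
      then show False using G1 that by auto
    qed
    then show "negligible {t. x + t *\<^sub>R e \<in> - G}"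
      by (intro negligible_subset[OF N(1)]) auto
  qed
  then show ?thesis using that[of "- G"] G2 unfolding q_def by auto
qed




section \<open>Porosity and total differentiability\<close>

text \<open>Holes of a fixed relative size at arbitrarily small scales exclude Lebesgue density. It
  is the negation that gets used: around a point that is not porous, every ball of radius
  \<open>c * t\<close> inside a small ball of radius \<open>t\<close> meets
  \<open>S\<close>.\<close>

definition porous_at :: "real \<Rightarrow> 'a::euclidean_space set \<Rightarrow> 'a \<Rightarrow> bool" where
  "porous_at c S x \<longleftrightarrow> (\<forall>d>0. \<exists>t y. 0 < t \<and> t < d \<and> ball y (c * t) \<subseteq> ball x t \<and> ball y (c * t) \<inter> S = {})"

lemma emeasure_ball_scale:
  fixes x y :: "'a::euclidean_space"
  assumes "0 \<le> c" "0 \<le> t"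
  shows "emeasure lborel (ball y (c * t)) = ennreal (c ^ DIM('a)) * emeasure lborel (ball x t)"
proof -
  have "emeasure lebesgue (ball y (c * t)) = ennreal (c ^ DIM('a)) * emeasure lebesgue (ball x t)"
    using assms emeasure_lebesgue_ball_conv_unit_ball[of "c * t" y] emeasure_lebesgue_ball_conv_unit_ball[of t x]
    by (simp only: power_mult_distrib ennreal_mult mult.assoc mult_nonneg_nonneg zero_le_power)
  then show ?thesis by simp
qed

text \<open>The holes of a Vitali covering of the porous points by disjoint balls lie in an open
  neighbourhood of \<open>S\<close> but outside \<open>S\<close>, so their total measure, a fixed fraction of that of the
  balls, is arbitrarily small.\<close>

lemma negligible_porous_points:
  fixes S :: "'a::euclidean_space set"
  assumes "closed S" "0 < c"
  shows "negligible {x \<in> S. porous_at c S x}"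
proof -
  have "negligible ({x \<in> S. porous_at c S x} \<inter> ball 0 (real n))" for n
  proof (rule negligible_outer_le[THEN iffD2], intro allI impI)
    fix e :: real assume e: "0 < e"
    let ?T = "{x \<in> S. porous_at c S x} \<inter> ball 0 (real n)"
    let ?S = "S \<inter> cball 0 (real n)"
    have S: "?S \<in> lmeasurable"
      using assms by (intro lmeasurable_compact closed_Int_compact) auto
    define e' where "e' = e * c ^ DIM('a)"
    have "e' > 0" using e assms by (simp add: e'_def)
    then obtain U where U: "open U" "?S \<subseteq> U" "U - ?S \<in> lmeasurable" "emeasure lebesgue (U - ?S) < ennreal e'"
      using sets_lebesgue_outer_open[OF fmeasurableD[OF S]] by metis
    define K where "K = {(x, t, y). x \<in> ?T \<and> 0 < t \<and> ball x t \<subseteq> U \<inter> ball 0 (real n)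
       \<and> ball y (c * t) \<subseteq> ball x t \<and> ball y (c * t) \<inter> S = {}}"
    have cov: "\<exists>i. i \<in> K \<and> x \<in> ball (fst i) (fst (snd i)) \<and> fst (snd i) < d"
      if x: "x \<in> ?T" and d: "0 < d" for x d
    proof -
      have "x \<in> U \<inter> ball 0 (real n)" using x U(2) by auto
      then obtain d' where d': "d' > 0" "ball x d' \<subseteq> U \<inter> ball 0 (real n)"
        using U(1) open_Int openE open_ball by metis
      obtain t y where t: "0 < t" "t < min d d'" "ball y (c * t) \<subseteq> ball x t" "ball y (c * t) \<inter> S = {}"
      proof -
        have "porous_at c S x" "0 < min d d'" using x d d'(1) by auto
        then have "\<exists>t y. 0 < t \<and> t < min d d' \<and> ball y (c * t) \<subseteq> ball x t \<and> ball y (c * t) \<inter> S = {}"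
          unfolding porous_at_def by blast
        then show ?thesis using that by blast
      qed
      have "ball x t \<subseteq> ball x d'" using t(2) by (intro subset_ball) simp
      then have "(x, t, y) \<in> K" using x t d' by (auto simp: K_def)
      then show ?thesis using t by (intro exI[of _ "(x, t, y)"]) auto
    qed
    obtain C where C: "countable C" "C \<subseteq> K"
      "pairwise (\<lambda>i j. disjnt (ball (fst i) (fst (snd i))) (ball (fst j) (fst (snd j)))) C"
      "negligible (?T - (\<Union>i\<in>C. ball (fst i) (fst (snd i))))"
    proof (rule Vitali_covering_theorem_balls[of ?T K fst "\<lambda>i. fst (snd i)"])
      fix x and d :: real assume "x \<in> ?T" "0 < d"
      then show "\<exists>i. i \<in> K \<and> x \<in> ball (fst i) (fst (snd i)) \<and> fst (snd i) < d" by (rule cov)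
    qed (rule that)
    define B where "B = (\<lambda>i::'a \<times> real \<times> 'a. ball (fst i) (fst (snd i)))"
    define H where "H = (\<lambda>i::'a \<times> real \<times> 'a. ball (snd (snd i)) (c * fst (snd i)))"
    have HB: "H i \<subseteq> B i" and HU: "H i \<subseteq> U - ?S" if "i \<in> C" for i
      using C(2) that by (force simp: K_def H_def B_def)+
    have dB: "disjoint_family_on B C"
      using C(3) by (auto simp: disjoint_family_on_def pairwise_def disjnt_def B_def)
    have dH: "disjoint_family_on H C"
      unfolding disjoint_family_on_def
    proof (intro ballI impI)
      fix i j assume "i \<in> C" "j \<in> C" "i \<noteq> j"
      then have "B i \<inter> B j = {}" using dB by (auto simp: disjoint_family_on_def)
      then show "H i \<inter> H j = {}" using HB \<open>i \<in> C\<close> \<open>j \<in> C\<close> by blast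
    qed
    have mB: "emeasure lborel (\<Union>(B ` C)) = (\<integral>\<^sup>+i. emeasure lborel (B i) \<partial>count_space C)"
      using C(1) dB by (intro emeasure_UN_countable) (auto simp: B_def)
    have mH: "emeasure lborel (\<Union>(H ` C)) = (\<integral>\<^sup>+i. emeasure lborel (H i) \<partial>count_space C)"
      using C(1) dH by (intro emeasure_UN_countable) (auto simp: H_def)
    have HBi: "emeasure lborel (H i) = ennreal (c ^ DIM('a)) * emeasure lborel (B i)" if "i \<in> C" for i
      using that C(2) assms(2) unfolding H_def B_def by (intro emeasure_ball_scale) (auto simp: K_def)
    have "emeasure lborel (\<Union>(H ` C)) = (\<integral>\<^sup>+i. ennreal (c ^ DIM('a)) * emeasure lborel (B i) \<partial>count_space C)"
      unfolding mH by (rule nn_integral_cong) (simp add: HBi)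
    also have "\<dots> = ennreal (c ^ DIM('a)) * emeasure lborel (\<Union>(B ` C))"
      unfolding mB by (rule nn_integral_cmult) simp
    finally have eq: "emeasure lborel (\<Union>(H ` C)) = ennreal (c ^ DIM('a)) * emeasure lborel (\<Union>(B ` C))" .
    have HbS: "\<Union>(H ` C) \<in> sets borel" "\<Union>(B ` C) \<in> sets borel"
      by (auto simp: H_def B_def intro!: borel_open open_UN)
    have "emeasure lborel (\<Union>(H ` C)) = emeasure lebesgue (\<Union>(H ` C))" using HbS by simp
    also have "\<dots> \<le> emeasure lebesgue (U - ?S)"
      using HU U(3) by (intro emeasure_mono) auto
    also have "\<dots> < ennreal e'" by (rule U)
    finally have lt: "ennreal (c ^ DIM('a)) * emeasure lborel (\<Union>(B ` C)) < ennreal e'" unfolding eq .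
    have "B i \<subseteq> ball 0 (real n)" if "i \<in> C" for i
      using C(2) that by (cases i) (auto simp: K_def B_def simp del: mem_ball_0 ball_subset_ball_iff)
    then have Bsub: "\<Union>(B ` C) \<subseteq> ball 0 (real n)" by blast
    then have Bl: "\<Union>(B ` C) \<in> lmeasurable"
      using HbS(2) by (intro bounded_set_imp_lmeasurable) (auto intro: bounded_subset)
    have "c ^ DIM('a) * measure lebesgue (\<Union>(B ` C)) < e'"
    proof -
      have "emeasure lborel (\<Union>(B ` C)) = ennreal (measure lebesgue (\<Union>(B ` C)))"
        using emeasure_eq_measure2[OF Bl] HbS(2) by simp
      then show ?thesis using lt assms(2) \<open>e' > 0\<close>
        by (simp add: ennreal_mult'[symmetric] ennreal_less_iff)
    qed
    then have me: "measure lebesgue (\<Union>(B ` C)) < e"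
      using assms(2) by (simp add: e'_def mult.commute)
    define W where "W = \<Union>(B ` C) \<union> (?T - \<Union>(B ` C))"
    have ng: "negligible (?T - \<Union>(B ` C))" using C(4) by (simp add: B_def)
    show "\<exists>T. ?T \<subseteq> T \<and> T \<in> lmeasurable \<and> measure lebesgue T \<le> e"
    proof (intro exI[of _ W] conjI)
      show "?T \<subseteq> W" by (auto simp: W_def)
      show "W \<in> lmeasurable" unfolding W_def
        by (rule fmeasurable.Un[OF Bl negligible_imp_measurable[OF ng]])
      have "measure lebesgue W \<le> measure lebesgue (\<Union>(B ` C)) + measure lebesgue (?T - \<Union>(B ` C))"
        unfolding W_def using Bl ng by (intro measure_Un_le) (auto dest: fmeasurableD negligible_imp_sets)
      also have "measure lebesgue (?T - \<Union>(B ` C)) = 0" using ng negligible_imp_measure0 by blast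
      finally show "measure lebesgue W \<le> e" using me by simp
    qed
  qed
  then have "negligible (\<Union>n. {x \<in> S. porous_at c S x} \<inter> ball 0 (real n))"
    by (rule negligible_Union_nat)
  moreover have "{x \<in> S. porous_at c S x} = (\<Union>n. {x \<in> S. porous_at c S x} \<inter> ball 0 (real n))"
    using reals_Archimedean2 by auto
  ultimately show ?thesis by metis
qed


text \<open>Partial derivatives at \<open>x\<close> alone say nothing about the intermediate corners
  of a walk from \<open>x\<close> to \<open>y\<close> along the coordinate directions. The sets
  \<open>S v k m\<close> collect the points whose partial increments are uniformly close to those of
  the slope \<open>v\<close>. Where such a set is not porous, every corner is close to one of its
  points, and the Lipschitz bound pays for the shift. Taking \<open>v\<close> from a countable dense
  set keeps the exceptional set negligible.\<close>

lemma rademacher_real: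
  fixes f :: "'a::euclidean_space \<Rightarrow> real"
  assumes lip: "L-lipschitz_on UNIV f"
  obtains N where "negligible N" "\<And>x. x \<notin> N \<Longrightarrow> f differentiable (at x)"
proof -
  have contf: "continuous_on UNIV f" using lip lipschitz_on_continuous_on by blast
  have L0: "0 \<le> L" using lip lipschitz_on_nonneg by blast
  have lipD: "\<bar>f x - f y\<bar> \<le> L * norm (x - y)" for x y
    using lipschitz_onD[OF lip, of x y] by (simp add: dist_real_def dist_norm)
  have "\<forall>b. \<exists>N. negligible N \<and> (\<forall>x. x \<notin> N \<longrightarrow> (\<exists>c. ((\<lambda>t. (f (x + t *\<^sub>R b) - f x) / t) \<longlongrightarrow> c) (at 0)))"
    using lipschitz_directional_derivative_ae[OF lip] by metis
  then obtain Nb where Nb: "\<And>b. negligible (Nb b)"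
    "\<And>b x. x \<notin> Nb b \<Longrightarrow> \<exists>c. ((\<lambda>t. (f (x + t *\<^sub>R b) - f x) / t) \<longlongrightarrow> c) (at 0)"
    by metis
  obtain D :: "'a set" where D: "countable D" "\<And>X. open X \<Longrightarrow> X \<noteq> {} \<Longrightarrow> \<exists>d\<in>D. d \<in> X"
    by (rule countable_dense_setE) auto
  define S where "S v k m = {x. \<forall>b\<in>Basis. \<forall>t. \<bar>t\<bar> \<le> 1 / real (Suc m) \<longrightarrow>
     \<bar>f (x + t *\<^sub>R b) - f x - t * (v \<bullet> b)\<bar> \<le> \<bar>t\<bar> / real (Suc k)}" for v k m
  have closedS: "closed (S v k m)" for v k m
  proof -
    have "S v k m = (\<Inter>(b, t) \<in> {(b, t). b \<in> Basis \<and> \<bar>t\<bar> \<le> 1 / real (Suc m)}.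
       {x. \<bar>f (x + t *\<^sub>R b) - f x - t * (v \<bullet> b)\<bar> \<le> \<bar>t\<bar> / real (Suc k)})"
      by (auto simp: S_def)
    moreover have "closed {x. \<bar>f (x + t *\<^sub>R b) - f x - t * (v \<bullet> b)\<bar> \<le> \<bar>t\<bar> / real (Suc k)}" for b t
    proof (rule closed_Collect_le)
      show "continuous_on UNIV (\<lambda>x. \<bar>f (x + t *\<^sub>R b) - f x - t * (v \<bullet> b)\<bar>)"
        by (intro continuous_intros continuous_on_compose2[OF contf]) auto
    qed simp
    ultimately show ?thesis by (auto intro!: closed_INT)
  qed
  define P where "P v k m j = {x \<in> S v k m. porous_at (1 / real (Suc j)) (S v k m) x}" for v k m j
  have negP: "negligible (P v k m j)" for v k m j
    unfolding P_def by (intro negligible_porous_points closedS) simp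
  define N where "N = (\<Union>b\<in>Basis. Nb b) \<union> (\<Union>v\<in>D. \<Union>k m j. P v k m j)"
  have negN: "negligible N"
  proof -
    have "negligible (\<Union>k m j. P v k m j)" for v
      by (intro negligible_Union_nat negP)
    then have "negligible (\<Union>v\<in>D. \<Union>k m j. P v k m j)"
      using D(1) by (intro negligible_countable_Union) auto
    moreover have "negligible (\<Union>b\<in>Basis. Nb b)"
      using Nb(1) by (intro negligible_Union) auto
    ultimately show ?thesis by (simp add: N_def)
  qed
  have "f differentiable (at x)" if x: "x \<notin> N" for x
  proof -
    have "\<forall>b\<in>Basis. \<exists>c. ((\<lambda>t. (f (x + t *\<^sub>R b) - f x) / t) \<longlongrightarrow> c) (at 0)"
      using x Nb(2) by (auto simp: N_def)
    then obtain c where c: "\<And>b. b \<in> Basis \<Longrightarrow> ((\<lambda>t. (f (x + t *\<^sub>R b) - f x) / t) \<longlongrightarrow> c b) (at 0)"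
      by metis
    define g where "g = (\<Sum>b\<in>Basis. c b *\<^sub>R b)"
    have gb: "g \<bullet> b = c b" if "b \<in> Basis" for b
      using that unfolding g_def by (simp add: inner_sum_left_Basis)
    let ?n = "real DIM('a)"
    have n1: "?n \<ge> 1" using DIM_positive[where 'a='a] by linarith
    have "\<exists>d>0. \<forall>y. norm (y - x) < d \<longrightarrow> norm (f y - f x - g \<bullet> (y - x)) \<le> e * norm (y - x)"
      if e: "e > 0" for e
    proof -
      define e1 where "e1 = e / (4 * ?n)"
      have e1: "e1 > 0" using e n1 by (simp add: e1_def)
      obtain k where k: "1 / real (Suc k) < e1" using e1 nat_approx_posE by blast
      \<comment> \<open>Half the tolerance of \<open>S v k m\<close>: one half is for the difference
        quotients at \<open>x\<close>, the other for replacing the gradient \<open>g\<close> by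
        \<open>v\<close>.\<close>
      define \<delta> where "\<delta> = 1 / real (Suc k) / 2"
      have \<delta>: "\<delta> > 0" by (simp add: \<delta>_def)
      obtain v where v: "v \<in> D" "v \<in> ball g \<delta>"
        using D(2)[of "ball g \<delta>"] \<delta> by auto
      have "\<exists>d>0. \<forall>t. t \<noteq> 0 \<and> \<bar>t\<bar> < d \<longrightarrow> \<bar>(f (x + t *\<^sub>R b) - f x) / t - c b\<bar> < \<delta>" if "b \<in> Basis" for b
        using c[OF that] \<delta> unfolding LIM_eq by auto
      then obtain db where db: "\<And>b. b \<in> Basis \<Longrightarrow> db b > 0"
        "\<And>b t. b \<in> Basis \<Longrightarrow> t \<noteq> 0 \<Longrightarrow> \<bar>t\<bar> < db b \<Longrightarrow> \<bar>(f (x + t *\<^sub>R b) - f x) / t - c b\<bar> < \<delta>"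
        by metis
      define d0 where "d0 = Min (db ` Basis)"
      have d0: "d0 > 0" "\<And>b. b \<in> Basis \<Longrightarrow> d0 \<le> db b" using db(1) by (auto simp: d0_def)
      obtain m where m: "1 / real (Suc m) < d0" using d0(1) nat_approx_posE by blast
      have xS: "x \<in> S v k m"
        unfolding S_def
      proof (intro CollectI ballI allI impI)
        fix b t assume b: "(b::'a) \<in> Basis" and t: "\<bar>t\<bar> \<le> 1 / real (Suc m)"
        show "\<bar>f (x + t *\<^sub>R b) - f x - t * (v \<bullet> b)\<bar> \<le> \<bar>t\<bar> / real (Suc k)"
        proof (cases "t = 0")
          case False
          have 1: "\<bar>(f (x + t *\<^sub>R b) - f x) / t - c b\<bar> < \<delta>"
            using db(2)[OF b False] t m d0(2)[OF b] by linarith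
          have "\<bar>v \<bullet> b - c b\<bar> = \<bar>(v - g) \<bullet> b\<bar>" by (simp add: gb[OF b] inner_diff_left)
          also have "\<dots> \<le> norm (v - g)" using b Basis_le_norm by blast
          also have "\<dots> < \<delta>" using v(2) by (simp add: dist_norm norm_minus_commute)
          finally have 2: "\<bar>v \<bullet> b - c b\<bar> < \<delta>" .
          have "\<bar>(f (x + t *\<^sub>R b) - f x) / t - v \<bullet> b\<bar> < 2 * \<delta>" using 1 2 by linarith
          then have "\<bar>t\<bar> * \<bar>(f (x + t *\<^sub>R b) - f x) / t - v \<bullet> b\<bar> \<le> \<bar>t\<bar> * (2 * \<delta>)"
            by (intro mult_left_mono) auto
          moreover have "\<bar>t\<bar> * \<bar>(f (x + t *\<^sub>R b) - f x) / t - v \<bullet> b\<bar> = \<bar>f (x + t *\<^sub>R b) - f x - t * (v \<bullet> b)\<bar>"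
          proof -
            have "t * ((f (x + t *\<^sub>R b) - f x) / t - v \<bullet> b) = f (x + t *\<^sub>R b) - f x - t * (v \<bullet> b)"
              using False by (simp add: field_simps)
            then show ?thesis by (metis abs_mult)
          qed
          moreover have "\<bar>t\<bar> * (2 * \<delta>) = \<bar>t\<bar> / real (Suc k)" by (simp add: \<delta>_def field_simps)
          ultimately show ?thesis by linarith
        qed simp
      qed
      define cc where "cc = e1 / (2 * (L + 1) * (?n + 1))"
      have cc: "cc > 0" using e1 n1 L0 by (simp add: cc_def)
      define cm where "cm = min cc (1 / (?n + 1))"
      have cm: "cm > 0" using cc n1 by (simp add: cm_def)
      obtain j where j: "1 / real (Suc j) < cm" using cm nat_approx_posE by blast
      define \<rho> where "\<rho> = 1 / real (Suc j)"
      have \<rho>: "\<rho> > 0" "\<rho> < cc" "\<rho> * (?n + 1) < 1"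
        using j n1 by (auto simp: \<rho>_def cm_def field_simps)
      have "x \<notin> P v k m j" using x v(1) by (auto simp: N_def)
      then have "\<not> porous_at \<rho> (S v k m) x" using xS by (simp add: P_def \<rho>_def)
      then obtain d1 where d1: "d1 > 0"
        "\<And>t y. 0 < t \<Longrightarrow> t < d1 \<Longrightarrow> ball y (\<rho> * t) \<subseteq> ball x t \<Longrightarrow> ball y (\<rho> * t) \<inter> S v k m \<noteq> {}"
        unfolding porous_at_def by blast
      define d where "d = min (d1 / (?n + 1)) (1 / real (Suc m))"
      have d: "d > 0" using d1 n1 by (simp add: d_def)
      have main: "norm (f y - f x - g \<bullet> (y - x)) \<le> e * norm (y - x)" if y: "norm (y - x) < d" for y
      proof (cases "y = x")
        case False
        define h where "h = y - x"
        define s where "s = norm h"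
        have s: "s > 0" using False by (simp add: s_def h_def)
        have sd: "s < d" using y by (simp add: s_def h_def)
        \<comment> \<open>The corners of the walk stay within \<open>?n * s\<close> of
          \<open>x\<close>. The additional \<open>s\<close> leaves room for a ball of radius
          \<open>\<rho> * t\<close> around each of them.\<close>
        define t where "t = (?n + 1) * s"
        have t: "0 < t" "t < d1"
        proof -
          show "0 < t" using s n1 by (simp add: t_def)
          have "s < d1 / (?n + 1)" using sd by (simp add: d_def)
          then show "t < d1" using n1 by (simp add: t_def field_simps)
        qed
        have hb: "\<bar>h \<bullet> b\<bar> \<le> s" if "b \<in> Basis" for b using that Basis_le_norm s_def by blast
        define z where "z B = x + (\<Sum>b\<in>B. (h \<bullet> b) *\<^sub>R b)" for B
        have zx: "norm (z B - x) \<le> ?n * s" if "B \<subseteq> Basis" for B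
        proof -
          have "norm (z B - x) \<le> (\<Sum>b\<in>B. norm ((h \<bullet> b) *\<^sub>R b))"
            unfolding z_def add_diff_cancel_left' by (rule norm_sum)
          also have "\<dots> \<le> (\<Sum>b\<in>B. s)"
            using that hb by (intro sum_mono) (auto simp: subset_iff)
          also have "\<dots> = real (card B) * s" by simp
          also have "\<dots> \<le> ?n * s"
            using that s by (intro mult_right_mono) (auto intro: card_mono)
          finally show ?thesis .
        qed
        \<comment> \<open>The tolerance of \<open>S v k m\<close> at an auxiliary point
          \<open>w\<close>, plus the cost of moving both ends of a step from the corner to
          \<open>w\<close>.\<close>
        define \<kappa> where "\<kappa> = 1 / real (Suc k) + 2 * L * \<rho> * (?n + 1)"
        have step: "\<bar>f (z B + (h \<bullet> b) *\<^sub>R b) - f (z B) - (h \<bullet> b) * (v \<bullet> b)\<bar> \<le> \<kappa> * s"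
          if B: "B \<subseteq> Basis" and b: "b \<in> Basis" for B b
        proof -
          have "ball (z B) (\<rho> * t) \<subseteq> ball x t"
          proof
            fix w assume "w \<in> ball (z B) (\<rho> * t)"
            then have "norm (w - z B) < \<rho> * t" by (simp add: dist_norm norm_minus_commute)
            also have "\<rho> * t = (\<rho> * (?n + 1)) * s" by (simp add: t_def)
            also have "\<dots> \<le> s" using \<rho>(3) s by (intro mult_left_le_one_le) (use \<rho>(1) n1 in auto)
            finally have "norm (w - z B) < s" .
            moreover have "norm (w - x) \<le> norm (w - z B) + norm (z B - x)"
              using norm_triangle_ineq[of "w - z B" "z B - x"] by simp
            ultimately have "norm (w - x) < t" using zx[OF B] by (simp add: t_def algebra_simps)
            then show "w \<in> ball x t" by (simp add: dist_norm norm_minus_commute)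
          qed
          then obtain w where w: "w \<in> ball (z B) (\<rho> * t)" "w \<in> S v k m"
            using d1(2)[OF t] by blast
          have wz: "norm (w - z B) \<le> \<rho> * t" using w(1) by (simp add: dist_norm norm_minus_commute)
          have "s \<le> 1 / real (Suc m)" using sd by (simp add: d_def)
          then have "\<bar>h \<bullet> b\<bar> \<le> 1 / real (Suc m)" using hb[OF b] by linarith
          then have 1: "\<bar>f (w + (h \<bullet> b) *\<^sub>R b) - f w - (h \<bullet> b) * (v \<bullet> b)\<bar> \<le> \<bar>h \<bullet> b\<bar> / real (Suc k)"
            using w(2) b unfolding S_def by blast
          have 2: "\<bar>h \<bullet> b\<bar> / real (Suc k) \<le> s / real (Suc k)"
            using hb[OF b] by (intro divide_right_mono) auto
          have 3: "\<bar>f (z B) - f w\<bar> \<le> L * (\<rho> * t)"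
            using lipD[of "z B" w] wz L0 by (smt (verit) mult_left_mono norm_minus_commute)
          have 4: "\<bar>f (z B + (h \<bullet> b) *\<^sub>R b) - f (w + (h \<bullet> b) *\<^sub>R b)\<bar> \<le> L * (\<rho> * t)"
            using lipD[of "z B + (h \<bullet> b) *\<^sub>R b" "w + (h \<bullet> b) *\<^sub>R b"] wz L0
            by (smt (verit) add_diff_cancel_right mult_left_mono norm_minus_commute)
          have "\<kappa> * s = s / real (Suc k) + 2 * (L * (\<rho> * t))"
            by (simp add: \<kappa>_def t_def algebra_simps)
          then show ?thesis using 1 2 3 4 by linarith
        qed
        have tele: "\<bar>f (z B) - f x - (\<Sum>b\<in>B. (h \<bullet> b) * (v \<bullet> b))\<bar> \<le> real (card B) * (\<kappa> * s)"
          if "finite B" "B \<subseteq> Basis" for B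
          using that
        proof (induction B rule: finite_induct)
          case empty
          then show ?case by (simp add: z_def)
        next
          case (insert b B)
          have "z (insert b B) = z B + (h \<bullet> b) *\<^sub>R b"
            using insert.hyps by (simp add: z_def algebra_simps)
          then have "\<bar>f (z (insert b B)) - f (z B) - (h \<bullet> b) * (v \<bullet> b)\<bar> \<le> \<kappa> * s"
            using step[of B b] insert.prems by simp
          moreover have "\<bar>f (z B) - f x - (\<Sum>b\<in>B. (h \<bullet> b) * (v \<bullet> b))\<bar> \<le> real (card B) * (\<kappa> * s)"
            using insert by simp
          moreover have "(\<Sum>b\<in>insert b B. (h \<bullet> b) * (v \<bullet> b)) = (h \<bullet> b) * (v \<bullet> b) + (\<Sum>b\<in>B. (h \<bullet> b) * (v \<bullet> b))"
            using insert.hyps by simp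
          moreover have "real (card (insert b B)) * (\<kappa> * s) = real (card B) * (\<kappa> * s) + \<kappa> * s"
            using insert.hyps by (simp add: algebra_simps)
          ultimately show ?case by linarith
        qed
        have zB: "z Basis = y" by (simp add: z_def h_def euclidean_representation)
        have vs: "(\<Sum>b\<in>Basis. (h \<bullet> b) * (v \<bullet> b)) = v \<bullet> h"
          by (simp add: euclidean_inner[of v h] mult.commute)
        have A: "\<bar>f y - f x - v \<bullet> h\<bar> \<le> ?n * (\<kappa> * s)"
          using tele[of Basis] by (simp add: zB vs)
        have "\<kappa> \<le> 2 * e1"
        proof -
          have "2 * L * \<rho> * (?n + 1) \<le> (2 * (L + 1) * (?n + 1)) * \<rho>"
            using \<rho>(1) n1 L0 by (simp add: algebra_simps)
          also have "\<dots> \<le> (2 * (L + 1) * (?n + 1)) * cc"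
            using \<rho>(2) n1 L0 by (intro mult_left_mono) auto
          also have "\<dots> = e1" using n1 L0 by (simp add: cc_def)
          finally show ?thesis using k by (simp add: \<kappa>_def)
        qed
        then have "?n * (\<kappa> * s) \<le> ?n * (2 * e1 * s)"
          using s n1 by (intro mult_left_mono mult_right_mono) auto
        also have "\<dots> = e / 2 * s" using n1 by (simp add: e1_def)
        finally have B: "\<bar>f y - f x - v \<bullet> h\<bar> \<le> e / 2 * s" using A by linarith
        have "\<bar>(v - g) \<bullet> h\<bar> \<le> norm (v - g) * s" unfolding s_def by (rule Cauchy_Schwarz_ineq2)
        also have "\<dots> \<le> (e / 2) * s"
        proof (intro mult_right_mono)
          have "norm (v - g) < \<delta>" using v(2) by (simp add: dist_norm norm_minus_commute)
          also have "\<delta> \<le> e1" using k \<delta> unfolding \<delta>_def by linarith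
          also have "e1 \<le> e / 2"
          proof -
            have "2 \<le> 4 * ?n" using n1 by linarith
            then show ?thesis unfolding e1_def using e by (intro divide_left_mono) auto
          qed
          finally show "norm (v - g) \<le> e / 2" by simp
        qed (use s in simp)
        finally have "\<bar>v \<bullet> h - g \<bullet> h\<bar> \<le> e / 2 * s" by (simp only: inner_diff_left)
        moreover have "e / 2 * s + e / 2 * s = e * s" by simp
        ultimately have "\<bar>f y - f x - g \<bullet> h\<bar> \<le> e * s" using B by linarith
        then show ?thesis by (simp add: s_def h_def)
      qed simp
      show ?thesis using d main by blast
    qed
    then have "(f has_derivative (\<lambda>h. g \<bullet> h)) (at x)"
      unfolding has_derivative_at_alt by (auto intro: bounded_linear_inner_right)
    then show ?thesis by (auto simp: differentiable_def)
  qed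
  then show ?thesis using that negN by blast
qed

lemma rademacher:
  fixes f :: "'a::euclidean_space \<Rightarrow> 'b::euclidean_space"
  assumes lip: "L-lipschitz_on UNIV f"
  obtains N where "negligible N" "\<And>x. x \<notin> N \<Longrightarrow> f differentiable (at x)"
proof -
  have "L-lipschitz_on UNIV (\<lambda>x. f x \<bullet> b)" if "b \<in> Basis" for b
  proof (rule lipschitz_onI)
    fix x y
    have "dist (f x \<bullet> b) (f y \<bullet> b) = \<bar>(f x - f y) \<bullet> b\<bar>" by (simp add: dist_real_def inner_diff_left)
    also have "\<dots> \<le> norm (f x - f y)" using Basis_le_norm that by blast
    also have "\<dots> \<le> L * dist x y" using lipschitz_onD[OF lip, of x y] by (simp add: dist_norm)
    finally show "dist (f x \<bullet> b) (f y \<bullet> b) \<le> L * dist x y" .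
  qed (rule lipschitz_on_nonneg[OF lip])
  then have "\<forall>b\<in>Basis. \<exists>N. negligible N \<and> (\<forall>x. x \<notin> N \<longrightarrow> (\<lambda>x. f x \<bullet> b) differentiable (at x))"
    using rademacher_real by metis
  then obtain N where N: "\<And>b. b \<in> Basis \<Longrightarrow> negligible (N b)"
     "\<And>b x. b \<in> Basis \<Longrightarrow> x \<notin> N b \<Longrightarrow> (\<lambda>x. f x \<bullet> b) differentiable (at x)"
    by metis
  have "negligible (\<Union>b\<in>Basis. N b)" using N(1) by (intro negligible_Union) auto
  moreover have "f differentiable (at x)" if "x \<notin> (\<Union>b\<in>Basis. N b)" for x
    using that N(2) by (subst differentiable_componentwise_within) auto
  ultimately show ?thesis using that by blast
qed

section \<open>Second order expansions of convex functions\<close>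

text \<open>The inequality is global. Convexity of \<open>f\<close> is expressed below by the
  existence of such a \<open>g\<close> at every point.\<close>

definition subgradient :: "('a::real_inner \<Rightarrow> real) \<Rightarrow> 'a \<Rightarrow> 'a \<Rightarrow> bool" where
  "subgradient f z g \<longleftrightarrow> (\<forall>y. f z + g \<bullet> (y - z) \<le> f y)"

lemma subgradientD: "subgradient f z g \<Longrightarrow> f z + g \<bullet> (y - z) \<le> f y"
  by (simp add: subgradient_def)

lemma subgradient_monotone:
  assumes "subgradient f x g" "subgradient f y h"
  shows "0 \<le> (g - h) \<bullet> (x - y)"
  using subgradientD[OF assms(1), of y] subgradientD[OF assms(2), of x]
  by (simp add: algebra_simps)

text \<open>The point \<open>z\<close> minimises \<open>f\<close> plus half the squared distance
  from \<open>w\<close>. Choosing it for every \<open>w\<close> gives the resolvent, which by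
  monotonicity of subgradients is 1-Lipschitz and hence accessible to Rademacher's theorem.\<close>

lemma resolvent_exists:
  fixes f :: "'a::euclidean_space \<Rightarrow> real"
  assumes cont: "continuous_on UNIV f" and sub: "\<And>z. \<exists>g. subgradient f z g"
  shows "\<exists>z. subgradient f z (w - z)"
proof -
  define F where "F z = f z + (norm (z - w))\<^sup>2 / 2" for z
  obtain g0 where g0: "subgradient f w g0" using sub by blast
  have contF: "continuous_on S F" for S
    unfolding F_def by (intro continuous_intros continuous_on_subset[OF cont]) auto
  \<comment> \<open>The subgradient \<open>g0\<close> at \<open>w\<close> limits how fast
    \<open>f\<close> can decrease, so beyond the radius \<open>2 * norm g0\<close> the quadratic
    term keeps \<open>F\<close> above \<open>F w\<close>.\<close>
  obtain z where z: "z \<in> cball w (2 * norm g0)" "\<And>y. y \<in> cball w (2 * norm g0) \<Longrightarrow> F z \<le> F y"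
    using continuous_attains_inf[OF compact_cball _ contF, of w "2 * norm g0"] by auto
  have min: "F z \<le> F y" for y
  proof (cases "y \<in> cball w (2 * norm g0)")
    case False
    then have far: "norm (y - w) > 2 * norm g0" by (simp add: dist_norm norm_minus_commute)
    have "F z \<le> F w" using z(2)[of w] by simp
    moreover have "F w = f w" by (simp add: F_def)
    moreover have "f w + g0 \<bullet> (y - w) \<le> f y" by (rule subgradientD[OF g0])
    moreover have "- (norm g0 * norm (y - w)) \<le> g0 \<bullet> (y - w)"
      using Cauchy_Schwarz_ineq2[of g0 "y - w"] by linarith
    moreover have "2 * norm g0 * norm (y - w) \<le> norm (y - w) * norm (y - w)"
      using far by (intro mult_right_mono) auto
    ultimately show ?thesis unfolding F_def[of y] power2_eq_square by linarith
  qed (rule z(2))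
  have "f z + (w - z) \<bullet> (y - z) \<le> f y" for y
  proof -
    define d where "d = y - z"
    \<comment> \<open>Compare \<open>z\<close> with a point a fraction \<open>t\<close> of the way
      to \<open>y\<close> and divide by \<open>t\<close>: the quadratic term leaves an error of
      order \<open>t\<close>. The convexity inequality used for this comes from a subgradient at the
      intermediate point.\<close>
    have key: "(w - z) \<bullet> d \<le> f y - f z + t * (norm d)\<^sup>2 / 2" if t: "0 < t" "t \<le> 1" for t
    proof -
      define c where "c = z + t *\<^sub>R d"
      obtain g where g: "subgradient f c g" using sub by blast
      have 1: "f c - t * (g \<bullet> d) \<le> f z"
        using subgradientD[OF g, of z] by (simp add: c_def)
      have "y - c = (1 - t) *\<^sub>R d" by (simp add: c_def d_def algebra_simps)
      then have 2: "f c + (1 - t) * (g \<bullet> d) \<le> f y"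
        using subgradientD[OF g, of y] by simp
      have "(1 - t) * (f c - t * (g \<bullet> d)) + t * (f c + (1 - t) * (g \<bullet> d)) \<le> (1 - t) * f z + t * f y"
        using 1 2 t by (intro add_mono mult_left_mono) auto
      then have cvx: "f c \<le> (1 - t) * f z + t * f y" by (simp add: algebra_simps)
      have "(norm (c - w))\<^sup>2 = (norm (z - w))\<^sup>2 + 2 * t * ((z - w) \<bullet> d) + t\<^sup>2 * (norm d)\<^sup>2"
        unfolding c_def power2_norm_eq_inner
        by (simp add: algebra_simps power2_eq_square inner_commute)
      then have "f z \<le> f c + t * ((z - w) \<bullet> d) + t\<^sup>2 * (norm d)\<^sup>2 / 2"
        using min[of c] unfolding F_def by (simp add: field_simps)
      then have "0 \<le> t * (f y - f z + (z - w) \<bullet> d + t * (norm d)\<^sup>2 / 2)"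
        using cvx by (simp add: algebra_simps power2_eq_square)
      then have "0 \<le> f y - f z + (z - w) \<bullet> d + t * (norm d)\<^sup>2 / 2"
        using t(1) by (simp add: zero_le_mult_iff)
      then show ?thesis by (simp add: algebra_simps)
    qed
    have "(w - z) \<bullet> d \<le> f y - f z"
    proof (rule field_le_epsilon)
      fix e :: real assume e: "0 < e"
      define t where "t = min 1 (e / (1 + (norm d)\<^sup>2))"
      have pos: "0 < 1 + (norm d)\<^sup>2" by (simp add: add_pos_nonneg)
      have t: "0 < t" "t \<le> 1" using e pos by (auto simp: t_def)
      have "t \<le> e / (1 + (norm d)\<^sup>2)" by (simp add: t_def)
      then have "t * (1 + (norm d)\<^sup>2) \<le> e"
        using pos by (simp only: pos_le_divide_eq)
      moreover have "t * (norm d)\<^sup>2 / 2 \<le> t * (1 + (norm d)\<^sup>2)"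
        using t by (simp add: algebra_simps)
      ultimately show "(w - z) \<bullet> d \<le> f y - f z + e" using key[OF t] by linarith
    qed
    then show ?thesis by (simp add: d_def)
  qed
  then show ?thesis by (auto simp: subgradient_def)
qed

lemma resolvent_unique:
  assumes "subgradient f x g" "subgradient f y h" "x + g = y + h"
  shows "x = y"
proof -
  have "g - h = - (x - y)" using assms(3) by (simp add: algebra_simps)
  then have "0 \<le> (- (x - y)) \<bullet> (x - y)"
    using subgradient_monotone[OF assms(1,2)] by metis
  then have "0 \<le> - ((x - y) \<bullet> (x - y))" by (simp only: inner_minus_left)
  then have "(norm (x - y))\<^sup>2 \<le> 0"
    unfolding power2_norm_eq_inner by linarith
  then show ?thesis by simp
qed

lemma resolvent_nonexpansive:
  assumes "subgradient f x (v - x)" "subgradient f y (w - y)"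
  shows "norm (x - y) \<le> norm (v - w)"
proof -
  have "0 \<le> ((v - x) - (w - y)) \<bullet> (x - y)" by (rule subgradient_monotone[OF assms])
  then have "(norm (x - y))\<^sup>2 \<le> (v - w) \<bullet> (x - y)"
    by (simp add: power2_norm_eq_inner algebra_simps)
  also have "\<dots> \<le> norm (v - w) * norm (x - y)" by (rule norm_cauchy_schwarz)
  finally show ?thesis
    by (cases "x = y") (auto simp: power2_eq_square)
qed

context
  fixes f :: "'a::euclidean_space \<Rightarrow> real" and z b :: 'a and C r0 :: real
  assumes C0: "0 \<le> C" and r0: "0 < r0"
    and touch: "\<forall>h. norm h < r0 \<longrightarrow> f (z + h) \<le> f z + b \<bullet> h + C * (norm h)\<^sup>2"
begin

lemma subgradient_at_touching_eq:
  assumes g: "subgradient f z g"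
  shows "g = b"
proof (rule ccontr)
  assume "g \<noteq> b"
  define n where "n = norm (g - b)"
  have n: "n > 0" using \<open>g \<noteq> b\<close> by (simp add: n_def)
  define t where "t = min (r0 / (2 * n)) (1 / (2 * (C + 1)))"
  have t: "t > 0" using n r0 C0 by (simp add: t_def)
  have "t \<le> r0 / (2 * n)" by (simp add: t_def)
  then have "t * n \<le> r0 / 2" using n by (simp add: field_simps)
  then have "norm (t *\<^sub>R (g - b)) < r0" using t r0 by (simp add: n_def[symmetric])
  then have "f (z + t *\<^sub>R (g - b)) \<le> f z + b \<bullet> (t *\<^sub>R (g - b)) + C * (norm (t *\<^sub>R (g - b)))\<^sup>2"
    using touch by blast
  then have "f (z + t *\<^sub>R (g - b)) \<le> f z + t * (b \<bullet> (g - b)) + C * (t * n)\<^sup>2"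
    using t by (simp add: n_def)
  moreover have "f z + t * (g \<bullet> (g - b)) \<le> f (z + t *\<^sub>R (g - b))"
    using subgradientD[OF g, of "z + t *\<^sub>R (g - b)"] by simp
  ultimately have "t * (g \<bullet> (g - b)) - t * (b \<bullet> (g - b)) \<le> C * (t * n)\<^sup>2" by linarith
  moreover have "t * (g \<bullet> (g - b)) - t * (b \<bullet> (g - b)) = t * n\<^sup>2"
    unfolding n_def power2_norm_eq_inner by (simp add: algebra_simps)
  ultimately have "t * n\<^sup>2 \<le> (C * t) * (t * n\<^sup>2)" by (simp add: power2_eq_square mult_ac)
  moreover have "C * t < 1"
  proof -
    have "C * t \<le> C * (1 / (2 * (C + 1)))" using C0 by (intro mult_left_mono) (auto simp: t_def)
    also have "\<dots> < 1" using C0 by (simp add: field_simps)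
    finally show ?thesis .
  qed
  moreover have "0 < t * n\<^sup>2" using t n by simp
  ultimately show False
    by (metis mult_less_cancel_right_disj mult_1 not_le order_less_imp_le)
qed

text \<open>Test the subgradient at \<open>y\<close> at the point \<open>z + h\<close>, with
  \<open>h\<close> of length \<open>2 * norm (y - z)\<close> in the direction \<open>g - b\<close>.
  The gain \<open>2 * norm (y - z) * norm (g - b)\<close> exceeds the loss from starting at
  \<open>y\<close> by a factor 2, and the touching paraboloid bounds what remains. The length of
  \<open>h\<close> is also the reason for \<open>r0 / 2\<close>.\<close>

lemma subgradient_near_touching:
  assumes b: "subgradient f z b" and g: "subgradient f y g" and near: "norm (y - z) < r0 / 2"
  shows "norm (g - b) \<le> 4 * C * norm (y - z)"
proof (cases "y = z \<or> g = b")
  case True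
  then show ?thesis using subgradient_at_touching_eq g C0 by auto
next
  case False
  define v where "v = g - b"
  define s where "s = norm (y - z)"
  have v: "norm v > 0" and s: "s > 0" using False by (auto simp: v_def s_def)
  define h where "h = (2 * s / norm v) *\<^sub>R v"
  have nh: "norm h = 2 * s" using v s by (simp add: h_def)
  have vh: "v \<bullet> h = 2 * s * norm v"
    using v by (simp add: h_def power2_norm_eq_inner[symmetric] power2_eq_square)
  have 1: "f (z + h) \<le> f z + b \<bullet> h + C * (2 * s)\<^sup>2"
  proof -
    have "norm h < r0" using near by (simp add: nh s_def)
    then show ?thesis using touch nh by metis
  qed
  have 2: "f y + g \<bullet> (z + h - y) \<le> f (z + h)" by (rule subgradientD[OF g])
  have 3: "f z + b \<bullet> (y - z) \<le> f y" by (rule subgradientD[OF b])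
  have "v \<bullet> h - v \<bullet> (y - z) \<le> 4 * C * s\<^sup>2"
    using 1 2 3 by (simp add: v_def algebra_simps power2_eq_square)
  moreover have "v \<bullet> (y - z) \<le> norm v * s" unfolding s_def by (rule norm_cauchy_schwarz)
  ultimately have "s * norm v \<le> s * (4 * C * s)"
    unfolding vh by (simp add: power2_eq_square mult_ac)
  then show ?thesis using s by (simp add: v_def s_def)
qed

end

text \<open>Instead of integrating a selection of subgradients along the segment, the increments of
  \<open>f\<close> over \<open>N\<close> equal pieces are bounded by the subgradients at both ends
  of each piece. This gives two Riemann sums of the same linear function, and their difference
  vanishes as \<open>N\<close> grows.\<close>

lemma second_order_expansion:
  fixes f :: "'a::euclidean_space \<Rightarrow> real"
  assumes sub: "\<And>y. \<exists>g. subgradient f y g" and B: "linear B"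
    and grad: "\<And>y g. norm (y - z) < d \<Longrightarrow> subgradient f y g \<Longrightarrow> norm (g - b - B (y - z)) \<le> e * norm (y - z)"
    and h: "norm h < d"
  shows "\<bar>f (z + h) - f z - b \<bullet> h - (h \<bullet> B h) / 2\<bar> \<le> e * (norm h)\<^sup>2"
proof -
  have e0: "0 \<le> e * norm h"
  proof -
    obtain g where "subgradient f (z + h) g" using sub by blast
    then have "norm (g - b - B h) \<le> e * norm h" using grad[of "z + h" g] h by simp
    then show ?thesis using norm_ge_zero order_trans by blast
  qed
  have fin: "\<bar>f (z + h) - f z - b \<bullet> h - (h \<bullet> B h) / 2\<bar> \<le> e * (norm h)\<^sup>2 + \<bar>h \<bullet> B h\<bar> / (2 * real N)"
    if N: "N > 0" for N :: nat
  proof -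
    define c where "c i = z + (real i / real N) *\<^sub>R h" for i :: nat
    have "\<forall>i. \<exists>g. subgradient f (c i) g" using sub by blast
    then obtain g where g: "\<And>i. subgradient f (c i) (g i)" by metis
    define q where "q = h \<bullet> B h"
    define E where "E = e * (norm h)\<^sup>2"
    have est: "\<bar>g i \<bullet> h - b \<bullet> h - real i / real N * q\<bar> \<le> E" if i: "i \<le> N" for i
    proof -
      have le1: "real i / real N \<le> 1" "0 \<le> real i / real N" using i N by auto
      have nc: "norm (c i - z) = real i / real N * norm h" by (simp add: c_def)
      have nc': "norm (c i - z) \<le> norm h"
        unfolding nc using le1 by (intro mult_left_le_one_le) auto
      have "norm (g i - b - B (c i - z)) \<le> e * norm (c i - z)"
        using grad[OF _ g] nc' h by simp
      also have "\<dots> = (real i / real N) * (e * norm h)" by (simp add: nc)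
      also have "\<dots> \<le> e * norm h" using le1 e0 by (intro mult_left_le_one_le) auto
      finally have n: "norm (g i - b - B (c i - z)) \<le> e * norm h" .
      have "B (c i - z) = (real i / real N) *\<^sub>R B h" by (simp add: c_def linear_cmul[OF B])
      then have "(g i - b - B (c i - z)) \<bullet> h = g i \<bullet> h - b \<bullet> h - real i / real N * q"
        by (simp add: q_def inner_diff_left inner_diff_right inner_commute)
      then have "\<bar>g i \<bullet> h - b \<bullet> h - real i / real N * q\<bar> \<le> norm (g i - b - B (c i - z)) * norm h"
        using Cauchy_Schwarz_ineq2 by metis
      also have "\<dots> \<le> (e * norm h) * norm h" using n by (intro mult_right_mono) auto
      finally show ?thesis by (simp add: E_def power2_eq_square mult.assoc)
    qed
    define m where "m = 1 / real N"
    have m: "m > 0" "m * real N = 1" using N by (auto simp: m_def)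
    have diff: "c (Suc i) - c i = m *\<^sub>R h" for i
      by (simp add: c_def m_def add_divide_distrib scaleR_add_left)
    have up: "f (c (Suc i)) - f (c i) \<le> m * (b \<bullet> h + m * real (Suc i) * q + E)" if "Suc i \<le> N" for i
    proof -
      have "f (c (Suc i)) - f (c i) \<le> m * (g (Suc i) \<bullet> h)"
        using subgradientD[OF g[of "Suc i"], of "c i"] diff[of i]
        by (simp add: minus_diff_eq[of "c (Suc i)" "c i", symmetric] del: minus_diff_eq)
      also have "\<dots> \<le> m * (b \<bullet> h + m * real (Suc i) * q + E)"
        using est[OF that] m(1) by (intro mult_left_mono) (auto simp: m_def abs_le_iff)
      finally show ?thesis .
    qed
    have lo: "m * (b \<bullet> h + m * real i * q - E) \<le> f (c (Suc i)) - f (c i)" if "i \<le> N" for i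
    proof -
      have "m * (b \<bullet> h + m * real i * q - E) \<le> m * (g i \<bullet> h)"
        using est[OF that] m(1) by (intro mult_left_mono) (auto simp: m_def abs_le_iff)
      also have "\<dots> \<le> f (c (Suc i)) - f (c i)"
        using subgradientD[OF g[of i], of "c (Suc i)"] diff[of i] by simp
      finally show ?thesis .
    qed
    have UP: "f (c i) - f z \<le> m * real i * (b \<bullet> h + E) + m\<^sup>2 * (real i * (real i + 1) / 2) * q" if "i \<le> N" for i
      using that
    proof (induction i)
      case 0 then show ?case by (simp add: c_def)
    next
      case (Suc i)
      then show ?case using up[of i] by (simp add: field_simps power2_eq_square)
    qed
    have LO: "m * real i * (b \<bullet> h - E) + m\<^sup>2 * (real i * (real i - 1) / 2) * q \<le> f (c i) - f z" if "i \<le> N" for i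
      using that
    proof (induction i)
      case 0 then show ?case by (simp add: c_def)
    next
      case (Suc i)
      then show ?case using lo[of i] by (simp add: field_simps power2_eq_square)
    qed
    have cN: "c N = z + h" using N by (simp add: c_def)
    have m2: "m\<^sup>2 * (real N * (real N + 1) / 2) * q = q / 2 + q * m / 2"
      "m\<^sup>2 * (real N * (real N - 1) / 2) * q = q / 2 - q * m / 2"
      using N by (auto simp: m_def field_simps power2_eq_square)
    have "f (z + h) - f z \<le> b \<bullet> h + E + (q / 2 + q * m / 2)"
      using UP[of N] by (simp only: cN m2 m(2) order_refl mult_1)
    moreover have "b \<bullet> h - E + (q / 2 - q * m / 2) \<le> f (z + h) - f z"
      using LO[of N] by (simp only: cN m2 m(2) order_refl mult_1)
    moreover have "q * m / 2 \<le> \<bar>q\<bar> / (2 * real N)"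
    proof -
      have "q * m / 2 \<le> \<bar>q\<bar> * m / 2" using m by (simp add: mult_right_mono)
      then show ?thesis by (simp add: m_def mult.commute)
    qed
    ultimately show ?thesis unfolding q_def E_def by linarith
  qed
  show ?thesis
  proof (rule field_le_epsilon)
    fix t :: real assume t: "0 < t"
    let ?q = "\<bar>h \<bullet> B h\<bar>"
    obtain N :: nat where N: "?q / t < real N" using reals_Archimedean2 by blast
    then have N0: "N > 0" using t by (metis abs_ge_zero divide_nonneg_pos gr0I less_le_not_le of_nat_0)
    have "?q < real N * t" using N t by (simp add: field_simps)
    then have "?q / (2 * real N) \<le> t" using N0 t by (simp add: field_simps)
    then show "\<bar>f (z + h) - f z - b \<bullet> h - (h \<bullet> B h) / 2\<bar> \<le> e * (norm h)\<^sup>2 + t"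
      using fin[OF N0] by linarith
  qed
qed

text \<open>Only the quadratic form of \<open>B\<close> is seen, so \<open>B\<close> need not be
  symmetric; \<open>symmetric_matrix_of_linear\<close> restores symmetry later.\<close>

definition quad_expansion :: "('a::real_inner \<Rightarrow> real) \<Rightarrow> 'a \<Rightarrow> 'a \<Rightarrow> ('a \<Rightarrow> 'a) \<Rightarrow> bool" where
  "quad_expansion f z b B \<longleftrightarrow> (\<forall>e>0. \<exists>d>0. \<forall>h. norm h < d \<longrightarrow>
     \<bar>f (z + h) - f z - b \<bullet> h - (h \<bullet> B h) / 2\<bar> \<le> e * (norm h)\<^sup>2)"

text \<open>The paraboloid touching from above makes the derivative of the resolvent \<open>J\<close> injective, so the
  subdifferential, which is the inverse of \<open>J\<close> minus the identity, is differentiable at \<open>z\<close>.\<close>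

lemma quad_expansion_at_touching:
  fixes f :: "'a::euclidean_space \<Rightarrow> real"
  assumes sub: "\<And>y. \<exists>g. subgradient f y g"
    and C0: "0 \<le> C" and r0: "0 < r0"
    and touch: "\<forall>h. norm h < r0 \<longrightarrow> f (z + h) \<le> f z + b \<bullet> h + C * (norm h)\<^sup>2"
    and J: "\<And>w. subgradient f (J w) (w - J w)"
    and diff: "J differentiable (at (z + b))"
  shows "\<exists>B. linear B \<and> quad_expansion f z b B"
proof -
  note touching = subgradient_at_touching_eq[OF C0 r0 touch] subgradient_near_touching[OF C0 r0 touch]
  have bz: "subgradient f z b" using sub[of z] touching(1) by metis
  define w where "w = z + b"
  have Jw: "J w = z" using resolvent_unique[OF J[of w] bz] by (simp add: w_def)
  have Jne: "norm (J v - J v') \<le> norm (v - v')" for v v'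
    by (rule resolvent_nonexpansive[OF J J])
  obtain D where D: "(J has_derivative D) (at w)" using diff by (auto simp: differentiable_def w_def)
  have linD: "linear D" using D has_derivative_linear by blast
  have exp: "\<exists>d>0. \<forall>v. norm (v - w) < d \<longrightarrow> norm (J v - z - D (v - w)) \<le> e * norm (v - w)" if "e > 0" for e
    using D that unfolding has_derivative_at_alt by (metis Jw)
  define \<Lambda> where "\<Lambda> = 1 + 4 * C"
  have \<Lambda>: "\<Lambda> > 0" using C0 by (simp add: \<Lambda>_def)
  have expand: "norm (y + g - w) \<le> \<Lambda> * norm (y - z)" if "subgradient f y g" "norm (y - z) < r0 / 2" for y g
  proof -
    have "norm (y + g - w) \<le> norm (y - z) + norm (g - b)"
      using norm_triangle_ineq[of "y - z" "g - b"] by (simp add: w_def algebra_simps)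
    then show ?thesis using touching(2)[OF bz that] by (simp add: \<Lambda>_def algebra_simps)
  qed
  \<comment> \<open>By \<open>expand\<close>, the resolvent moves a point \<open>v\<close> near
    \<open>w\<close> by at least \<open>norm (v - w) / \<Lambda>\<close>. Along a kernel vector of
    \<open>D\<close> the motion would be of smaller order.\<close>
  have injD: "inj D"
  proof (rule linear_injective_0[OF linD, THEN iffD2], intro allI impI, rule ccontr)
    fix k assume k: "D k = 0" "k \<noteq> 0"
    define e where "e = 1 / (2 * \<Lambda>)"
    have e: "e > 0" using \<Lambda> by (simp add: e_def)
    obtain d where d: "d > 0" "\<And>v. norm (v - w) < d \<Longrightarrow> norm (J v - z - D (v - w)) \<le> e * norm (v - w)"
      using exp[OF e] by blast
    define t where "t = min d (r0 / 2) / (2 * norm k)"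
    have t: "t > 0" using d r0 k by (simp add: t_def)
    define v where "v = w + t *\<^sub>R k"
    have "norm (v - w) = min d (r0 / 2) / 2" using k d r0 by (simp add: v_def t_def)
    then have vd: "norm (v - w) < d" "norm (v - w) < r0 / 2" using d r0 by auto
    have v0: "norm (v - w) > 0" using t k by (simp add: v_def)
    have "D (v - w) = 0" using k by (simp add: v_def linear_cmul[OF linD])
    then have 1: "norm (J v - z) \<le> e * norm (v - w)" using d(2)[OF vd(1)] by simp
    have "norm (J v - z) < r0 / 2" using Jne[of v w] vd(2) by (simp add: Jw)
    from expand[OF J this] have "norm (v - w) \<le> \<Lambda> * norm (J v - z)" by simp
    also have "\<dots> \<le> \<Lambda> * (e * norm (v - w))" using 1 \<Lambda> by (intro mult_left_mono) auto
    also have "\<dots> = norm (v - w) / 2" using \<Lambda> by (simp add: e_def)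
    finally show False using v0 by simp
  qed
  obtain E where E: "linear E" "\<And>x. E (D x) = x" "\<And>x. D (E x) = x"
    using linear_injective_isomorphism[OF linD injD] by metis
  have blE: "bounded_linear E" using E(1) linear_conv_bounded_linear by blast
  define M where "M = onorm E + 1"
  have M: "M > 0" "\<And>x. norm (E x) \<le> M * norm x"
  proof -
    show "M > 0" using onorm_pos_le[OF blE] by (simp add: M_def)
    fix x
    have "norm (E x) \<le> onorm E * norm x" by (rule onorm[OF blE])
    also have "\<dots> \<le> M * norm x" by (intro mult_right_mono) (auto simp: M_def)
    finally show "norm (E x) \<le> M * norm x" .
  qed
  define B where "B x = E x - x" for x
  have linB: "linear B" unfolding B_def using E(1) by (intro linear_compose_sub) (auto simp: linear_id[unfolded id_def])
  have grad: "\<exists>d>0. \<forall>y g. norm (y - z) < d \<longrightarrow> subgradient f y g \<longrightarrow>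
      norm (g - b - B (y - z)) \<le> e * norm (y - z)" if e: "e > 0" for e
  proof -
    define e' where "e' = e / (M * \<Lambda>)"
    have e': "e' > 0" using e M \<Lambda> by (simp add: e'_def)
    obtain d where d: "d > 0" "\<And>v. norm (v - w) < d \<Longrightarrow> norm (J v - z - D (v - w)) \<le> e' * norm (v - w)"
      using exp[OF e'] by blast
    define d' where "d' = min (r0 / 2) (d / \<Lambda>)"
    have d': "d' > 0" using r0 d \<Lambda> by (simp add: d'_def)
    have "norm (g - b - B (y - z)) \<le> e * norm (y - z)" if y: "norm (y - z) < d'" and g: "subgradient f y g" for y g
    proof -
      define v where "v = y + g"
      have Jv: "J v = y" using resolvent_unique[OF J[of v] g] by (simp add: v_def)
      have le: "norm (v - w) \<le> \<Lambda> * norm (y - z)"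
        using expand[OF g] y by (simp add: v_def d'_def)
      also have "\<dots> < d" using y \<Lambda> by (simp add: d'_def field_simps)
      finally have "norm (y - z - D (v - w)) \<le> e' * norm (v - w)" using d(2)[of v] Jv by simp
      also have "\<dots> \<le> e' * (\<Lambda> * norm (y - z))" using le e' by (intro mult_left_mono) auto
      finally have 1: "norm (y - z - D (v - w)) \<le> e' * (\<Lambda> * norm (y - z))" .
      have "E (y - z - D (v - w)) = E (y - z) - (v - w)"
        using E(2) linear_diff[OF E(1)] by simp
      then have "g - b - B (y - z) = - E (y - z - D (v - w))"
        by (simp add: B_def v_def w_def)
      then have "norm (g - b - B (y - z)) \<le> M * norm (y - z - D (v - w))" using M(2) by simp
      also have "\<dots> \<le> M * (e' * (\<Lambda> * norm (y - z)))" using 1 M(1) by (intro mult_left_mono) auto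
      also have "\<dots> = e * norm (y - z)" using M(1) \<Lambda> by (simp add: e'_def)
      finally show ?thesis .
    qed
    then show ?thesis using d' by blast
  qed
  have "quad_expansion f z b B"
    unfolding quad_expansion_def
  proof (intro allI impI)
    fix e :: real assume "e > 0"
    from grad[OF this] obtain d where d: "d > 0" "\<And>y g. norm (y - z) < d \<Longrightarrow> subgradient f y g \<Longrightarrow>
      norm (g - b - B (y - z)) \<le> e * norm (y - z)" by blast
    show "\<exists>d>0. \<forall>h. norm h < d \<longrightarrow> \<bar>f (z + h) - f z - b \<bullet> h - (h \<bullet> B h) / 2\<bar> \<le> e * (norm h)\<^sup>2"
    proof (intro exI[of _ d] conjI allI impI)
      fix h :: 'a assume h: "norm h < d"
      show "\<bar>f (z + h) - f z - b \<bullet> h - (h \<bullet> B h) / 2\<bar> \<le> e * (norm h)\<^sup>2"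
        by (rule second_order_expansion[OF sub linB d(2) h])
    qed (rule d(1))
  qed
  then show ?thesis using linB by blast
qed

text \<open>Every slope perturbation \<open>p\<close> for which a maximiser falls into the exceptional set is the image of a
  point of the null set \<open>N\<close> where \<open>J\<close> is not differentiable under a fixed Lipschitz map.\<close>

lemma jensen_alexandrov:
  fixes f :: "'a::euclidean_space \<Rightarrow> real"
  assumes cont: "continuous_on UNIV f" and sub: "\<And>y. \<exists>g. subgradient f y g"
    and Q: "linear Q" "\<And>x y. Q x \<bullet> y = x \<bullet> Q y"
    and r: "0 < r" and \<kappa>: "0 < \<kappa>" and \<delta>: "0 < \<delta>"
    and sphere: "\<And>h. norm h = r \<Longrightarrow> f (z0 + h) \<le> f z0 + P \<bullet> h + (h \<bullet> Q h) / 2 - \<kappa>"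
  obtains z p B where "norm (z - z0) < r" "norm p < \<delta>" "linear B"
    "quad_expansion f z (P + Q (z - z0) + p) B"
    "\<And>h. norm h < r - norm (z - z0) \<Longrightarrow> f (z + h) \<le> f z + (P + Q (z - z0) + p) \<bullet> h + (h \<bullet> Q h) / 2"
proof -
  obtain J where J: "\<And>w. subgradient f (J w) (w - J w)" using resolvent_exists[OF cont sub] by metis
  have Jne: "norm (J v - J v') \<le> norm (v - v')" for v v'
    by (rule resolvent_nonexpansive[OF J J])
  have "1-lipschitz_on UNIV J" using Jne by (auto simp: lipschitz_on_def dist_norm)
  from rademacher[OF this] obtain N where N: "negligible N" "\<And>x. x \<notin> N \<Longrightarrow> J differentiable (at x)"
    by metis
  have blQ: "bounded_linear Q" using Q(1) linear_conv_bounded_linear by blast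
  define M where "M = onorm Q"
  have M: "M \<ge> 0" "\<And>x. norm (Q x) \<le> M * norm x"
    using onorm_pos_le[OF blQ] onorm[OF blQ] by (auto simp: M_def)
  \<comment> \<open>The contact condition \<open>w = z + P + Q (z - z0) + p\<close> with
    \<open>z = J w\<close>, solved for \<open>p\<close>.\<close>
  define \<Psi> where "\<Psi> w = w - J w - P - Q (J w - z0)" for w
  have lip\<Psi>: "norm (\<Psi> v - \<Psi> w) \<le> (2 + M) * norm (v - w)" for v w
  proof -
    have "\<Psi> v - \<Psi> w = (v - w) - (J v - J w) - Q (J v - J w)"
      by (simp add: \<Psi>_def linear_diff[OF Q(1)] algebra_simps)
    then have "norm (\<Psi> v - \<Psi> w) \<le> norm (v - w) + norm (J v - J w) + norm (Q (J v - J w))"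
      using norm_triangle_ineq4[of "v - w - (J v - J w)" "Q (J v - J w)"] norm_triangle_ineq4[of "v - w" "J v - J w"]
      by simp
    moreover have "norm (Q (J v - J w)) \<le> M * norm (v - w)"
      using M Jne[of v w] by (meson mult_left_mono order_trans)
    ultimately show ?thesis using Jne[of v w] by (simp add: algebra_simps)
  qed
  have neg: "negligible (\<Psi> ` N)"
  proof (rule negligible_locally_Lipschitz_image[OF order_refl N(1)])
    fix x
    show "\<exists>T B. open T \<and> x \<in> T \<and> (\<forall>y\<in>N \<inter> T. norm (\<Psi> y - \<Psi> x) \<le> B * norm (y - x))"
      using lip\<Psi> by (intro exI[of _ UNIV] exI[of _ "2 + M"]) auto
  qed
  \<comment> \<open>Tilting by \<open>p\<close> changes values on the sphere by at most
    \<open>\<kappa> / 2\<close>, so the maximum of the tilted function \<open>G\<close> stays in the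
    interior.\<close>
  define \<epsilon> where "\<epsilon> = min \<delta> (\<kappa> / (2 * r))"
  have \<epsilon>: "\<epsilon> > 0" using \<delta> \<kappa> r by (simp add: \<epsilon>_def)
  have "\<not> ball 0 \<epsilon> \<subseteq> \<Psi> ` N"
  proof
    assume "ball 0 \<epsilon> \<subseteq> \<Psi> ` N"
    then have "negligible (ball (0::'a) \<epsilon>)" using neg negligible_subset by blast
    moreover have "ball (0::'a) \<epsilon> \<noteq> {}" using \<epsilon> by simp
    ultimately show False using open_not_negligible[OF open_ball] by blast
  qed
  then obtain p where "p \<in> ball 0 \<epsilon>" and p2: "p \<notin> \<Psi> ` N" by blast
  then have p: "norm p < \<epsilon>" "p \<notin> \<Psi> ` N" by auto
  define G where "G z = f z - (P + p) \<bullet> (z - z0) - ((z - z0) \<bullet> Q (z - z0)) / 2" for z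
  have contG: "continuous_on S G" for S
    unfolding G_def
    by (intro continuous_intros continuous_on_subset[OF cont] bounded_linear.continuous_on[OF blQ]) auto
  obtain z where z: "z \<in> cball z0 r" "\<And>y. y \<in> cball z0 r \<Longrightarrow> G y \<le> G z"
    using continuous_attains_sup[OF compact_cball _ contG, of z0 r] r by auto
  have inner: "norm (z - z0) < r"
  proof (rule ccontr)
    assume "\<not> norm (z - z0) < r"
    then have eq: "norm (z - z0) = r" using z(1) by (simp add: dist_norm norm_minus_commute)
    have "- (p \<bullet> (z - z0)) \<le> norm p * r" using Cauchy_Schwarz_ineq2[of p "z - z0"] eq by simp
    also have "norm p * r \<le> (\<kappa> / (2 * r)) * r"
      using p(1) r by (intro mult_right_mono) (auto simp: \<epsilon>_def)
    also have "\<dots> = \<kappa> / 2" using r by simp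
    finally have "G z \<le> f z0 - \<kappa> / 2"
      using sphere[OF eq] by (simp add: G_def inner_add_left)
    moreover have "G z0 \<le> G z" using z(2)[of z0] r by simp
    moreover have "G z0 = f z0" by (simp add: G_def linear_0[OF Q(1)])
    ultimately show False using \<kappa> by linarith
  qed
  define b where "b = P + Q (z - z0) + p"
  have contact: "f (z + h) \<le> f z + b \<bullet> h + (h \<bullet> Q h) / 2" if "norm h < r - norm (z - z0)" for h
  proof -
    have "norm (z + h - z0) \<le> norm (z - z0) + norm h"
      using norm_triangle_ineq[of "z - z0" h] by (simp add: algebra_simps)
    then have "z + h \<in> cball z0 r" using that by (simp add: dist_norm norm_minus_commute)
    from z(2)[OF this] have "G (z + h) \<le> G z" .
    moreover have "(z + h - z0) \<bullet> Q (z + h - z0) = (z - z0) \<bullet> Q (z - z0) + 2 * (Q (z - z0) \<bullet> h) + h \<bullet> Q h"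
    proof -
      have "z + h - z0 = (z - z0) + h" by simp
      then show ?thesis using Q(2)[of "z - z0" h]
        by (simp only: linear_add[OF Q(1)] inner_add_left inner_add_right) (simp add: inner_commute)
    qed
    moreover have "(P + p) \<bullet> (z + h - z0) = (P + p) \<bullet> (z - z0) + P \<bullet> h + p \<bullet> h"
      by (simp add: algebra_simps)
    moreover have "b \<bullet> h = P \<bullet> h + Q (z - z0) \<bullet> h + p \<bullet> h"
      by (simp add: b_def inner_add_left)
    ultimately show ?thesis unfolding G_def by linarith
  qed
  have touch: "\<forall>h. norm h < r - norm (z - z0) \<longrightarrow> f (z + h) \<le> f z + b \<bullet> h + M * (norm h)\<^sup>2"
  proof (intro allI impI)
    fix h :: 'a assume h: "norm h < r - norm (z - z0)"
    have "h \<bullet> Q h \<le> norm h * norm (Q h)" by (rule norm_cauchy_schwarz)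
    also have "\<dots> \<le> norm h * (M * norm h)" using M by (intro mult_left_mono) auto
    also have "\<dots> = M * (norm h)\<^sup>2" by (simp add: power2_eq_square)
    finally have "h \<bullet> Q h \<le> M * (norm h)\<^sup>2" .
    moreover have "0 \<le> M * (norm h)\<^sup>2" using M(1) by simp
    ultimately have "h \<bullet> Q h / 2 \<le> M * (norm h)\<^sup>2" by linarith
    then show "f (z + h) \<le> f z + b \<bullet> h + M * (norm h)\<^sup>2" using contact[OF h] by linarith
  qed
  have r0: "0 < r - norm (z - z0)" using inner by simp
  have "subgradient f z b"
    using sub[of z] subgradient_at_touching_eq[OF M(1) r0 touch] by metis
  then have "J (z + b) = z" using resolvent_unique[OF J[of "z + b"]] by simp
  then have "\<Psi> (z + b) = p" by (simp add: \<Psi>_def b_def)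
  then have "z + b \<notin> N" using p(2) by blast
  then have "J differentiable (at (z + b))" by (rule N(2))
  from quad_expansion_at_touching[OF sub M(1) r0 touch J this] obtain B where "linear B" "quad_expansion f z b B"
    by blast
  moreover have "norm p < \<delta>" using p(1) by (simp add: \<epsilon>_def)
  ultimately show ?thesis using that[of z p B] inner contact unfolding b_def by blast
qed


section \<open>The theorem on sums\<close>

text \<open>The second order superjet. Subjets get no definition of their own; they appear as
  superjets of \<open>- u\<close>.\<close>

definition upper_jet :: "(real^'n \<Rightarrow> real) \<Rightarrow> real^'n \<Rightarrow> real^'n \<Rightarrow> real^'n^'n \<Rightarrow> bool" where
  "upper_jet u x p X \<longleftrightarrow> (\<forall>e>0. \<exists>d>0. \<forall>h. norm h < d \<longrightarrow>
     u (x + h) \<le> u x + p \<bullet> h + (h \<bullet> (X *v h)) / 2 + e * (norm h)\<^sup>2)"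

text \<open>The supremum runs over a ball only, so \<open>U\<close> is finite on the whole space.
  Adding \<open>c / 2 * (norm x)\<^sup>2\<close> cancels the square of \<open>x\<close> in the
  penalty and leaves a maximum of affine functions. The one attained at \<open>m x\<close> has slope
  \<open>c *\<^sub>R m x\<close>, and these slopes are bounded.\<close>

lemma sup_convolution_exists:
  fixes u :: "'a::euclidean_space \<Rightarrow> real"
  assumes cont: "continuous_on (cball x0 r) u" and r: "0 < r" and c: "0 < c"
  obtains U m where "\<And>x. m x \<in> cball x0 r" "\<And>x. U x = u (m x) - c / 2 * (norm (x - m x))\<^sup>2"
    "\<And>x y. y \<in> cball x0 r \<Longrightarrow> u y - c / 2 * (norm (x - y))\<^sup>2 \<le> U x"
    "\<And>x. subgradient (\<lambda>x. U x + c / 2 * (norm x)\<^sup>2) x (c *\<^sub>R m x)"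
    "continuous_on UNIV (\<lambda>x. U x + c / 2 * (norm x)\<^sup>2)"
proof -
  have "\<exists>m\<in>cball x0 r. \<forall>y\<in>cball x0 r. u y - c / 2 * (norm (x - y))\<^sup>2 \<le> u m - c / 2 * (norm (x - m))\<^sup>2" for x
    by (rule continuous_attains_sup) (use r in \<open>auto intro!: continuous_intros cont\<close>)
  then obtain m where m: "\<And>x. m x \<in> cball x0 r"
    "\<And>x y. y \<in> cball x0 r \<Longrightarrow> u y - c / 2 * (norm (x - y))\<^sup>2 \<le> u (m x) - c / 2 * (norm (x - m x))\<^sup>2"
    by metis
  define U where "U x = u (m x) - c / 2 * (norm (x - m x))\<^sup>2" for x
  let ?f = "\<lambda>x. U x + c / 2 * (norm x)\<^sup>2"
  have sg: "subgradient ?f x (c *\<^sub>R m x)" for x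
    unfolding subgradient_def
  proof
    fix y
    have "u (m x) - c / 2 * (norm (y - m x))\<^sup>2 \<le> U y" unfolding U_def by (rule m(2)[OF m(1)])
    moreover have "c / 2 * (norm y)\<^sup>2 - c / 2 * (norm (y - m x))\<^sup>2 =
      c / 2 * (norm x)\<^sup>2 - c / 2 * (norm (x - m x))\<^sup>2 + c *\<^sub>R m x \<bullet> (y - x)"
      unfolding power2_norm_eq_inner by (simp add: algebra_simps inner_commute)
    ultimately show "?f x + c *\<^sub>R m x \<bullet> (y - x) \<le> ?f y" by (simp add: U_def[of x])
  qed
  define L where "L = c * (norm x0 + r)"
  have nm: "norm (c *\<^sub>R m x) \<le> L" for x
  proof -
    have "norm (m x) \<le> norm x0 + r"
      using m(1)[of x] norm_triangle_ineq[of x0 "m x - x0"] by (simp add: dist_norm norm_minus_commute)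
    then show ?thesis using c by (simp add: L_def mult_left_mono)
  qed
  have one: "?f x - ?f y \<le> L * norm (x - y)" for x y
  proof -
    have "?f x + c *\<^sub>R m x \<bullet> (y - x) \<le> ?f y" by (rule subgradientD[OF sg])
    moreover have "\<bar>c *\<^sub>R m x \<bullet> (y - x)\<bar> \<le> norm (c *\<^sub>R m x) * norm (y - x)" by (rule Cauchy_Schwarz_ineq2)
    moreover have "norm (c *\<^sub>R m x) * norm (y - x) \<le> L * norm (x - y)"
      using mult_right_mono[OF nm norm_ge_zero] by (metis norm_minus_commute)
    ultimately show ?thesis by linarith
  qed
  have "L-lipschitz_on UNIV ?f"
  proof (rule lipschitz_onI)
    fix x y
    have "\<bar>?f x - ?f y\<bar> \<le> L * norm (x - y)"
      using one[of x y] one[of y x] unfolding norm_minus_commute[of y x] by linarith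
    then show "dist (?f x) (?f y) \<le> L * dist x y" by (simp only: dist_real_def dist_norm)
  qed (use nm[of x0] norm_ge_zero order_trans in blast)
  then have "continuous_on UNIV ?f" by (rule lipschitz_on_continuous_on)
  then show ?thesis using that[of m U] m sg by (simp add: U_def)
qed

text \<open>Shifting \<open>x\<close> and \<open>m\<close> by the same \<open>h\<close> leaves the
  penalty unchanged, so near \<open>m\<close> the function \<open>u\<close> lies below a translate
  of \<open>U\<close>, with equality at \<open>m\<close>. It has to be an interior point because
  only points of the ball compete.\<close>

lemma sup_convolution_jet:
  fixes u U :: "real^'n \<Rightarrow> real"
  assumes dom: "\<And>x y. y \<in> cball x0 r \<Longrightarrow> u y - c / 2 * (norm (x - y))\<^sup>2 \<le> U x"
    and att: "U x = u m - c / 2 * (norm (x - m))\<^sup>2" and m: "norm (m - x0) < r"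
    and jet: "upper_jet U x p X"
  shows "upper_jet u m p X"
  unfolding upper_jet_def
proof (intro allI impI)
  fix e :: real assume "0 < e"
  then obtain d where d: "d > 0" "\<And>h. norm h < d \<Longrightarrow>
      U (x + h) \<le> U x + p \<bullet> h + (h \<bullet> (X *v h)) / 2 + e * (norm h)\<^sup>2"
    using jet unfolding upper_jet_def by metis
  show "\<exists>d>0. \<forall>h. norm h < d \<longrightarrow> u (m + h) \<le> u m + p \<bullet> h + (h \<bullet> (X *v h)) / 2 + e * (norm h)\<^sup>2"
  proof (intro exI[of _ "min d (r - norm (m - x0))"] conjI allI impI)
    show "0 < min d (r - norm (m - x0))" using d m by simp
    fix h :: "real^'n" assume h: "norm h < min d (r - norm (m - x0))"
    have "norm (m + h - x0) \<le> norm (m - x0) + norm h"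
      using norm_triangle_ineq[of "m - x0" h] by (simp add: algebra_simps)
    then have "m + h \<in> cball x0 r" using h by (simp add: dist_norm norm_minus_commute)
    from dom[OF this, of "x + h"] have "u (m + h) - c / 2 * (norm (x - m))\<^sup>2 \<le> U (x + h)" by simp
    then show "u (m + h) \<le> u m + p \<bullet> h + (h \<bullet> (X *v h)) / 2 + e * (norm h)\<^sup>2"
      using d(2)[of h] h att by simp
  qed
qed

lemma symmetric_matrix_of_linear:
  fixes T :: "real^'n \<Rightarrow> real^'n"
  assumes "linear T"
  obtains X where "X \<in> Sym" "\<And>h. h \<bullet> (X *v h) = h \<bullet> T h"
proof -
  define X where "X = (1 / 2) *\<^sub>R (matrix T + transpose (matrix T))"
  have "X \<in> Sym" by (simp add: X_def Sym_def transpose_def vec_eq_iff)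
  moreover have "h \<bullet> (X *v h) = h \<bullet> T h" for h
  proof -
    have T: "matrix T *v h = T h"
      using matrix_vector_mul(2)[OF assms] by metis
    have "h \<bullet> (transpose (matrix T) *v h) = h \<bullet> T h"
      by (metis T dot_lmul_matrix inner_commute transpose_matrix_vector)
    then show ?thesis
      by (simp add: X_def T scaleR_matrix_vector_assoc[symmetric] matrix_vector_mult_add_rdistrib inner_add_right)
  qed
  ultimately show ?thesis using that by blast
qed

text \<open>On the product space the convexified sum of the two sup-convolutions has a second order
  expansion at a contact point arbitrarily close to the given one, and jets of sup-convolutions pass
  to the original functions. Points and slopes are only \<delta>-close to the given ones: no limit
  is taken, so the matrices need no lower bound. The strictness \<tau> keeps the perturbed maximum
  away from the boundary.\<close>

lemma theorem_on_sums:
  fixes u w :: "real^'n \<Rightarrow> real" and Q :: "(real^'n) \<times> (real^'n) \<Rightarrow> (real^'n) \<times> (real^'n)"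
  assumes r: "0 < r" and contu: "continuous_on (cball x0 r) u" and contw: "continuous_on (cball y0 r) w"
    and Q: "linear Q" "\<And>x y. Q x \<bullet> y = x \<bullet> Q y"
    and \<tau>: "0 < \<tau>" and \<delta>: "0 < \<delta>"
    and bound: "\<And>h k. norm h \<le> r \<Longrightarrow> norm k \<le> r \<Longrightarrow>
      u (x0 + h) + w (y0 + k) \<le> u x0 + w y0 + P1 \<bullet> h + P2 \<bullet> k + ((h, k) \<bullet> Q (h, k)) / 2 - \<tau> * (norm (h, k))\<^sup>2"
  obtains x y p q X Y where "norm (x - x0) < \<delta>" "norm (y - y0) < \<delta>" "norm (p - P1) < \<delta>" "norm (q - P2) < \<delta>"
    "X \<in> Sym" "Y \<in> Sym" "upper_jet u x p X" "upper_jet w y q Y"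
    "\<And>h k. h \<bullet> (X *v h) + k \<bullet> (Y *v k) \<le> (h, k) \<bullet> Q (h, k)"
proof -
  have blQ: "bounded_linear Q" using Q(1) linear_conv_bounded_linear by blast
  define M where "M = onorm Q + 1"
  have M: "M > 0" "\<And>x. norm (Q x) \<le> M * norm x"
  proof -
    show "M > 0" using onorm_pos_le[OF blQ] by (simp add: M_def)
    fix x
    have "norm (Q x) \<le> onorm Q * norm x" by (rule onorm[OF blQ])
    also have "\<dots> \<le> M * norm x" by (intro mult_right_mono) (auto simp: M_def)
    finally show "norm (Q x) \<le> M * norm x" .
  qed
  define r1 where "r1 = min (r / 2) (min (\<delta> / 2) (\<delta> / (2 * M)))"
  have r1: "0 < r1" "r1 \<le> r / 2" "r1 \<le> \<delta> / 2" "M * r1 \<le> \<delta> / 2"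
  proof -
    show "0 < r1" "r1 \<le> r / 2" "r1 \<le> \<delta> / 2" using r \<delta> M(1) by (auto simp: r1_def)
    have "r1 \<le> \<delta> / (2 * M)" by (simp add: r1_def)
    then show "M * r1 \<le> \<delta> / 2" using M(1) by (simp add: field_simps)
  qed
  \<comment> \<open>On the sphere of radius \<open>r1\<close> the strictness is worth
    \<open>4 * \<kappa>\<close>. The two sup-convolutions cost at most \<open>\<kappa> / 2\<close>
    each, and \<open>jensen_alexandrov\<close> asks for \<open>\<kappa>\<close>.\<close>
  define \<kappa> where "\<kappa> = \<tau> * r1\<^sup>2 / 4"
  have \<kappa>: "\<kappa> > 0" using \<tau> r1 by (simp add: \<kappa>_def)
  have "bounded (u ` cball x0 r)" "bounded (w ` cball y0 r)"
    using contu contw by (auto intro!: compact_imp_bounded compact_continuous_image)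
  then obtain K1 K2 where K12: "\<And>x. x \<in> cball x0 r \<Longrightarrow> \<bar>u x\<bar> \<le> K1" "\<And>y. y \<in> cball y0 r \<Longrightarrow> \<bar>w y\<bar> \<le> K2"
    unfolding bounded_iff by (metis image_eqI real_norm_def)
  define K where "K = max K1 K2 + 1"
  have K: "\<And>x. x \<in> cball x0 r \<Longrightarrow> \<bar>u x\<bar> \<le> K" "\<And>y. y \<in> cball y0 r \<Longrightarrow> \<bar>w y\<bar> \<le> K"
    using K12 by (force simp: K_def)+
  have Kpos: "K > 0"
  proof -
    have "0 \<le> K1" using K12(1)[of x0] r by force
    then show ?thesis by (simp add: K_def)
  qed
  have "uniformly_continuous_on (cball x0 r) u" "uniformly_continuous_on (cball y0 r) w"
    using contu contw by (auto intro: compact_uniformly_continuous)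
  then obtain t1 t2 where t1: "t1 > 0" "\<And>x y. x \<in> cball x0 r \<Longrightarrow> y \<in> cball x0 r \<Longrightarrow> dist y x < t1 \<Longrightarrow> dist (u y) (u x) < \<kappa> / 2"
    and t2: "t2 > 0" "\<And>x y. x \<in> cball y0 r \<Longrightarrow> y \<in> cball y0 r \<Longrightarrow> dist y x < t2 \<Longrightarrow> dist (w y) (w x) < \<kappa> / 2"
    unfolding uniformly_continuous_on_def using \<kappa> half_gt_zero by metis
  define \<theta> where "\<theta> = min (min t1 t2) (min (\<delta> / 2) (r / 2))"
  have \<theta>: "\<theta> > 0" "\<theta> \<le> t1" "\<theta> \<le> t2" "\<theta> \<le> \<delta> / 2" "\<theta> \<le> r / 2" using t1 t2 \<delta> r by (auto simp: \<theta>_def)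
  \<comment> \<open>A maximiser pays a penalty of at most \<open>2 * K\<close>, while a displacement
    of \<open>\<theta>\<close> would cost \<open>4 * K\<close>. So \<open>m\<close> and
    \<open>n\<close> move points of the balls by less than \<open>\<theta>\<close>.\<close>
  define c where "c = 8 * K / \<theta>\<^sup>2"
  have c: "c > 0" using Kpos \<theta> by (simp add: c_def)
  obtain U m where Um: "\<And>x. m x \<in> cball x0 r" "\<And>x. U x = u (m x) - c / 2 * (norm (x - m x))\<^sup>2"
    "\<And>x y. y \<in> cball x0 r \<Longrightarrow> u y - c / 2 * (norm (x - y))\<^sup>2 \<le> U x"
    "\<And>x. subgradient (\<lambda>x. U x + c / 2 * (norm x)\<^sup>2) x (c *\<^sub>R m x)"
    "continuous_on UNIV (\<lambda>x. U x + c / 2 * (norm x)\<^sup>2)"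
    by (rule sup_convolution_exists[OF contu r c]) (rule that)
  obtain W n where Wn: "\<And>x. n x \<in> cball y0 r" "\<And>x. W x = w (n x) - c / 2 * (norm (x - n x))\<^sup>2"
    "\<And>x y. y \<in> cball y0 r \<Longrightarrow> w y - c / 2 * (norm (x - y))\<^sup>2 \<le> W x"
    "\<And>x. subgradient (\<lambda>x. W x + c / 2 * (norm x)\<^sup>2) x (c *\<^sub>R n x)"
    "continuous_on UNIV (\<lambda>x. W x + c / 2 * (norm x)\<^sup>2)"
    by (rule sup_convolution_exists[OF contw r c]) (rule that)
  have close: "norm (x - y) < \<theta>"
    if "a - c / 2 * (norm (x - y))\<^sup>2 \<ge> b" "\<bar>a\<bar> \<le> K" "\<bar>b\<bar> \<le> K" for a b :: real and x y :: "real^'n"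
  proof -
    have "c / 2 * (norm (x - y))\<^sup>2 \<le> 2 * K" using that by linarith
    also have "\<dots> < c / 2 * \<theta>\<^sup>2" using Kpos \<theta> by (simp add: c_def)
    finally have "(norm (x - y))\<^sup>2 < \<theta>\<^sup>2" using c by simp
    then show ?thesis using \<theta>(1) by (simp add: power2_less_imp_less)
  qed
  have Uge: "u x \<le> U x" if "x \<in> cball x0 r" for x using Um(3)[OF that, of x] by simp
  have Wge: "w x \<le> W x" if "x \<in> cball y0 r" for x using Wn(3)[OF that, of x] by simp
  have mclose: "norm (x - m x) < \<theta>" if "x \<in> cball x0 r" for x
    using Uge[OF that] K(1)[OF that] K(1)[OF Um(1)] by (intro close[of "u x" "u (m x)"]) (simp_all only: Um(2)[symmetric])
  have nclose: "norm (x - n x) < \<theta>" if "x \<in> cball y0 r" for x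
    using Wge[OF that] K(2)[OF that] K(2)[OF Wn(1)] by (intro close[of "w x" "w (n x)"]) (simp_all only: Wn(2)[symmetric])
  have Ule: "U x \<le> u x + \<kappa> / 2" if "x \<in> cball x0 r" for x
  proof -
    have "U x \<le> u (m x)" using c by (simp add: Um(2))
    moreover have "dist (u (m x)) (u x) < \<kappa> / 2"
      using mclose[OF that] \<theta>(2) by (intro t1(2) that Um(1)) (simp add: dist_norm norm_minus_commute)
    ultimately show ?thesis unfolding dist_real_def by linarith
  qed
  have Wle: "W x \<le> w x + \<kappa> / 2" if "x \<in> cball y0 r" for x
  proof -
    have "W x \<le> w (n x)" using c by (simp add: Wn(2))
    moreover have "dist (w (n x)) (w x) < \<kappa> / 2"
      using nclose[OF that] \<theta>(3) by (intro t2(2) that Wn(1)) (simp add: dist_norm norm_minus_commute)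
    ultimately show ?thesis unfolding dist_real_def by linarith
  qed
  define f where "f z = (U (fst z) + c / 2 * (norm (fst z))\<^sup>2) + (W (snd z) + c / 2 * (norm (snd z))\<^sup>2)" for z
  have contf: "continuous_on UNIV f"
    unfolding f_def by (intro continuous_intros continuous_on_compose2[OF Um(5)] continuous_on_compose2[OF Wn(5)]) auto
  have subf: "\<exists>g. subgradient f z g" for z
  proof -
    have "subgradient f z (c *\<^sub>R m (fst z), c *\<^sub>R n (snd z))"
      unfolding subgradient_def
    proof
      fix y
      show "f z + (c *\<^sub>R m (fst z), c *\<^sub>R n (snd z)) \<bullet> (y - z) \<le> f y"
        using subgradientD[OF Um(4)[of "fst z"], of "fst y"] subgradientD[OF Wn(4)[of "snd z"], of "snd y"]
        by (simp add: f_def inner_prod_def)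
    qed
    then show ?thesis by blast
  qed
  define z0 where "z0 = (x0, y0)"
  \<comment> \<open>The convexifying squares contribute \<open>c\<close> to the Hessian and
    \<open>c *\<^sub>R z0\<close> to the slope at \<open>z0\<close>. Both are removed again from the
    slope and the matrices that come out.\<close>
  define Q' where "Q' \<zeta> = Q \<zeta> + c *\<^sub>R \<zeta>" for \<zeta>
  define P' where "P' = (P1, P2) + c *\<^sub>R z0"
  have Q': "linear Q'" "\<And>x y. Q' x \<bullet> y = x \<bullet> Q' y"
  proof -
    show "linear Q'" unfolding Q'_def
      by (intro linear_compose_add Q(1) linear_compose_scale_right linear_id[unfolded id_def])
    show "Q' x \<bullet> y = x \<bullet> Q' y" for x y by (simp add: Q'_def inner_add_left inner_add_right Q(2))
  qed
  have sphere: "f (z0 + \<zeta>) \<le> f z0 + P' \<bullet> \<zeta> + (\<zeta> \<bullet> Q' \<zeta>) / 2 - \<kappa>" if "norm \<zeta> = r1" for \<zeta>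
  proof -
    obtain h k where hk: "\<zeta> = (h, k)" by (cases \<zeta>)
    have nh: "norm h \<le> r" "norm k \<le> r"
      using that norm_fst_le[of h k] norm_snd_le[of k h] r1(2) r by (auto simp: hk)
    have in1: "x0 + h \<in> cball x0 r" "y0 + k \<in> cball y0 r" "x0 \<in> cball x0 r" "y0 \<in> cball y0 r"
      using nh r by (auto simp: dist_norm)
    have "U (x0 + h) + W (y0 + k) \<le> u (x0 + h) + w (y0 + k) + \<kappa>"
      using Ule[OF in1(1)] Wle[OF in1(2)] by linarith
    also have "\<dots> \<le> u x0 + w y0 + P1 \<bullet> h + P2 \<bullet> k + (\<zeta> \<bullet> Q \<zeta>) / 2 - 4 * \<kappa> + \<kappa>"
      using bound[OF nh] that by (simp add: \<kappa>_def hk)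
    also have "\<dots> \<le> U x0 + W y0 + P1 \<bullet> h + P2 \<bullet> k + (\<zeta> \<bullet> Q \<zeta>) / 2 - \<kappa>"
      using Uge[OF in1(3)] Wge[OF in1(4)] \<kappa> by linarith
    finally have 1: "U (x0 + h) + W (y0 + k) \<le> U x0 + W y0 + P1 \<bullet> h + P2 \<bullet> k + (\<zeta> \<bullet> Q \<zeta>) / 2 - \<kappa>" .
    have 2: "c / 2 * (norm (x0 + h))\<^sup>2 + c / 2 * (norm (y0 + k))\<^sup>2 =
       c / 2 * (norm x0)\<^sup>2 + c / 2 * (norm y0)\<^sup>2 + c * (x0 \<bullet> h) + c * (y0 \<bullet> k) + c * (\<zeta> \<bullet> \<zeta>) / 2"
      unfolding power2_norm_eq_inner hk inner_prod_def by (simp add: algebra_simps inner_commute)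
    have 3: "P' \<bullet> \<zeta> = P1 \<bullet> h + P2 \<bullet> k + c * (x0 \<bullet> h) + c * (y0 \<bullet> k)"
      by (simp add: P'_def z0_def hk inner_prod_def algebra_simps)
    have 4: "(\<zeta> \<bullet> Q' \<zeta>) / 2 = (\<zeta> \<bullet> Q \<zeta>) / 2 + c * (\<zeta> \<bullet> \<zeta>) / 2"
      by (simp add: Q'_def inner_add_right add_divide_distrib)
    have 5: "f (z0 + \<zeta>) = U (x0 + h) + W (y0 + k) + (c / 2 * (norm (x0 + h))\<^sup>2 + c / 2 * (norm (y0 + k))\<^sup>2)"
      "f z0 = U x0 + W y0 + (c / 2 * (norm x0)\<^sup>2 + c / 2 * (norm y0)\<^sup>2)"
      by (simp_all add: f_def z0_def hk)
    show ?thesis using 1 unfolding 3 4 5 2 by linarith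
  qed
  have \<delta>2: "0 < \<delta> / 2" using \<delta> by simp
  from jensen_alexandrov[OF contf subf Q' r1(1) \<kappa> \<delta>2 sphere]
  obtain z s B where z: "norm (z - z0) < r1" and s: "norm s < \<delta> / 2" and B: "linear B"
    and expB: "quad_expansion f z (P' + Q' (z - z0) + s) B"
    and contact: "\<And>h. norm h < r1 - norm (z - z0) \<Longrightarrow> f (z + h) \<le> f z + (P' + Q' (z - z0) + s) \<bullet> h + (h \<bullet> Q' h) / 2"
    by blast
  obtain x y where xy: "z = (x, y)" by (cases z)
  define pq where "pq = (P1, P2) + Q (z - z0) + s"
  obtain p q where pq': "pq = (p, q)" by (cases pq)
  have b: "P' + Q' (z - z0) + s = pq + c *\<^sub>R z"
    by (simp add: P'_def Q'_def pq_def algebra_simps)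
  have near: "norm (x - x0) < r1" "norm (y - y0) < r1"
    using z norm_fst_le[of "x - x0" "y - y0"] norm_snd_le[of "y - y0" "x - x0"] by (auto simp: xy z0_def)
  have inb: "x \<in> cball x0 r" "y \<in> cball y0 r"
    using near r1(2) r by (auto simp: dist_norm norm_minus_commute)
  have npq: "norm (pq - (P1, P2)) < \<delta>"
  proof -
    have "norm (Q (z - z0)) \<le> M * r1" using M z by (meson less_imp_le mult_left_mono order_trans)
    then have "norm (Q (z - z0) + s) < \<delta>"
      using s r1(4) norm_triangle_ineq[of "Q (z - z0)" s] by linarith
    then show ?thesis by (simp add: pq_def)
  qed
  have np: "norm (p - P1) < \<delta>" "norm (q - P2) < \<delta>"
    using npq norm_fst_le[of "p - P1" "q - P2"] norm_snd_le[of "q - P2" "p - P1"] by (auto simp: pq')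
  have lin: "linear (\<lambda>h. fst (B (h, 0)) - c *\<^sub>R h)" "linear (\<lambda>h. snd (B (0, h)) - c *\<^sub>R h)"
  proof -
    have a: "B (h + k, 0) = B (h, 0) + B (k, 0)" "B (0, h + k) = B (0, h) + B (0, k)" for h k
      by (simp_all flip: linear_add[OF B])
    have s: "B (t *\<^sub>R h, 0) = t *\<^sub>R B (h, 0)" "B (0, t *\<^sub>R h) = t *\<^sub>R B (0, h)" for t h
      by (simp_all flip: linear_cmul[OF B])
    show "linear (\<lambda>h. fst (B (h, 0)) - c *\<^sub>R h)"
      by (rule linearI) (simp_all only: a s fst_add fst_scaleR scaleR_add_right scaleR_diff_right
          scaleR_left_commute[of c] add_diff_add)
    show "linear (\<lambda>h. snd (B (0, h)) - c *\<^sub>R h)"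
      by (rule linearI) (simp_all only: a s snd_add snd_scaleR scaleR_add_right scaleR_diff_right
          scaleR_left_commute[of c] add_diff_add)
  qed
  \<comment> \<open>Only the diagonal blocks of \<open>B\<close> matter: \<open>f\<close> is a sum
    of functions of separate variables, so its expansion along \<open>(h, 0)\<close> is an expansion
    of \<open>U\<close>, and along \<open>(0, k)\<close> one of \<open>W\<close>.\<close>
  obtain X where X: "X \<in> Sym" "\<And>h. h \<bullet> (X *v h) = h \<bullet> (fst (B (h, 0)) - c *\<^sub>R h)"
    by (rule symmetric_matrix_of_linear[OF lin(1)]) (rule that)
  obtain Y where Y: "Y \<in> Sym" "\<And>h. h \<bullet> (Y *v h) = h \<bullet> (snd (B (0, h)) - c *\<^sub>R h)"
    by (rule symmetric_matrix_of_linear[OF lin(2)]) (rule that)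
  have expU: "\<exists>d>0. \<forall>h. norm h < d \<longrightarrow> \<bar>U (x + h) - U x - p \<bullet> h - (h \<bullet> (X *v h)) / 2\<bar> \<le> e * (norm h)\<^sup>2"
    if e: "e > 0" for e
  proof -
    obtain d where d: "d > 0" "\<And>\<zeta>. norm \<zeta> < d \<Longrightarrow> \<bar>f (z + \<zeta>) - f z - (pq + c *\<^sub>R z) \<bullet> \<zeta> - (\<zeta> \<bullet> B \<zeta>) / 2\<bar> \<le> e * (norm \<zeta>)\<^sup>2"
      using expB e unfolding b quad_expansion_def by metis
    have "\<bar>U (x + h) - U x - p \<bullet> h - (h \<bullet> (X *v h)) / 2\<bar> \<le> e * (norm h)\<^sup>2" if h: "norm h < d" for h
    proof -
      have "f (z + (h, 0)) - f z - (pq + c *\<^sub>R z) \<bullet> (h, 0) - ((h, 0) \<bullet> B (h, 0)) / 2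
         = U (x + h) - U x - p \<bullet> h - (h \<bullet> (X *v h)) / 2"
        unfolding X(2) f_def power2_norm_eq_inner
        by (simp add: xy pq' inner_prod_def algebra_simps inner_commute) (simp add: field_simps)
      then show ?thesis using d(2)[of "(h, 0)"] h by simp
    qed
    then show ?thesis using d(1) by blast
  qed
  have expW: "\<exists>d>0. \<forall>k. norm k < d \<longrightarrow> \<bar>W (y + k) - W y - q \<bullet> k - (k \<bullet> (Y *v k)) / 2\<bar> \<le> e * (norm k)\<^sup>2"
    if e: "e > 0" for e
  proof -
    obtain d where d: "d > 0" "\<And>\<zeta>. norm \<zeta> < d \<Longrightarrow> \<bar>f (z + \<zeta>) - f z - (pq + c *\<^sub>R z) \<bullet> \<zeta> - (\<zeta> \<bullet> B \<zeta>) / 2\<bar> \<le> e * (norm \<zeta>)\<^sup>2"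
      using expB e unfolding b quad_expansion_def by metis
    have "\<bar>W (y + k) - W y - q \<bullet> k - (k \<bullet> (Y *v k)) / 2\<bar> \<le> e * (norm k)\<^sup>2" if k: "norm k < d" for k
    proof -
      have "f (z + (0, k)) - f z - (pq + c *\<^sub>R z) \<bullet> (0, k) - ((0, k) \<bullet> B (0, k)) / 2
         = W (y + k) - W y - q \<bullet> k - (k \<bullet> (Y *v k)) / 2"
        unfolding Y(2) f_def power2_norm_eq_inner
        by (simp add: xy pq' inner_prod_def algebra_simps inner_commute) (simp add: field_simps)
      then show ?thesis using d(2)[of "(0, k)"] k by simp
    qed
    then show ?thesis using d(1) by blast
  qed
  have jetU: "upper_jet U x p X"
    unfolding upper_jet_def
  proof (intro allI impI)
    fix e :: real assume "0 < e"
    from expU[OF this] show "\<exists>d>0. \<forall>h. norm h < d \<longrightarrow> U (x + h) \<le> U x + p \<bullet> h + (h \<bullet> (X *v h)) / 2 + e * (norm h)\<^sup>2"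
      by (elim exE conjE) (rule exI, rule conjI, assumption, smt (verit))
  qed
  have jetW: "upper_jet W y q Y"
    unfolding upper_jet_def
  proof (intro allI impI)
    fix e :: real assume "0 < e"
    from expW[OF this] show "\<exists>d>0. \<forall>h. norm h < d \<longrightarrow> W (y + h) \<le> W y + q \<bullet> h + (h \<bullet> (Y *v h)) / 2 + e * (norm h)\<^sup>2"
      by (elim exE conjE) (rule exI, rule conjI, assumption, smt (verit))
  qed
  \<comment> \<open>Along a small multiple of \<open>(h, k)\<close> the contact inequality bounds
    the increments from above and the expansions bound them from below. The linear parts agree, and
    division by \<open>t\<^sup>2\<close> leaves the quadratic forms.\<close>
  have quad: "h \<bullet> (X *v h) + k \<bullet> (Y *v k) \<le> (h, k) \<bullet> Q (h, k)" for h k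
  proof (rule field_le_epsilon)
    fix e0 :: real assume e0: "0 < e0"
    define S where "S = (norm h)\<^sup>2 + (norm k)\<^sup>2 + 1"
    have S: "S > 0" by (simp add: S_def add_nonneg_pos)
    define e where "e = e0 / (2 * S)"
    have e: "e > 0" using e0 S by (simp add: e_def)
    obtain d1 where d1: "d1 > 0" "\<And>h. norm h < d1 \<Longrightarrow> \<bar>U (x + h) - U x - p \<bullet> h - (h \<bullet> (X *v h)) / 2\<bar> \<le> e * (norm h)\<^sup>2"
      using expU[OF e] by blast
    obtain d2 where d2: "d2 > 0" "\<And>k. norm k < d2 \<Longrightarrow> \<bar>W (y + k) - W y - q \<bullet> k - (k \<bullet> (Y *v k)) / 2\<bar> \<le> e * (norm k)\<^sup>2"
      using expW[OF e] by blast
    define D where "D = min (min d1 d2) (r1 - norm (z - z0))"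
    have D: "D > 0" using d1 d2 z by (simp add: D_def)
    define N where "N = norm (h, k) + 1"
    define t where "t = D / (2 * N)"
    have nk1: "N > 0" by (simp add: add_nonneg_pos N_def)
    have t: "t > 0" using D nk1 by (simp add: t_def)
    have "t * norm (h, k) < D"
    proof -
      have "t * norm (h, k) \<le> t * N" using t by (simp add: N_def)
      also have "\<dots> = D / 2" using nk1 by (simp add: t_def)
      also have "\<dots> < D" using D by simp
      finally show ?thesis .
    qed
    then have n: "norm (t *\<^sub>R (h, k)) < D" using t by (simp del: scaleR_Pair)
    then have n1: "norm (t *\<^sub>R h) < d1" "norm (t *\<^sub>R k) < d2"
      using norm_fst_le[of "t *\<^sub>R h" "t *\<^sub>R k"] norm_snd_le[of "t *\<^sub>R k" "t *\<^sub>R h"] by (auto simp: D_def)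
    have 1: "f (z + t *\<^sub>R (h, k)) \<le> f z + (pq + c *\<^sub>R z) \<bullet> (t *\<^sub>R (h, k)) + ((t *\<^sub>R (h, k)) \<bullet> Q' (t *\<^sub>R (h, k))) / 2"
      using contact[of "t *\<^sub>R (h, k)"] n unfolding b by (simp add: D_def)
    have 2: "Q' (t *\<^sub>R (h, k)) = t *\<^sub>R (Q (h, k) + c *\<^sub>R (h, k))"
      by (simp add: Q'_def linear_cmul[OF Q(1)] scaleR_add_right del: scaleR_Pair)
    have 3: "f (z + t *\<^sub>R (h, k)) - f z = (U (x + t *\<^sub>R h) - U x) + (W (y + t *\<^sub>R k) - W y)
      + c * (t * (x \<bullet> h) + t * (y \<bullet> k)) + c * t\<^sup>2 * (h \<bullet> h + k \<bullet> k) / 2"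
      unfolding f_def power2_norm_eq_inner
      by (simp add: xy algebra_simps inner_commute power2_eq_square)
    have 4: "(pq + c *\<^sub>R z) \<bullet> (t *\<^sub>R (h, k)) = t * (p \<bullet> h) + t * (q \<bullet> k) + c * (t * (x \<bullet> h) + t * (y \<bullet> k))"
      by (simp add: pq' xy inner_prod_def algebra_simps)
    have 5: "(t *\<^sub>R (h, k)) \<bullet> (t *\<^sub>R (Q (h, k) + c *\<^sub>R (h, k))) = t\<^sup>2 * ((h, k) \<bullet> Q (h, k)) + c * t\<^sup>2 * (h \<bullet> h + k \<bullet> k)"
      by (simp add: inner_prod_def algebra_simps power2_eq_square)
    have A: "(U (x + t *\<^sub>R h) - U x) + (W (y + t *\<^sub>R k) - W y) \<le> t * (p \<bullet> h) + t * (q \<bullet> k) + t\<^sup>2 * ((h, k) \<bullet> Q (h, k)) / 2"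
      using 1 3 unfolding 2 4 5 by (simp add: add_divide_distrib)
    have sc: "(t *\<^sub>R v) \<bullet> (Z *v (t *\<^sub>R v)) = t\<^sup>2 * (v \<bullet> (Z *v v))" "(norm (t *\<^sub>R v))\<^sup>2 = t\<^sup>2 * (norm v)\<^sup>2"
      for v :: "real^'n" and Z :: "real^'n^'n"
      by (simp_all add: matrix_vector_mult_scaleR power_mult_distrib power2_eq_square)
    have B1: "t * (p \<bullet> h) + t\<^sup>2 * (h \<bullet> (X *v h)) / 2 - e * (t\<^sup>2 * (norm h)\<^sup>2) \<le> U (x + t *\<^sub>R h) - U x"
      using d1(2)[OF n1(1)] unfolding sc inner_scaleR_right by linarith
    have B2: "t * (q \<bullet> k) + t\<^sup>2 * (k \<bullet> (Y *v k)) / 2 - e * (t\<^sup>2 * (norm k)\<^sup>2) \<le> W (y + t *\<^sub>R k) - W y"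
      using d2(2)[OF n1(2)] unfolding sc inner_scaleR_right by linarith
    have "t\<^sup>2 * (h \<bullet> (X *v h) + k \<bullet> (Y *v k)) \<le> t\<^sup>2 * ((h, k) \<bullet> Q (h, k) + 2 * e * ((norm h)\<^sup>2 + (norm k)\<^sup>2))"
      using A B1 B2 by (simp add: algebra_simps)
    then have "h \<bullet> (X *v h) + k \<bullet> (Y *v k) \<le> (h, k) \<bullet> Q (h, k) + 2 * e * ((norm h)\<^sup>2 + (norm k)\<^sup>2)"
      using t by (simp add: mult_le_cancel_left)
    moreover have "2 * e * ((norm h)\<^sup>2 + (norm k)\<^sup>2) \<le> 2 * e * S" using e by (simp add: S_def)
    moreover have "2 * e * S = e0" using S by (simp add: e_def)
    ultimately show "h \<bullet> (X *v h) + k \<bullet> (Y *v k) \<le> (h, k) \<bullet> Q (h, k) + e0" by linarith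
  qed
  have mx: "norm (m x - x0) < r" "norm (m x - x0) < \<delta>"
  proof -
    have "norm (m x - x0) \<le> norm (x - m x) + norm (x - x0)"
      using norm_triangle_ineq4[of "x - x0" "x - m x"] by simp
    then show "norm (m x - x0) < r" "norm (m x - x0) < \<delta>"
      using near(1) mclose[OF inb(1)] r1(2,3) \<theta>(4,5) by linarith+
  qed
  have ny: "norm (n y - y0) < r" "norm (n y - y0) < \<delta>"
  proof -
    have "norm (n y - y0) \<le> norm (y - n y) + norm (y - y0)"
      using norm_triangle_ineq4[of "y - y0" "y - n y"] by simp
    then show "norm (n y - y0) < r" "norm (n y - y0) < \<delta>"
      using near(2) nclose[OF inb(2)] r1(2,3) \<theta>(4,5) by linarith+
  qed
  have "upper_jet u (m x) p X" by (rule sup_convolution_jet[OF Um(3) Um(2) mx(1) jetU])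
  moreover have "upper_jet w (n y) q Y" by (rule sup_convolution_jet[OF Wn(3) Wn(2) ny(1) jetW])
  ultimately show ?thesis using that[of "m x" "n y" p q X Y] mx ny np X(1) Y(1) quad by blast
qed

section \<open>Jets of viscosity solutions\<close>

lemma scaled_identity_Sym: "c *\<^sub>R mat 1 \<in> (Sym :: (real^'n^'n) set)"
  by (simp add: Sym_def transpose_def vec_eq_iff mat_def)

lemma Sym_add: "X \<in> Sym \<Longrightarrow> Y \<in> Sym \<Longrightarrow> X + Y \<in> Sym"
  and Sym_minus: "X \<in> Sym \<Longrightarrow> - X \<in> Sym"
  and Sym_diff: "X \<in> Sym \<Longrightarrow> Y \<in> Sym \<Longrightarrow> X - Y \<in> Sym"
  by (simp_all add: Sym_def transpose_def vec_eq_iff)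

lemma scaled_identity_mult: "(c *\<^sub>R mat 1) *v v = c *\<^sub>R (v :: real^'n)"
  by (simp add: scaleR_matrix_vector_assoc[symmetric])

lemma psd_scaled_identity: "0 \<le> c \<Longrightarrow> psd (c *\<^sub>R mat 1 :: real^'n^'n)"
  by (simp add: psd_def scaled_identity_Sym scaled_identity_mult)

lemma trace_scaled_identity: "trace (c *\<^sub>R mat 1 :: real^'n^'n) = c * real CARD('n)"
  by (simp add: trace_def mat_def)

lemma elliptic_scaled_identity:
  fixes X :: "real^'n^'n"
  assumes F: "elliptic_operator a A F" and X: "X \<in> Sym" and c: "0 \<le> c"
  shows "F (X + c *\<^sub>R mat 1) \<le> F X + A * real CARD('n) * c"
    and "F X - A * real CARD('n) * c \<le> F (X - c *\<^sub>R mat 1)"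
proof -
  let ?C = "c *\<^sub>R mat 1 :: real^'n^'n"
  have *: "F (Z + ?C) - F Z \<le> A * trace ?C" if "Z \<in> Sym" for Z
    using F that psd_scaled_identity[OF c] scaled_identity_Sym unfolding elliptic_operator_def by blast
  show "F (X + ?C) \<le> F X + A * real CARD('n) * c"
    using *[OF X] by (simp add: trace_scaled_identity mult_ac)
  show "F X - A * real CARD('n) * c \<le> F (X - ?C)"
    using *[OF Sym_diff[OF X scaled_identity_Sym], of c] by (simp add: trace_scaled_identity mult_ac)
qed

lemma elliptic_zero:
  assumes "elliptic_operator a A F"
  shows "F (0 :: real^'n^'n) = 0"
proof -
  have "(0 :: real^'n^'n) \<in> Sym" by (simp add: Sym_def transpose_def vec_eq_iff)
  then have "F (2 *\<^sub>R (0 :: real^'n^'n)) = 2 * F 0"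
    using assms unfolding elliptic_operator_def by (metis zero_less_numeral)
  then show ?thesis by simp
qed

text \<open>The principal minors of size two give \<open>\<bar>N $ i $ j\<bar> \<le> sqrt (N $ i $
  i) * sqrt (N $ j $ j)\<close>. Hence the form is at most the square of an inner product of two
  vectors whose squared norms are 1 and the trace. This takes the place of a
  diagonalisation.\<close>

lemma psd_quadratic_form_le_trace:
  fixes N :: "real^'n^'n"
  assumes N: "psd N" and e: "norm e = 1"
  shows "e \<bullet> (N *v e) \<le> trace N"
proof -
  have q: "v \<bullet> (N *v w) = (\<Sum>i\<in>UNIV. \<Sum>j\<in>UNIV. v $ i * (N $ i $ j * w $ j))" for v w
    by (simp add: inner_vec_def matrix_vector_mult_def sum_distrib_left)
  have ax: "axis i x \<bullet> (N *v axis j y) = x * y * N $ i $ j" for i j x y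
    by (simp add: inner_axis' matrix_vector_mul_component inner_axis)
  have sym: "N $ i $ j = N $ j $ i" for i j
    using N by (auto simp: psd_def Sym_def transpose_def vec_eq_iff)
  have diag: "0 \<le> N $ i $ i" for i
    using N ax[of i 1 i 1] unfolding psd_def by (metis mult_1)
  have off: "\<bar>N $ i $ j\<bar> \<le> sqrt (N $ i $ i) * sqrt (N $ j $ j)" for i j
  proof -
    have form: "0 \<le> x\<^sup>2 * N $ i $ i + 2 * x * y * N $ i $ j + y\<^sup>2 * N $ j $ j" for x y
    proof -
      have "0 \<le> (axis i x + axis j y) \<bullet> (N *v (axis i x + axis j y))" using N by (simp add: psd_def)
      also have "\<dots> = x\<^sup>2 * N $ i $ i + 2 * x * y * N $ i $ j + y\<^sup>2 * N $ j $ j"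
        by (simp add: matrix_vector_right_distrib inner_add_left inner_add_right ax sym[of j i] power2_eq_square)
      finally show ?thesis .
    qed
    have "(N $ i $ j)\<^sup>2 \<le> N $ i $ i * N $ j $ j"
    proof (cases "N $ i $ i = 0")
      case True
      have "N $ i $ j = 0"
      proof (rule ccontr)
        assume ne: "N $ i $ j \<noteq> 0"
        \<comment> \<open>With a zero diagonal entry the form is affine in \<open>x\<close>; this
          choice gives it the value -1.\<close>
        define x where "x = - (N $ j $ j + 1) / (2 * N $ i $ j)"
        have "2 * x * N $ i $ j = - (N $ j $ j + 1)" using ne by (simp add: x_def)
        then show False using form[of x 1] True by simp
      qed
      then show ?thesis using True by simp
    next
      case False
      then have pos: "N $ i $ i > 0" using diag[of i] by simp
      have "0 \<le> N $ i $ i * (N $ i $ i * N $ j $ j - (N $ i $ j)\<^sup>2)"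
        using form[of "- N $ i $ j" "N $ i $ i"] by (simp add: algebra_simps power2_eq_square)
      then show ?thesis using pos by (simp add: zero_le_mult_iff)
    qed
    then have "sqrt ((N $ i $ j)\<^sup>2) \<le> sqrt (N $ i $ i * N $ j $ j)" by (rule real_sqrt_le_mono)
    then show ?thesis by (simp add: real_sqrt_mult)
  qed
  define s where "s = (\<chi> i. sqrt (N $ i $ i))"
  define b where "b = (\<chi> i. \<bar>e $ i\<bar>)"
  have "e \<bullet> (N *v e) \<le> (\<Sum>i\<in>UNIV. \<Sum>j\<in>UNIV. (b $ i * s $ i) * (b $ j * s $ j))"
    unfolding q
  proof (intro sum_mono)
    fix i j
    have "e $ i * (N $ i $ j * e $ j) \<le> \<bar>e $ i\<bar> * (\<bar>N $ i $ j\<bar> * \<bar>e $ j\<bar>)"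
      by (metis abs_ge_self abs_mult)
    also have "\<dots> \<le> \<bar>e $ i\<bar> * ((sqrt (N $ i $ i) * sqrt (N $ j $ j)) * \<bar>e $ j\<bar>)"
      by (intro mult_left_mono mult_right_mono off) auto
    finally show "e $ i * (N $ i $ j * e $ j) \<le> (b $ i * s $ i) * (b $ j * s $ j)"
      by (simp add: b_def s_def mult_ac)
  qed
  also have "\<dots> = (b \<bullet> s)\<^sup>2"
    by (simp add: inner_vec_def power2_eq_square sum_product)
  also have "\<dots> \<le> (norm b * norm s)\<^sup>2"
    by (metis Cauchy_Schwarz_ineq2 abs_ge_zero power2_abs power_mono)
  also have "\<dots> = (norm s)\<^sup>2"
  proof -
    have "norm b = norm e" by (simp add: norm_vec_def b_def)
    then show ?thesis using e by simp
  qed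
  also have "\<dots> = trace N"
    unfolding power2_norm_eq_inner by (simp add: inner_vec_def s_def trace_def diag)
  finally show ?thesis .
qed

lemma C2_on_quadratic:
  fixes p :: "real^'n" and X :: "real^'n^'n"
  assumes X: "X \<in> Sym"
  shows "C2_on \<Omega> (\<lambda>y. p \<bullet> (y - x) + ((y - x) \<bullet> (X *v (y - x))) / 2) (\<lambda>y. p + X *v (y - x)) (\<lambda>y. X)"
  unfolding C2_on_def gderiv_def
proof (intro conjI ballI)
  fix y
  have bl: "bounded_linear (\<lambda>v. X *v v)" by (rule matrix_vector_mul_bounded_linear)
  have sym: "v \<bullet> (X *v w) = w \<bullet> (X *v v)" for v w
    using X by (metis (mono_tags, lifting) Sym_def dot_lmul_matrix inner_commute mem_Collect_eq transpose_matrix_vector)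
  have d: "((\<lambda>y. X *v (y - x)) has_derivative (\<lambda>h. X *v h)) (at y)"
    by (rule bounded_linear.has_derivative[OF bl, where g="\<lambda>y. y - x" and g'="\<lambda>h. h"]) (auto intro!: derivative_eq_intros)
  show "((\<lambda>y. p \<bullet> (y - x) + ((y - x) \<bullet> (X *v (y - x))) / 2) has_derivative (\<lambda>h. h \<bullet> (p + X *v (y - x)))) (at y)"
    by (rule derivative_eq_intros d refl | simp)+
       (simp add: fun_eq_iff inner_add_right sym[of "y - x"] inner_commute[of p])
  show "((\<lambda>y. p + X *v (y - x)) has_derivative (\<lambda>h. X *v h)) (at y)"
    by (rule derivative_eq_intros d refl | simp)+
qed simp

text \<open>This rules out the alternative of local constancy in the definition of viscosity
  solutions for negative \<alpha>. A displacement against \<open>p\<close> makes the linear term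
  dominate the quadratic ones.\<close>

lemma upper_jet_locally_constant:
  assumes jet: "upper_jet u x p X" and r: "0 < r" and const: "\<And>y. y \<in> ball x r \<Longrightarrow> u y = k"
  shows "p = 0"
proof (rule ccontr)
  assume "p \<noteq> 0"
  then have np: "norm p > 0" by simp
  obtain d where d: "d > 0" "\<And>h. norm h < d \<Longrightarrow> u (x + h) \<le> u x + p \<bullet> h + (h \<bullet> (X *v h)) / 2 + 1 * (norm h)\<^sup>2"
    using jet unfolding upper_jet_def by (metis zero_less_one)
  define c where "c = \<bar>p \<bullet> (X *v p)\<bar> / 2 + (norm p)\<^sup>2"
  have c: "c > 0" using np by (simp add: c_def add_nonneg_pos)
  define t where "t = min (min d r / (2 * norm p)) ((norm p)\<^sup>2 / (2 * c))"
  have t: "t > 0" using np c d r by (simp add: t_def)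
  define h where "h = (- t) *\<^sub>R p"
  have "t \<le> min d r / (2 * norm p)" by (simp add: t_def)
  then have "t * norm p \<le> min d r / 2" using np by (simp add: field_simps)
  then have nh: "norm h < d" "norm h < r" using t d r by (auto simp: h_def)
  have "u (x + h) = k" "u x = k" using const[of "x + h"] const[of x] nh r by (auto simp: dist_norm)
  then have "0 \<le> p \<bullet> h + (h \<bullet> (X *v h)) / 2 + (norm h)\<^sup>2" using d(2)[OF nh(1)] by simp
  also have "\<dots> = - t * (norm p)\<^sup>2 + t\<^sup>2 * ((p \<bullet> (X *v p)) / 2 + (norm p)\<^sup>2)"
    unfolding h_def matrix_vector_mult_scaleR inner_scaleR_left inner_scaleR_right norm_scaleR power_mult_distrib
    by (simp add: dot_square_norm algebra_simps power2_eq_square)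
  also have "\<dots> \<le> - t * (norm p)\<^sup>2 + t\<^sup>2 * c"
    by (intro add_left_mono mult_left_mono) (auto simp: c_def)
  also have "\<dots> = t * (t * c - (norm p)\<^sup>2)" by (simp add: algebra_simps power2_eq_square)
  finally have "(norm p)\<^sup>2 \<le> t * c" using t by (simp add: zero_le_mult_iff)
  moreover have "t \<le> (norm p)\<^sup>2 / (2 * c)" by (simp add: t_def)
  then have "t * c \<le> (norm p)\<^sup>2 / 2" using c by (simp add: field_simps)
  moreover have "(norm p)\<^sup>2 > 0" using np by simp
  ultimately show False by linarith
qed

text \<open>Raising the Hessian by \<open>2 * e\<close> times the identity turns the expansion up to
  an error into genuine touching from above by a paraboloid. Ellipticity later lets \<open>e\<close>
  tend to 0.\<close>

lemma upper_jet_test_function: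
  assumes "upper_jet u x p X" "0 < e"
  shows "\<forall>\<^sub>F y in nhds x. u y - (p \<bullet> (y - x) + ((y - x) \<bullet> ((X + (2 * e) *\<^sub>R mat 1) *v (y - x))) / 2) \<le> u x"
proof -
  obtain d where d: "d > 0" "\<And>h. norm h < d \<Longrightarrow> u (x + h) \<le> u x + p \<bullet> h + (h \<bullet> (X *v h)) / 2 + e * (norm h)\<^sup>2"
    using assms unfolding upper_jet_def by metis
  show ?thesis
    unfolding eventually_nhds_metric
  proof (intro exI[of _ d] conjI allI impI d(1))
    fix y assume "dist y x < d"
    then have "u (x + (y - x)) \<le> u x + p \<bullet> (y - x) + ((y - x) \<bullet> (X *v (y - x))) / 2 + e * (norm (y - x))\<^sup>2"
      by (intro d(2)) (simp add: dist_norm)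
    then show "u y - (p \<bullet> (y - x) + ((y - x) \<bullet> ((X + (2 * e) *\<^sub>R mat 1) *v (y - x))) / 2) \<le> u x"
      by (simp add: matrix_vector_mult_add_rdistrib scaled_identity_mult inner_add_right power2_norm_eq_inner add_divide_distrib)
  qed
qed

lemma subsolution_upper_jet:
  fixes u :: "real^'n \<Rightarrow> real"
  assumes F: "elliptic_operator a A F" and A: "0 < A"
    and vs: "viscosity_subsolution \<alpha> \<beta> lam F f \<Omega> u" and x: "x \<in> \<Omega>"
    and X: "X \<in> Sym" and p: "p \<noteq> 0" and jet: "upper_jet u x p X"
  shows "norm p powr \<beta> - norm p powr \<alpha> * F X + lam * spow \<alpha> (u x) \<le> f x"
proof -
  have alt: "(\<alpha> < 0 \<and> (\<exists>r>0. \<exists>k. ball x r \<subseteq> \<Omega> \<and> (\<forall>y\<in>ball x r. u y = k \<and> lam * spow \<alpha> k \<le> f y))) \<or>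
        (\<forall>\<psi> g H. C2_on \<Omega> \<psi> g H \<and> (\<forall>\<^sub>F y in nhds x. u y - \<psi> y \<le> u x - \<psi> x) \<and> (\<alpha> < 0 \<longrightarrow> g x \<noteq> 0) \<longrightarrow>
           lhs \<alpha> \<beta> lam F (u x) (g x) (H x) \<le> f x)"
    using vs x unfolding viscosity_subsolution_def by blast
  moreover have "\<not> (\<exists>r>0. \<exists>k. ball x r \<subseteq> \<Omega> \<and> (\<forall>y\<in>ball x r. u y = k \<and> lam * spow \<alpha> k \<le> f y))"
    using upper_jet_locally_constant[OF jet] p by blast
  ultimately have test: "lhs \<alpha> \<beta> lam F (u x) (g x) (H x) \<le> f x"
    if "C2_on \<Omega> \<psi> g H" "\<forall>\<^sub>F y in nhds x. u y - \<psi> y \<le> u x - \<psi> x" "g x \<noteq> 0" for \<psi> g H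
    using that by blast
  have np: "norm p > 0" using p by simp
  have est: "norm p powr \<beta> - norm p powr \<alpha> * F X + lam * spow \<alpha> (u x)
      \<le> f x + norm p powr \<alpha> * (A * real CARD('n) * (2 * e))" if e: "e > 0" for e
  proof -
    define Z where "Z = X + (2 * e) *\<^sub>R mat 1"
    have Z: "Z \<in> Sym" unfolding Z_def by (intro Sym_add X scaled_identity_Sym)
    have ev: "\<forall>\<^sub>F y in nhds x. u y - (p \<bullet> (y - x) + ((y - x) \<bullet> (Z *v (y - x))) / 2)
        \<le> u x - (p \<bullet> (x - x) + ((x - x) \<bullet> (Z *v (x - x))) / 2)"
      using upper_jet_test_function[OF jet e] by (rule eventually_mono) (simp add: Z_def[symmetric])
    have "lhs \<alpha> \<beta> lam F (u x) (p + Z *v (x - x)) Z \<le> f x"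
      by (rule test[OF C2_on_quadratic[OF Z] ev]) (use p in simp)
    \<comment> \<open>For a nonzero slope the guarded power agrees with \<open>powr\<close>, also
      when the exponent is 0.\<close>
    then have "- (norm p powr \<alpha> * F Z) + norm p powr \<beta> + lam * spow \<alpha> (u x) \<le> f x"
      using np by (simp add: lhs_def rpow_def split: if_splits)
    moreover have "norm p powr \<alpha> * F Z \<le> norm p powr \<alpha> * (F X + A * real CARD('n) * (2 * e))"
      unfolding Z_def using e by (intro mult_left_mono elliptic_scaled_identity(1)[OF F X]) auto
    ultimately show ?thesis by (simp add: algebra_simps)
  qed
  show ?thesis
  proof (rule field_le_epsilon)
    fix e0 :: real assume e0: "0 < e0"
    define c where "c = norm p powr \<alpha> * (A * real CARD('n) * 2)"
    have c: "c > 0" using np A by (simp add: c_def)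
    have "norm p powr \<alpha> * (A * real CARD('n) * (2 * (e0 / c))) = c * (e0 / c)"
      unfolding c_def by (simp only: mult_ac)
    also have "\<dots> = e0" using c by simp
    finally show "norm p powr \<beta> - norm p powr \<alpha> * F X + lam * spow \<alpha> (u x) \<le> f x + e0"
      using est[of "e0 / c"] e0 c by simp
  qed
qed

lemma supersolution_upper_jet:
  fixes u :: "real^'n \<Rightarrow> real"
  assumes F: "elliptic_operator a A F" and A: "0 < A"
    and vs: "viscosity_supersolution \<alpha> \<beta> lam F f \<Omega> u" and x: "x \<in> \<Omega>"
    and X: "X \<in> Sym" and p: "p \<noteq> 0" and jet: "upper_jet (\<lambda>y. - u y) x p X"
  shows "f x \<le> norm p powr \<beta> - norm p powr \<alpha> * F (- X) + lam * spow \<alpha> (u x)"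
proof -
  have alt: "(\<alpha> < 0 \<and> (\<exists>r>0. \<exists>k. ball x r \<subseteq> \<Omega> \<and> (\<forall>y\<in>ball x r. u y = k \<and> lam * spow \<alpha> k \<ge> f y))) \<or>
        (\<forall>\<psi> g H. C2_on \<Omega> \<psi> g H \<and> (\<forall>\<^sub>F y in nhds x. u y - \<psi> y \<ge> u x - \<psi> x) \<and> (\<alpha> < 0 \<longrightarrow> g x \<noteq> 0) \<longrightarrow>
           lhs \<alpha> \<beta> lam F (u x) (g x) (H x) \<ge> f x)"
    using vs x unfolding viscosity_supersolution_def by blast
  moreover have "\<not> (\<exists>r>0. \<exists>k. ball x r \<subseteq> \<Omega> \<and> (\<forall>y\<in>ball x r. u y = k \<and> lam * spow \<alpha> k \<ge> f y))"
  proof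
    assume "\<exists>r>0. \<exists>k. ball x r \<subseteq> \<Omega> \<and> (\<forall>y\<in>ball x r. u y = k \<and> lam * spow \<alpha> k \<ge> f y)"
    then obtain r k where "r > 0" "\<And>y. y \<in> ball x r \<Longrightarrow> - u y = - k" by auto
    from upper_jet_locally_constant[OF jet this] p show False by blast
  qed
  ultimately have test: "lhs \<alpha> \<beta> lam F (u x) (g x) (H x) \<ge> f x"
    if "C2_on \<Omega> \<psi> g H" "\<forall>\<^sub>F y in nhds x. u y - \<psi> y \<ge> u x - \<psi> x" "g x \<noteq> 0" for \<psi> g H
    using that by blast
  have np: "norm p > 0" using p by simp
  have est: "f x \<le> norm p powr \<beta> - norm p powr \<alpha> * F (- X) + lam * spow \<alpha> (u x)
      + norm p powr \<alpha> * (A * real CARD('n) * (2 * e))" if e: "e > 0" for e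
  proof -
    define Z where "Z = X + (2 * e) *\<^sub>R mat 1"
    have Z: "- Z \<in> Sym" unfolding Z_def by (intro Sym_minus Sym_add X scaled_identity_Sym)
    have neg: "(- Z) *v v = - (Z *v v)" for v :: "real^'n"
      by (simp add: matrix_vector_mult_def vec_eq_iff sum_negf)
    have ev: "\<forall>\<^sub>F y in nhds x. u y - ((- p) \<bullet> (y - x) + ((y - x) \<bullet> ((- Z) *v (y - x))) / 2)
        \<ge> u x - ((- p) \<bullet> (x - x) + ((x - x) \<bullet> ((- Z) *v (x - x))) / 2)"
      using upper_jet_test_function[OF jet e]
      by (rule eventually_mono) (simp add: Z_def[symmetric] neg)
    have "lhs \<alpha> \<beta> lam F (u x) (- p + (- Z) *v (x - x)) (- Z) \<ge> f x"
      by (rule test[OF C2_on_quadratic[OF Z] ev]) (use p in simp)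
    then have "- (norm p powr \<alpha> * F (- Z)) + norm p powr \<beta> + lam * spow \<alpha> (u x) \<ge> f x"
      using np by (simp add: lhs_def rpow_def split: if_splits)
    moreover have "norm p powr \<alpha> * (F (- X) - A * real CARD('n) * (2 * e)) \<le> norm p powr \<alpha> * F (- Z)"
    proof (rule mult_left_mono)
      have "- Z = - X - (2 * e) *\<^sub>R mat 1" by (simp add: Z_def)
      then show "F (- X) - A * real CARD('n) * (2 * e) \<le> F (- Z)"
        using elliptic_scaled_identity(2)[OF F Sym_minus[OF X], of "2 * e"] e by simp
    qed simp
    ultimately show ?thesis by (simp add: algebra_simps)
  qed
  show ?thesis
  proof (rule field_le_epsilon)
    fix e0 :: real assume e0: "0 < e0"
    define c where "c = norm p powr \<alpha> * (A * real CARD('n) * 2)"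
    have c: "c > 0" using np A by (simp add: c_def)
    have "norm p powr \<alpha> * (A * real CARD('n) * (2 * (e0 / c))) = c * (e0 / c)"
      unfolding c_def by (simp only: mult_ac)
    also have "\<dots> = e0" using c by simp
    finally show "f x \<le> norm p powr \<beta> - norm p powr \<alpha> * F (- X) + lam * spow \<alpha> (u x) + e0"
      using est[of "e0 / c"] e0 c by simp
  qed
qed

section \<open>Radial test functions\<close>

lemma taylor_second_order:
  fixes w :: "real \<Rightarrow> real"
  assumes d0: "0 < d0" and w: "\<And>s. \<bar>s - t\<bar> < d0 \<Longrightarrow> (w has_real_derivative w' s) (at s)"
    and w': "(w' has_real_derivative w2) (at t)" and e: "0 < e"
  shows "\<exists>d>0. \<forall>q. \<bar>q\<bar> < d \<longrightarrow> w (t + q) \<le> w t + w' t * q + w2 / 2 * q\<^sup>2 + e * q\<^sup>2"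
proof -
  obtain d1 where d1: "d1 > 0" "\<And>y. norm (y - t) < d1 \<Longrightarrow> norm (w' y - w' t - w2 * (y - t)) \<le> e * norm (y - t)"
    using w' e unfolding has_field_derivative_def has_derivative_at_alt by blast
  define d where "d = min d0 d1"
  have "w (t + q) \<le> w t + w' t * q + w2 / 2 * q\<^sup>2 + e * q\<^sup>2" if q: "\<bar>q\<bar> < d" for q
  proof -
    define \<phi> where "\<phi> s = w (t + s) - w t - w' t * s - w2 / 2 * s\<^sup>2" for s
    have der: "(\<phi> has_real_derivative (w' (t + s) - w' t - w2 * s)) (at s)" if "\<bar>s\<bar> < d" for s
    proof -
      have "((\<lambda>s. w (t + s)) has_real_derivative w' (t + s)) (at s)"
        using w[of "t + s"] that DERIV_at_within_shift[of w "w' (t + s)" t s UNIV] by (simp add: d_def add.commute)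
      then show ?thesis unfolding \<phi>_def by (auto intro!: derivative_eq_intros)
    qed
    have bd: "norm (w' (t + s) - w' t - w2 * s) \<le> e * \<bar>q\<bar>" if "\<bar>s\<bar> \<le> \<bar>q\<bar>" for s
    proof -
      have "norm (w' (t + s) - w' t - w2 * s) \<le> e * \<bar>s\<bar>" using d1(2)[of "t + s"] that q by (simp add: d_def)
      also have "\<dots> \<le> e * \<bar>q\<bar>" using that e by (intro mult_left_mono) auto
      finally show ?thesis .
    qed
    have "norm (\<phi> q - \<phi> 0) \<le> e * \<bar>q\<bar> * norm (q - 0)"
    proof (rule field_differentiable_bound[where S="closed_segment 0 q" and f'="\<lambda>s. w' (t + s) - w' t - w2 * s"])
      fix s assume "s \<in> closed_segment 0 q"
      then have s: "\<bar>s\<bar> \<le> \<bar>q\<bar>" by (auto simp: closed_segment_eq_real_ivl split: if_splits)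
      show "(\<phi> has_field_derivative (w' (t + s) - w' t - w2 * s)) (at s within closed_segment 0 q)"
        using der[of s] s q has_field_derivative_at_within by auto
      show "norm (w' (t + s) - w' t - w2 * s) \<le> e * \<bar>q\<bar>" by (rule bd[OF s])
    qed auto
    then have "\<bar>\<phi> q\<bar> \<le> e * q\<^sup>2"
      by (simp add: \<phi>_def power2_eq_square abs_mult_self_eq mult.assoc)
    then show ?thesis unfolding \<phi>_def by linarith
  qed
  then show ?thesis using d0 d1 by (intro exI[of _ d]) (auto simp: d_def)
qed

lemma norm_add_upper:
  fixes v h :: "'a::real_inner"
  assumes "v \<noteq> 0"
  shows "norm (v + h) \<le> norm v + (v \<bullet> h) / norm v + (norm h)\<^sup>2 / (2 * norm v)"
proof -
  define t where "t = norm v"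
  have t: "t > 0" using assms by (simp add: t_def)
  have sq: "(norm (v + h))\<^sup>2 = t\<^sup>2 + 2 * (v \<bullet> h) + (norm h)\<^sup>2"
    unfolding t_def power2_norm_eq_inner by (simp add: algebra_simps inner_commute)
  have "0 \<le> (norm (v + h) - t)\<^sup>2" by simp
  then have "norm (v + h) * (2 * t) \<le> t\<^sup>2 + (norm (v + h))\<^sup>2" by (simp add: power2_diff mult_ac)
  then have "norm (v + h) * (2 * t) \<le> 2 * t\<^sup>2 + 2 * (v \<bullet> h) + (norm h)\<^sup>2" using sq by simp
  then have "norm (v + h) \<le> (2 * t\<^sup>2 + 2 * (v \<bullet> h) + (norm h)\<^sup>2) / (2 * t)"
    using t by (simp add: pos_le_divide_eq)
  also have "\<dots> = t + (v \<bullet> h) / t + (norm h)\<^sup>2 / (2 * t)"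
    using t by (simp add: add_divide_distrib power2_eq_square)
  finally show ?thesis unfolding t_def .
qed

text \<open>The Hessian of the radial function has the eigenvalue \<open>w2\<close> in the radial
  direction and \<open>w' / t\<close>, with \<open>t = norm (x - z)\<close>, in the orthogonal ones.
  Both are nonnegative here, so the multiple of the identity by their sum lies above it, and this
  crude matrix is enough for the barrier.\<close>

lemma radial_upper_jet:
  fixes u :: "real^'n \<Rightarrow> real"
  assumes d0: "0 < d0" and w: "\<And>s. \<bar>s - norm (x - z)\<bar> < d0 \<Longrightarrow> (w has_real_derivative w' s) (at s)"
    and w2: "(w' has_real_derivative w2) (at (norm (x - z)))"
    and pos: "0 \<le> w' (norm (x - z))" "0 \<le> w2" "x \<noteq> z"
    and max: "\<And>y. norm (y - x) < d0 \<Longrightarrow> u y - w (norm (y - z)) \<le> u x - w (norm (x - z))"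
  shows "upper_jet u x ((w' (norm (x - z)) / norm (x - z)) *\<^sub>R (x - z)) ((w' (norm (x - z)) / norm (x - z) + w2) *\<^sub>R mat 1)"
  unfolding upper_jet_def
proof (intro allI impI)
  fix e :: real assume e: "0 < e"
  define t where "t = norm (x - z)"
  have t: "t > 0" using pos(3) by (simp add: t_def)
  obtain d where d: "d > 0" "\<And>q. \<bar>q\<bar> < d \<Longrightarrow> w (t + q) \<le> w t + w' t * q + w2 / 2 * q\<^sup>2 + e * q\<^sup>2"
    using taylor_second_order[OF d0 w w2 e] unfolding t_def by metis
  let ?X = "(w' t / t + w2) *\<^sub>R mat 1 :: real^'n^'n"
  show "\<exists>d>0. \<forall>h. norm h < d \<longrightarrow> u (x + h) \<le> u x + ((w' (norm (x - z)) / norm (x - z)) *\<^sub>R (x - z)) \<bullet> h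
      + (h \<bullet> (((w' (norm (x - z)) / norm (x - z) + w2) *\<^sub>R mat 1) *v h)) / 2 + e * (norm h)\<^sup>2"
    unfolding t_def[symmetric]
  proof (intro exI[of _ "min d d0"] conjI allI impI)
    show "0 < min d d0" using d d0 by simp
    fix h :: "real^'n" assume h: "norm h < min d d0"
    define q where "q = norm (x + h - z) - t"
    have eq: "x + h - z = (x - z) + h" by simp
    have qh: "\<bar>q\<bar> \<le> norm h"
      unfolding q_def t_def eq using norm_triangle_ineq3[of "x - z + h" "x - z"] by simp
    have q1: "q \<le> ((x - z) \<bullet> h) / t + (norm h)\<^sup>2 / (2 * t)"
      unfolding q_def t_def eq using norm_add_upper[of "x - z" h] pos(3) by simp
    have q2: "q\<^sup>2 \<le> (norm h)\<^sup>2" using qh by (simp add: abs_le_square_iff[symmetric])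
    have "u (x + h) \<le> u x + (w (t + q) - w t)"
      using max[of "x + h"] h by (simp add: q_def t_def)
    also have "\<dots> \<le> u x + (w' t * q + w2 / 2 * q\<^sup>2 + e * q\<^sup>2)"
      using d(2)[of q] qh h by simp
    also have "\<dots> \<le> u x + (w' t * (((x - z) \<bullet> h) / t + (norm h)\<^sup>2 / (2 * t)) + w2 / 2 * (norm h)\<^sup>2 + e * (norm h)\<^sup>2)"
      using q1 q2 pos e by (intro add_mono mult_left_mono order_refl) (auto simp: t_def)
    also have "\<dots> = u x + ((w' t / t) *\<^sub>R (x - z)) \<bullet> h + (h \<bullet> (?X *v h)) / 2 + e * (norm h)\<^sup>2"
    proof -
      have "h \<bullet> (?X *v h) = (w' t / t + w2) * (norm h)\<^sup>2"
        by (simp only: scaled_identity_mult inner_scaleR_right power2_norm_eq_inner)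
      then show ?thesis unfolding inner_scaleR_left using t by (simp add: field_simps)
    qed
    finally show "u (x + h) \<le> u x + ((w' t / t) *\<^sub>R (x - z)) \<bullet> h + (h \<bullet> (?X *v h)) / 2 + e * (norm h)\<^sup>2" .
  qed
qed


section \<open>Interior Lipschitz estimate\<close>

definition jet_subsolution where
  "jet_subsolution \<alpha> \<beta> F K S u \<longleftrightarrow> (\<forall>x\<in>S. \<forall>p X. X \<in> Sym \<longrightarrow> p \<noteq> 0 \<longrightarrow> upper_jet u x p X \<longrightarrow>
     norm p powr \<beta> - norm p powr \<alpha> * F X \<le> K)"

text \<open>An upper jet \<open>(p, X)\<close> of \<open>- u\<close> is a lower jet
  \<open>(- p, - X)\<close> of \<open>u\<close>. Hence the argument \<open>- X\<close> of
  \<open>F\<close>, while the sign of the slope disappears in the norm.\<close>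

definition jet_supersolution where
  "jet_supersolution \<alpha> \<beta> F K S u \<longleftrightarrow> (\<forall>x\<in>S. \<forall>p X. X \<in> Sym \<longrightarrow> p \<noteq> 0 \<longrightarrow> upper_jet (\<lambda>y. - u y) x p X \<longrightarrow>
     - K \<le> norm p powr \<beta> - norm p powr \<alpha> * F (- X))"

lemma jet_subsolution_subset: "jet_subsolution \<alpha> \<beta> F K S u \<Longrightarrow> T \<subseteq> S \<Longrightarrow> jet_subsolution \<alpha> \<beta> F K T u"
  and jet_supersolution_subset: "jet_supersolution \<alpha> \<beta> F K S u \<Longrightarrow> T \<subseteq> S \<Longrightarrow> jet_supersolution \<alpha> \<beta> F K T u"
  unfolding jet_subsolution_def jet_supersolution_def by blast+

lemma powr_diff_le:
  fixes x y M g :: real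
  assumes g: "1 \<le> g" and x: "0 < x" and y: "0 < y" "y \<le> M" and D: "y \<le> x + D" "0 \<le> D"
  shows "y powr g - x powr g \<le> g * M powr (g - 1) * D"
proof (cases "y \<le> x")
  case True
  then have "y powr g \<le> x powr g" using g y by (intro powr_mono2) auto
  moreover have "0 \<le> g * M powr (g - 1) * D" using g D by simp
  ultimately show ?thesis by linarith
next
  case False
  then have xy: "x < y" by simp
  have "\<exists>z>x. z < y \<and> y powr g - x powr g = (y - x) * (g * z powr (g - 1))"
    using xy x by (intro MVT2) (auto intro!: derivative_eq_intros)
  then obtain z where z: "x < z" "z < y" "y powr g - x powr g = (y - x) * (g * z powr (g - 1))" by blast
  have "z powr (g - 1) \<le> M powr (g - 1)" using z x y g by (intro powr_mono2) auto
  then have "(y - x) * (g * z powr (g - 1)) \<le> D * (g * M powr (g - 1))"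
    using z g D x xy by (intro mult_mono) auto
  then show ?thesis unfolding z(3) by (simp add: mult_ac)
qed

text \<open>The relation between \<sigma> and \<gamma> is scale invariance: a slope
  \<open>t * d powr (- \<sigma>)\<close> has the natural length
  \<open>t powr (1 - \<gamma>) * d\<close>, a fraction of \<open>d\<close> that depends on
  \<open>t\<close> only.\<close>

locale coercive_equation =
  fixes \<alpha> \<beta> \<gamma> \<sigma> a A :: real and F :: "real^'n^'n \<Rightarrow> real"
  assumes alpha: "\<alpha> > -1" and beta_eq: "\<beta> = \<alpha> + \<gamma>" and gamma_gt_1: "\<gamma> > 1"
    and sigma: "\<sigma> * (\<gamma> - 1) = 1" and a_pos: "0 < a" and a_less_A: "a < A"
    and F: "elliptic_operator a A F"
begin

lemma beta_pos: "\<beta> > 0" and A_pos: "A > 0" and dim_ge_1: "real CARD('n) \<ge> 1"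
  using alpha beta_eq gamma_gt_1 a_pos a_less_A by (auto simp: Suc_le_eq)

lemma sigma_pos: "\<sigma> > 0"
  using sigma gamma_gt_1 by (metis diff_gt_0_iff_gt zero_less_mult_pos2 zero_less_one)

lemma sigma_add_1_mult: "(\<sigma> + 1) * (\<gamma> - 1) = \<gamma>"
  using sigma by (simp add: algebra_simps)

text \<open>The barrier \<open>w\<close> below is a strict supersolution that is linear with slope \<open>\<mu>\<close> up to the factor
  coming from the second summand, which blows up at distance \<open>R\<close> so that no boundary information on
  \<open>u\<close> is needed there.\<close>

lemma radial_barrier:
  fixes u :: "real^'n \<Rightarrow> real"
  assumes sub: "jet_subsolution \<alpha> \<beta> F K (ball z R) u" and cont: "continuous_on (cball z R) u"
    and K: "0 \<le> K" and \<mu>: "0 < \<mu>" and \<rho>: "4 * A * real CARD('n) * (\<sigma> + 1) * \<mu> powr (1 - \<gamma>) \<le> \<rho>" and R: "\<rho> \<le> R"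
    and K\<mu>: "4 * K \<le> \<mu> powr \<beta>"
    and inner: "\<And>x. norm (x - z) = \<rho> \<Longrightarrow> u x \<le> c0"
    and x1: "\<rho> \<le> norm (x1 - z)" "norm (x1 - z) \<le> R / 2"
  shows "u x1 \<le> c0 + \<mu> * (1 + 2 powr (\<sigma> + 1)) * norm (x1 - z)"
proof (rule ccontr)
  assume contr: "\<not> ?thesis"
  define m0 where "m0 = \<mu> powr (1 - \<gamma>)"
  have m0: "m0 > 0" using \<mu> by (simp add: m0_def)
  have \<rho>0: "\<rho> > 0"
  proof -
    have "0 < 4 * A * real CARD('n) * (\<sigma> + 1) * m0" using A_pos dim_ge_1 sigma_pos m0 by (intro mult_pos_pos) auto
    then show ?thesis using \<rho> unfolding m0_def by linarith
  qed
  have R0: "R > 0" using \<rho>0 R by simp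
  define v where "v t = 1 - t / R" for t
  \<comment> \<open>Balancing the second derivative against the gradient term would suggest the
    slope \<open>v t powr (- \<sigma>)\<close>, but for \<open>\<sigma> < 1\<close> its primitive
    stays bounded. With the exponent lowered by 1 the barrier always blows up.\<close>
  define w where "w t = \<mu> * (t + (R / \<sigma>) * (v t powr (- \<sigma>) - 1))" for t
  define w' where "w' t = \<mu> * (1 + v t powr (- \<sigma> - 1))" for t
  define w2 where "w2 t = \<mu> * ((\<sigma> + 1) / R * v t powr (- \<sigma> - 2))" for t
  have vpos: "v t > 0" if "t < R" for t using that R0 by (simp add: v_def)
  have dv: "(v has_real_derivative (- 1 / R)) (at t)" for t
    unfolding v_def using R0 by (auto intro!: derivative_eq_intros)
  have dw: "(w has_real_derivative w' t) (at t)" if "t < R" for t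
  proof -
    have "(w has_real_derivative (\<mu> * (1 + (R / \<sigma>) * ((- \<sigma>) * v t powr (- \<sigma> - 1) * (- 1 / R))))) (at t)"
      unfolding w_def using vpos[OF that] by (auto intro!: derivative_eq_intros dv)
    then show ?thesis using sigma_pos R0 by (simp add: w'_def)
  qed
  have dw': "(w' has_real_derivative w2 t) (at t)" if "t < R" for t
  proof -
    have "(w' has_real_derivative (\<mu> * ((- \<sigma> - 1) * v t powr (- \<sigma> - 1 - 1) * (- 1 / R)))) (at t)"
      unfolding w'_def using vpos[OF that] by (auto intro!: derivative_eq_intros dv)
    moreover have "(- \<sigma> - 1) * v t powr (- \<sigma> - 1 - 1) * (- 1 / R) = (\<sigma> + 1) / R * v t powr (- \<sigma> - 2)"
    proof -
      have "- \<sigma> - 1 - 1 = - \<sigma> - 2" by simp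
      then have "(- \<sigma> - 1) * v t powr (- \<sigma> - 1 - 1) * (- 1 / R) = (- \<sigma> - 1) * v t powr (- \<sigma> - 2) * (- 1 / R)"
        by (simp only:)
      also have "\<dots> = (\<sigma> + 1) / R * v t powr (- \<sigma> - 2)"
        by (simp add: divide_inverse algebra_simps)
      finally show ?thesis .
    qed
    ultimately show ?thesis by (simp only: w2_def)
  qed
  have w'pos: "w' t \<ge> \<mu>" for t using \<mu> by (simp add: w'_def)
  have w2pos: "w2 t \<ge> 0" for t using \<mu> R0 sigma_pos by (simp add: w2_def)
  have wge: "w t \<ge> 0" if "0 \<le> t" "t < R" for t
  proof -
    have "v t \<le> 1" using that R0 by (simp add: v_def)
    then have "1 \<le> v t powr (- \<sigma>)" using vpos[OF that(2)] sigma_pos powr_mono2'[of "- \<sigma>" "v t" 1] by simp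
    then show ?thesis using that \<mu> R0 sigma_pos by (simp add: w_def)
  qed
  have wle: "w t \<le> \<mu> * (1 + 2 powr (\<sigma> + 1)) * t" if t: "0 < t" "t \<le> R / 2" for t
  proof -
    have "\<exists>s>0. s < t \<and> w t - w 0 = (t - 0) * w' s"
      using t R0 by (intro MVT2[OF t(1)] dw) auto
    then obtain s where s: "0 < s" "s < t" "w t - w 0 = t * w' s" by auto
    have "v s \<ge> 1 / 2" using s t R0 by (simp add: v_def field_simps)
    then have "v s powr (- \<sigma> - 1) \<le> (1 / 2) powr (- \<sigma> - 1)"
      using sigma_pos by (intro powr_mono2') auto
    also have "(1 / 2) powr (- \<sigma> - 1) = 2 powr (\<sigma> + 1)"
    proof -
      have "(1 / 2 :: real) powr (- \<sigma> - 1) = inverse (2 powr (- \<sigma> - 1))"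
        by (simp add: powr_divide inverse_eq_divide)
      also have "\<dots> = 2 powr (- (- \<sigma> - 1))" by (rule powr_minus[symmetric])
      finally show ?thesis by (simp add: add.commute)
    qed
    finally have "w' s \<le> \<mu> * (1 + 2 powr (\<sigma> + 1))" unfolding w'_def using \<mu> by (intro mult_left_mono) auto
    then have "t * w' s \<le> t * (\<mu> * (1 + 2 powr (\<sigma> + 1)))" using t by (intro mult_left_mono) auto
    moreover have "w 0 = 0" by (simp add: w_def v_def)
    ultimately show ?thesis using s(3) by (simp add: mult_ac)
  qed
  define t1 where "t1 = norm (x1 - z)"
  have t1: "\<rho> \<le> t1" "t1 \<le> R / 2" using x1 by (auto simp: t1_def)
  have viol: "u x1 > c0 + w t1" using contr wle[of t1] t1 \<rho>0 unfolding t1_def[symmetric] by auto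
  have "bounded (u ` cball z R)"
    using cont by (auto intro!: compact_imp_bounded compact_continuous_image)
  then obtain Mu where Mu: "\<And>x. x \<in> cball z R \<Longrightarrow> \<bar>u x\<bar> \<le> Mu"
    unfolding bounded_iff by (metis image_eqI real_norm_def)
  \<comment> \<open>Chosen so that at \<open>R' = (1 - \<theta>) * R\<close> the barrier exceeds
    \<open>\<bar>Mu\<bar> + \<bar>c0\<bar>\<close>, which prevents a maximum on the outer sphere.
    The bound \<open>Mu\<close> of \<open>u\<close> only decides where the comparison stops; it does
    not enter the estimate.\<close>
  define B where "B = 1 + (\<bar>Mu\<bar> + \<bar>c0\<bar>) * \<sigma> / (\<mu> * R)"
  have B: "B \<ge> 1" using \<mu> R0 sigma_pos by (simp add: B_def)
  define \<theta> where "\<theta> = min (1 / 4) (B powr (- 1 / \<sigma>))"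
  have \<theta>: "0 < \<theta>" "\<theta> \<le> 1 / 4" using B by (auto simp: \<theta>_def)
  define R' where "R' = (1 - \<theta>) * R"
  have R': "R' < R" "t1 < R'"
  proof -
    show "R' < R" using \<theta> R0 by (simp add: R'_def)
    have "3 / 4 * R \<le> R'" unfolding R'_def using \<theta> R0 by (intro mult_right_mono) auto
    then show "t1 < R'" using t1 R0 by simp
  qed
  have wR': "\<bar>Mu\<bar> + \<bar>c0\<bar> \<le> w R'"
  proof -
    have v\<theta>: "v R' = \<theta>" using R0 by (simp add: v_def R'_def)
    have "B = (B powr (- 1 / \<sigma>)) powr (- \<sigma>)" using B sigma_pos by (simp add: powr_powr)
    also have "\<dots> \<le> \<theta> powr (- \<sigma>)" using \<theta> sigma_pos by (intro powr_mono2') (auto simp: \<theta>_def)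
    finally have "B - 1 \<le> v R' powr (- \<sigma>) - 1" by (simp add: v\<theta>)
    then have "(R / \<sigma>) * (B - 1) \<le> (R / \<sigma>) * (v R' powr (- \<sigma>) - 1)"
      using R0 sigma_pos by (intro mult_left_mono) auto
    moreover have "0 \<le> R'" using t1 R'(2) \<rho>0 by linarith
    ultimately have "\<mu> * ((R / \<sigma>) * (B - 1)) \<le> \<mu> * (R' + (R / \<sigma>) * (v R' powr (- \<sigma>) - 1))"
      using \<mu> by (intro mult_left_mono) auto
    moreover have "\<mu> * ((R / \<sigma>) * (B - 1)) = \<bar>Mu\<bar> + \<bar>c0\<bar>"
      using \<mu> R0 sigma_pos by (simp add: B_def)
    ultimately show ?thesis by (simp add: w_def)
  qed
  define T where "T = {x. \<rho> \<le> norm (x - z)} \<inter> cball z R'"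
  have compT: "compact T"
    unfolding T_def by (intro closed_Int_compact closed_Collect_le continuous_intros compact_cball)
  have inT: "x \<in> T \<longleftrightarrow> \<rho> \<le> norm (x - z) \<and> norm (x - z) \<le> R'" for x
    by (simp add: T_def dist_norm norm_minus_commute)
  have x1T: "x1 \<in> T" using t1 R' by (simp add: inT t1_def)
  have contw: "continuous_on {..<R} w"
    by (rule DERIV_continuous_on[where D=w']) (simp add: dw has_field_derivative_at_within)
  have "continuous_on T (\<lambda>x. u x - w (norm (x - z)))"
  proof (rule continuous_on_diff)
    show "continuous_on T u"
      by (rule continuous_on_subset[OF cont]) (use R' in \<open>auto simp: inT dist_norm norm_minus_commute\<close>)
    show "continuous_on T (\<lambda>x. w (norm (x - z)))"
      by (rule continuous_on_compose2[OF contw]) (use R' in \<open>auto simp: inT intro!: continuous_intros\<close>)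
  qed
  then obtain x2 where x2: "x2 \<in> T" "\<And>y. y \<in> T \<Longrightarrow> u y - w (norm (y - z)) \<le> u x2 - w (norm (x2 - z))"
    using continuous_attains_sup[OF compT] x1T by blast
  define t where "t = norm (x2 - z)"
  have val: "u x2 - w t > c0" using x2(2)[OF x1T] viol by (simp add: t_def t1_def)
  have t\<rho>: "\<rho> < t"
  proof (rule ccontr)
    assume "\<not> \<rho> < t"
    then have "t = \<rho>" using x2(1) by (simp add: inT t_def)
    then have "u x2 \<le> c0" using inner by (simp add: t_def)
    then show False using val wge[of t] \<open>t = \<rho>\<close> \<rho>0 R' t1 by auto
  qed
  have tR': "t < R'"
  proof (rule ccontr)
    assume "\<not> t < R'"
    then have "t = R'" using x2(1) by (simp add: inT t_def)
    moreover have "\<bar>u x2\<bar> \<le> Mu" using x2(1) R' by (intro Mu) (auto simp: inT dist_norm norm_minus_commute)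
    ultimately show False using val wR' by simp
  qed
  have x2z: "x2 \<noteq> z" using t\<rho> \<rho>0 by (auto simp: t_def)
  define d0 where "d0 = min (t - \<rho>) (R' - t)"
  have d0: "d0 > 0" using t\<rho> tR' by (simp add: d0_def)
  have jet: "upper_jet u x2 ((w' t / t) *\<^sub>R (x2 - z)) ((w' t / t + w2 t) *\<^sub>R mat 1)"
    unfolding t_def
  proof (rule radial_upper_jet[OF d0])
    fix s assume "\<bar>s - norm (x2 - z)\<bar> < d0"
    then show "(w has_real_derivative w' s) (at s)" using R' by (intro dw) (auto simp: d0_def t_def)
  next
    show "(w' has_real_derivative w2 (norm (x2 - z))) (at (norm (x2 - z)))"
      using tR' R' by (intro dw') (simp add: t_def)
    show "0 \<le> w' (norm (x2 - z))" using w'pos \<mu> by (meson less_imp_le order_trans)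
    show "0 \<le> w2 (norm (x2 - z))" by (rule w2pos)
    show "x2 \<noteq> z" by (rule x2z)
  next
    fix y assume y: "norm (y - x2) < d0"
    have "\<bar>norm (y - z) - norm (x2 - z)\<bar> \<le> norm (y - x2)"
      using norm_triangle_ineq3[of "y - z" "x2 - z"] by simp
    then have "y \<in> T" using y unfolding inT by (auto simp: d0_def t_def)
    then show "u y - w (norm (y - z)) \<le> u x2 - w (norm (x2 - z))" by (rule x2(2))
  qed
  have t0: "t > 0" using t\<rho> \<rho>0 by simp
  define p where "p = (w' t / t) *\<^sub>R (x2 - z)"
  have np: "norm p = w' t" using t0 w'pos[of t] \<mu> by (simp add: p_def t_def[symmetric])
  have W: "w' t > 0" using w'pos[of t] \<mu> by simp
  have p0: "p \<noteq> 0" using np W by auto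
  have x2B: "x2 \<in> ball z R" using tR' R' by (simp add: t_def dist_norm norm_minus_commute)
  define C where "C = w' t / t + w2 t"
  have C0: "C \<ge> 0" using W t0 w2pos by (simp add: C_def)
  have "norm p powr \<beta> - norm p powr \<alpha> * F (C *\<^sub>R mat 1) \<le> K"
    using sub x2B scaled_identity_Sym p0 jet unfolding jet_subsolution_def p_def C_def by blast
  moreover have "F (C *\<^sub>R mat 1) \<le> A * real CARD('n) * C"
    using elliptic_scaled_identity(1)[OF F scaled_identity_Sym[of 0] C0] elliptic_zero[OF F] by simp
  then have "norm p powr \<alpha> * F (C *\<^sub>R mat 1) \<le> norm p powr \<alpha> * (A * real CARD('n) * C)"
    by (intro mult_left_mono) auto
  ultimately have main: "w' t powr \<beta> \<le> K + w' t powr \<alpha> * (A * real CARD('n) * C)" by (simp add: np)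
  \<comment> \<open>The three terms that bound \<open>P\<close> in \<open>main\<close> (constant,
    tangential and radial) are each at most a quarter of \<open>P\<close>, which is a
    contradiction.\<close>
  define P where "P = w' t powr \<beta>"
  have P: "P > 0" using W by (simp add: P_def)
  have b1: "4 * K \<le> P"
    using K\<mu> powr_mono2[of \<beta> \<mu> "w' t"] w'pos[of t] \<mu> beta_pos unfolding P_def by simp
  have gam_split: "w' t powr \<alpha> * w' t powr \<gamma> = P" unfolding P_def beta_eq by (simp add: powr_add)
  have b2: "4 * (w' t powr \<alpha> * (A * real CARD('n) * (w' t / t))) \<le> P"
  proof -
    have "w' t powr (1 - \<gamma>) \<le> m0"
      unfolding m0_def using w'pos \<mu> gamma_gt_1 by (intro powr_mono2') auto
    then have "4 * A * real CARD('n) * w' t powr (1 - \<gamma>) \<le> 4 * A * real CARD('n) * m0"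
      using A_pos by (intro mult_left_mono) auto
    also have "\<dots> \<le> 4 * A * real CARD('n) * (\<sigma> + 1) * m0"
      using A_pos m0 sigma_pos by (simp add: mult_ac)
    also have "\<dots> \<le> t" using \<rho> t\<rho> by (simp add: m0_def)
    finally have "4 * A * real CARD('n) * w' t powr (1 - \<gamma>) \<le> t" .
    then have "w' t powr \<gamma> * (4 * A * real CARD('n) * w' t powr (1 - \<gamma>)) \<le> w' t powr \<gamma> * t"
      by (intro mult_left_mono) auto
    moreover have "w' t powr \<gamma> * w' t powr (1 - \<gamma>) = w' t" using W by (simp flip: powr_add)
    ultimately have "4 * A * real CARD('n) * w' t \<le> w' t powr \<gamma> * t" by (metis mult.assoc mult.left_commute)
    then have "4 * A * real CARD('n) * w' t / t \<le> w' t powr \<gamma>" using t0 by (simp add: pos_divide_le_eq)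
    then have "w' t powr \<alpha> * (4 * A * real CARD('n) * w' t / t) \<le> w' t powr \<alpha> * w' t powr \<gamma>"
      by (intro mult_left_mono) auto
    then show ?thesis unfolding gam_split by (simp add: mult_ac)
  qed
  have b3: "4 * (w' t powr \<alpha> * (A * real CARD('n) * w2 t)) \<le> P"
  proof -
    have vt: "0 < v t" "v t \<le> 1" using vpos[of t] tR' R' t0 R0 by (auto simp: v_def)
    define q where "q = v t powr (- \<sigma> - 1)"
    have q: "\<mu> * q \<le> w' t" "q > 0" using \<mu> vt by (auto simp: q_def w'_def)
    \<comment> \<open>Here \<open>(\<sigma> + 1) * \<gamma>\<close> equals
      \<open>\<sigma> + 1 + \<gamma>\<close>, which exceeds \<open>\<sigma> + 2\<close>. So the
      gradient term dominates the second derivative right up to the blow-up.\<close>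
    have "q powr \<gamma> = v t powr ((- \<sigma> - 1) * \<gamma>)" by (simp add: q_def powr_powr)
    also have "(- \<sigma> - 1) * \<gamma> = - \<sigma> - 1 - \<gamma>"
      using sigma_add_1_mult by (simp add: algebra_simps)
    also have "v t powr (- \<sigma> - 1 - \<gamma>) \<ge> v t powr (- \<sigma> - 2)"
      using vt gamma_gt_1 by (intro powr_mono') auto
    finally have q2: "v t powr (- \<sigma> - 2) \<le> q powr \<gamma>" .
    have e1: "4 * A * real CARD('n) * ((\<sigma> + 1) / R) \<le> \<mu> powr (\<gamma> - 1)"
    proof -
      have "4 * A * real CARD('n) * (\<sigma> + 1) * m0 \<le> R" using \<rho> R by (simp add: m0_def)
      then have "(4 * A * real CARD('n) * (\<sigma> + 1) * m0) * \<mu> powr (\<gamma> - 1) \<le> R * \<mu> powr (\<gamma> - 1)"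
        by (intro mult_right_mono) auto
      moreover have "m0 * \<mu> powr (\<gamma> - 1) = 1" using \<mu> by (simp add: m0_def flip: powr_add)
      ultimately have "4 * A * real CARD('n) * (\<sigma> + 1) \<le> R * \<mu> powr (\<gamma> - 1)" by (simp add: mult.assoc)
      then have "4 * A * real CARD('n) * (\<sigma> + 1) / R \<le> \<mu> powr (\<gamma> - 1)"
        using R0 by (simp add: pos_divide_le_eq mult.commute)
      then show ?thesis by simp
    qed
    have "4 * A * real CARD('n) * w2 t = (4 * A * real CARD('n) * ((\<sigma> + 1) / R)) * (\<mu> * v t powr (- \<sigma> - 2))"
      by (simp add: w2_def mult_ac)
    also have "\<dots> \<le> \<mu> powr (\<gamma> - 1) * (\<mu> * q powr \<gamma>)"
      using e1 q2 \<mu> by (intro mult_mono mult_left_mono) auto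
    also have "\<dots> = (\<mu> * q) powr \<gamma>"
    proof -
      have "\<mu> powr (\<gamma> - 1) * \<mu> = \<mu> powr \<gamma>" using \<mu> by (metis add.commute diff_add_cancel powr_add powr_one less_imp_le)
      then show ?thesis using \<mu> q by (simp add: powr_mult flip: mult.assoc)
    qed
    also have "\<dots> \<le> w' t powr \<gamma>" using q \<mu> gamma_gt_1 by (intro powr_mono2) auto
    finally have "w' t powr \<alpha> * (4 * A * real CARD('n) * w2 t) \<le> w' t powr \<alpha> * w' t powr \<gamma>"
      by (intro mult_left_mono) auto
    then show ?thesis unfolding gam_split by (simp add: mult_ac)
  qed
  have "w' t powr \<alpha> * (A * real CARD('n) * C) = w' t powr \<alpha> * (A * real CARD('n) * (w' t / t)) + w' t powr \<alpha> * (A * real CARD('n) * w2 t)"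
    by (simp add: C_def algebra_simps)
  then show False using main b1 b2 b3 P unfolding P_def[symmetric] by linarith
qed

section \<open>Doubling of variables\<close>

lemma divide_by_gradient_power:
  assumes s: "0 < s"
  shows "s powr \<beta> - s powr \<alpha> * T \<le> K \<Longrightarrow> s powr \<gamma> - T \<le> K * s powr (- \<alpha>)"
    and "K \<le> s powr \<beta> - s powr \<alpha> * T \<Longrightarrow> K * s powr (- \<alpha>) \<le> s powr \<gamma> - T"
proof -
  have eq: "(s powr \<beta> - s powr \<alpha> * T) * s powr (- \<alpha>) = s powr \<gamma> - T"
  proof -
    have 1: "s powr \<beta> * s powr (- \<alpha>) = s powr \<gamma>" by (simp add: beta_eq flip: powr_add)
    have 2: "s powr \<alpha> * s powr (- \<alpha>) = 1" using s by (simp flip: powr_add)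
    have "(s powr \<beta> - s powr \<alpha> * T) * s powr (- \<alpha>) = s powr \<beta> * s powr (- \<alpha>) - (s powr \<alpha> * s powr (- \<alpha>)) * T"
      by (simp add: algebra_simps)
    then show ?thesis by (simp only: 1 2 mult_1)
  qed
  show "s powr \<gamma> - T \<le> K * s powr (- \<alpha>)" if "s powr \<beta> - s powr \<alpha> * T \<le> K"
    using mult_right_mono[OF that, of "s powr (- \<alpha>)"] unfolding eq by simp
  show "K * s powr (- \<alpha>) \<le> s powr \<gamma> - T" if "K \<le> s powr \<beta> - s powr \<alpha> * T"
    using mult_right_mono[OF that, of "s powr (- \<alpha>)"] unfolding eq by simp
qed

text \<open>The sign of \<alpha> decides which end of the range of slopes is critical. The upper end
  is relaxed to \<open>8 * l\<close> so that both cases share one constant.\<close>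

lemma powr_minus_alpha_bound:
  assumes l: "0 < l" and s: "l / 8 \<le> s" "s \<le> 2 * l"
  shows "s powr (- \<alpha>) \<le> 8 powr \<bar>\<alpha>\<bar> * l powr (- \<alpha>)"
proof (cases "\<alpha> \<ge> 0")
  case True
  have "s powr (- \<alpha>) \<le> (l / 8) powr (- \<alpha>)" using True l s by (intro powr_mono2') auto
  also have "\<dots> = 8 powr \<bar>\<alpha>\<bar> * l powr (- \<alpha>)" using True l by (simp add: powr_divide powr_minus field_simps)
  finally show ?thesis .
next
  case False
  have "s powr (- \<alpha>) \<le> (8 * l) powr (- \<alpha>)" using False l s by (intro powr_mono2) auto
  also have "\<dots> = 8 powr \<bar>\<alpha>\<bar> * l powr (- \<alpha>)" using False l by (simp add: powr_mult)
  finally show ?thesis .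
qed

text \<open>The concave profile \<open>om\<close> makes \<open>X + Y\<close> very negative in the direction \<open>e\<close> joining the two
  points, which the ellipticity turns into the term \<open>2 a l / s0\<close>.\<close>

lemma doubling_estimate:
  fixes u :: "real^'n \<Rightarrow> real"
  assumes cont: "continuous_on (cball x1 (r + s0)) u"
    and sub: "jet_subsolution \<alpha> \<beta> F K (ball x1 (r + s0)) u"
    and sup: "jet_supersolution \<alpha> \<beta> F K (ball x1 (r + s0)) u"
    and K: "0 \<le> K" and r: "0 < r" and s0: "0 < s0" and l: "0 < l" and m: "0 \<le> m" and \<eta>: "0 < \<eta>"
    and b1: "\<And>x y. norm (x - x1) \<le> r \<Longrightarrow> norm (x - y) \<le> s0 \<Longrightarrow> u x - u y \<le> \<eta> + m * r\<^sup>2"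
    and b2: "\<And>x y. norm (x - x1) \<le> r \<Longrightarrow> norm (x - y) = s0 \<Longrightarrow> u x - u y \<le> \<eta> + 3 / 4 * l * s0"
    and b3: "8 * m * r \<le> l"
    and b4: "2 * m * real CARD('n) * A + \<gamma> * (2 * l) powr (\<gamma> - 1) * (2 * m * r)
       + 2 * K * 8 powr \<bar>\<alpha>\<bar> * l powr (- \<alpha>) < 2 * a * l / s0"
    and y1: "norm (x1 - y1) \<le> s0"
  shows "u x1 - u y1 \<le> \<eta> + l * norm (x1 - y1)"
proof (rule ccontr)
  assume contr: "\<not> ?thesis"
  \<comment> \<open>On the range from 0 to \<open>s0\<close> the slope of \<open>om\<close> falls
    from 1 to 1/2, and its second derivative is the constant \<open>- 1 / (2 * s0)\<close>. The
    value \<open>3 / 4 * s0\<close> at the end is the one in \<open>b2\<close>.\<close>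
  define om where "om t = t - t\<^sup>2 / (4 * s0)" for t
  have om_le: "om t \<le> t" for t using s0 by (simp add: om_def)
  have om_ge: "0 \<le> om t" if "0 \<le> t" "t \<le> s0" for t
  proof -
    have "t * t \<le> t * (4 * s0)" using that s0 by (intro mult_left_mono) auto
    then show ?thesis using s0 by (simp add: om_def pos_divide_le_eq power2_eq_square)
  qed
  have om_s0: "om s0 = 3 / 4 * s0" using s0 by (simp add: om_def power2_eq_square)
  \<comment> \<open>A positive maximum over \<open>G\<close> cannot lie on the diagonal because of
    \<eta>, at distance \<open>s0\<close> because of \<open>b2\<close>, or on the sphere of radius
    \<open>r\<close> because of \<open>b1\<close> and the penalty with \<open>m\<close>.\<close>
  define \<Phi> where "\<Phi> z = u (fst z) - u (snd z) - \<eta> - l * om (norm (fst z - snd z)) - m * (norm (fst z - x1))\<^sup>2"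
    for z :: "(real^'n) \<times> (real^'n)"
  define G where "G = {z :: (real^'n) \<times> (real^'n). norm (fst z - x1) \<le> r \<and> norm (fst z - snd z) \<le> s0}"
  have Gsub: "fst z \<in> cball x1 (r + s0)" "snd z \<in> cball x1 (r + s0)" if "z \<in> G" for z
  proof -
    have "norm (snd z - x1) \<le> norm (fst z - x1) + norm (fst z - snd z)"
      using norm_triangle_ineq4[of "fst z - x1" "fst z - snd z"] by simp
    then show "fst z \<in> cball x1 (r + s0)" "snd z \<in> cball x1 (r + s0)"
      using that s0 by (auto simp: G_def dist_norm norm_minus_commute)
  qed
  have "closed G"
    unfolding G_def by (intro closed_Collect_conj closed_Collect_le continuous_intros)
  moreover have "bounded G"
    by (rule bounded_subset[OF bounded_Times[OF bounded_cball bounded_cball], of _ x1 "r + s0" x1 "r + s0"])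
      (use Gsub in \<open>force simp: mem_Times_iff\<close>)
  ultimately have compG: "compact G" by (simp add: compact_eq_bounded_closed)
  have cu1: "continuous_on G (\<lambda>z. u (fst z))"
    by (rule continuous_on_compose2[OF cont]) (use Gsub in \<open>auto intro!: continuous_intros\<close>)
  have cu2: "continuous_on G (\<lambda>z. u (snd z))"
    by (rule continuous_on_compose2[OF cont]) (use Gsub in \<open>auto intro!: continuous_intros\<close>)
  have cont\<Phi>: "continuous_on G \<Phi>"
    unfolding \<Phi>_def om_def using s0 by (intro continuous_intros cu1 cu2) auto
  have y1G: "(x1, y1) \<in> G" using y1 r by (simp add: G_def)
  have \<Phi>1: "\<Phi> (x1, y1) > 0"
  proof -
    have "l * om (norm (x1 - y1)) \<le> l * norm (x1 - y1)" using l om_le by (intro mult_left_mono) auto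
    then show ?thesis using contr by (simp add: \<Phi>_def)
  qed
  obtain zz where zz: "zz \<in> G" "\<And>z. z \<in> G \<Longrightarrow> \<Phi> z \<le> \<Phi> zz"
    using continuous_attains_sup[OF compG _ cont\<Phi>] y1G by blast
  obtain x y where xy: "zz = (x, y)" by (cases zz)
  have pos: "\<Phi> (x, y) > 0" using zz(2)[OF y1G] \<Phi>1 xy by simp
  define s where "s = norm (x - y)"
  have inG: "norm (x - x1) \<le> r" "s \<le> s0" using zz(1) by (auto simp: G_def xy s_def)
  have s_pos: "s > 0"
  proof (rule ccontr)
    assume "\<not> s > 0"
    then have "x = y" by (simp add: s_def)
    moreover have "0 \<le> m * (norm (x - x1))\<^sup>2" using m by simp
    ultimately show False using pos \<eta> by (simp add: \<Phi>_def om_def)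
  qed
  have s_lt: "s < s0"
  proof (rule ccontr)
    assume "\<not> s < s0"
    then have "s = s0" using inG by simp
    then have "u x - u y \<le> \<eta> + 3 / 4 * l * s0" using b2[OF inG(1)] by (simp add: s_def)
    moreover have "0 \<le> m * (norm (x - x1))\<^sup>2" using m by simp
    ultimately show False using pos om_s0 \<open>s = s0\<close> by (simp add: \<Phi>_def s_def[symmetric])
  qed
  have x_in: "norm (x - x1) < r"
  proof (rule ccontr)
    assume "\<not> norm (x - x1) < r"
    then have "norm (x - x1) = r" using inG by simp
    moreover have "u x - u y \<le> \<eta> + m * r\<^sup>2" using b1[OF inG(1)] inG(2) by (simp add: s_def)
    moreover have "0 \<le> l * om s" using l om_ge[of s] s_pos inG(2) by simp
    ultimately show False using pos by (simp add: \<Phi>_def s_def[symmetric])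
  qed
  define n where "n = real CARD('n)"
  have n: "n \<ge> 1" using dim_ge_1 by (simp add: n_def)
  define G1 where "G1 = \<gamma> * (2 * l) powr (\<gamma> - 1)"
  have G1: "G1 > 0" using gamma_gt_1 l by (simp add: G1_def)
  define E where "E = 8 powr \<bar>\<alpha>\<bar> * l powr (- \<alpha>)"
  define gap where "gap = 2 * a * l / s0 - (2 * m * n * A + G1 * (2 * m * r) + 2 * K * E)"
  have gap: "gap > 0" using b4 by (simp add: gap_def n_def G1_def E_def mult.assoc)
  \<comment> \<open>\<open>gap\<close> is the slack in \<open>b4\<close>. The perturbation
    \<open>4 * c\<close> in the matrix bound uses up a quarter of it.\<close>
  define c where "c = gap / (16 * A * n)"
  have c: "c > 0" using gap A_pos n by (simp add: c_def)
  \<comment> \<open>The three bounds keep the perturbed slopes between \<open>l / 8\<close> and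
    \<open>2 * l\<close>, keep the jet points inside the ball, and limit the error in the gradient
    term to a quarter of \<open>gap\<close>.\<close>
  define \<delta> where "\<delta> = min (l / 8) (min (s0 - s) (gap / (8 * G1)))"
  have \<delta>: "\<delta> > 0" "\<delta> \<le> l / 8" "\<delta> \<le> s0 - s" "\<delta> \<le> gap / (8 * G1)"
  proof -
    show "\<delta> > 0" using l s_lt gap G1 by (simp add: \<delta>_def)
    show "\<delta> \<le> l / 8" unfolding \<delta>_def by (rule min.cobounded1)
    have "\<delta> \<le> min (s0 - s) (gap / (8 * G1))" unfolding \<delta>_def by (rule min.cobounded2)
    then show "\<delta> \<le> s0 - s" "\<delta> \<le> gap / (8 * G1)" by (auto simp only: min.bounded_iff)
  qed
  define e where "e = (1 / s) *\<^sub>R (x - y)"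
  have e: "norm e = 1" using s_pos by (simp add: e_def s_def)
  have ee: "e \<bullet> e = 1" using e by (simp add: dot_square_norm)
  define w1 where "w1 = 1 - s / (2 * s0)"
  have w1: "1 / 2 \<le> w1" "w1 \<le> 1" using s_pos s_lt s0 by (auto simp: w1_def field_simps)
  \<comment> \<open>The Hessian of \<open>om (norm \<xi>)\<close> at \<open>\<xi> = x - y\<close>:
    the projection orthogonal to \<open>e\<close>, divided by \<open>s\<close>, comes from the norm,
    and the multiple of the identity from the square.\<close>
  define S where "S v = (1 / s) *\<^sub>R (v - (e \<bullet> v) *\<^sub>R e) - (1 / (2 * s0)) *\<^sub>R v" for v :: "real^'n"
  have Sq: "v \<bullet> S v = ((norm v)\<^sup>2 - (e \<bullet> v)\<^sup>2) / s - (norm v)\<^sup>2 / (2 * s0)" for v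
    by (simp add: S_def inner_diff_right dot_square_norm inner_commute power2_eq_square)
  have Ssym: "S v \<bullet> w = v \<bullet> S w" for v w
    by (simp add: S_def inner_diff_right inner_diff_left inner_commute algebra_simps)
  have Sadd: "S (v + w) = S v + S w" for v w by (simp add: S_def algebra_simps)
  have Sscale: "S (t *\<^sub>R v) = t *\<^sub>R S v" for t v by (simp add: S_def algebra_simps)
  have expansion: "\<exists>d>0. \<forall>\<xi>. norm \<xi> < d \<longrightarrow>
      om (norm (x - y + \<xi>)) \<le> om s + w1 * (e \<bullet> \<xi>) + (\<xi> \<bullet> S \<xi>) / 2 + t * (norm \<xi>)\<^sup>2" if t: "t > 0" for t
  proof (intro exI[of _ "min (s / 2) (t * s\<^sup>2)"] conjI allI impI)
    show "0 < min (s / 2) (t * s\<^sup>2)" using s_pos t by simp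
    fix \<xi> :: "real^'n" assume \<xi>: "norm \<xi> < min (s / 2) (t * s\<^sup>2)"
    define q where "q = e \<bullet> \<xi>"
    have q: "\<bar>q\<bar> \<le> norm \<xi>" using Cauchy_Schwarz_ineq2[of e \<xi>] e by (simp add: q_def)
    define b where "b = (norm \<xi>)\<^sup>2 - q\<^sup>2"
    have b: "0 \<le> b" "b \<le> (norm \<xi>)\<^sup>2" using q by (auto simp: b_def abs_le_square_iff[symmetric])
    have A': "s + q \<ge> s / 2" using q \<xi> by (simp add: abs_le_iff)
    have sq: "(norm (x - y + \<xi>))\<^sup>2 = s\<^sup>2 + 2 * s * q + (norm \<xi>)\<^sup>2"
    proof -
      have "(x - y) \<bullet> \<xi> = s * q" using s_pos by (simp add: q_def e_def)
      then show ?thesis unfolding s_def power2_norm_eq_inner by (simp add: algebra_simps inner_commute)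
    qed
    have "0 \<le> (norm (x - y + \<xi>) - (s + q))\<^sup>2" by simp
    then have "norm (x - y + \<xi>) * (2 * (s + q)) \<le> (norm (x - y + \<xi>))\<^sup>2 + (s + q)\<^sup>2"
      by (simp add: power2_diff algebra_simps)
    also have "\<dots> = (s + q) * (2 * (s + q)) + b" unfolding sq b_def by (simp add: power2_eq_square algebra_simps)
    finally have "norm (x - y + \<xi>) \<le> ((s + q) * (2 * (s + q)) + b) / (2 * (s + q))"
      using A' s_pos by (subst pos_le_divide_eq) auto
    then have 1: "norm (x - y + \<xi>) \<le> s + q + b / (2 * (s + q))"
      using A' s_pos by (simp add: add_divide_distrib)
    have 2: "b / (2 * (s + q)) \<le> b / (2 * s) + t * (norm \<xi>)\<^sup>2"
    proof -
      have "1 / (2 * b') - 1 / (2 * s) = (s - b') / (2 * s * b')" if "b' > 0" for b'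
        using that s_pos by (simp add: field_simps)
      from this[of "s + q"] have "1 / (2 * (s + q)) - 1 / (2 * s) = - q / (2 * s * (s + q))"
        using A' s_pos by simp
      also have "\<dots> \<le> norm \<xi> / (2 * s * (s / 2))"
        using A' s_pos q by (intro frac_le) (auto simp: abs_le_iff)
      also have "\<dots> = norm \<xi> / s\<^sup>2" by (simp add: power2_eq_square)
      also have "\<dots> \<le> t" using \<xi> s_pos by (simp add: pos_divide_le_eq)
      finally have "b * (1 / (2 * (s + q)) - 1 / (2 * s)) \<le> (norm \<xi>)\<^sup>2 * t"
        using b t by (meson mult_left_mono mult_right_mono order_trans less_imp_le)
      then show ?thesis by (simp add: algebra_simps)
    qed
    have 3: "(\<xi> \<bullet> S \<xi>) / 2 = b / (2 * s) - (norm \<xi>)\<^sup>2 / (4 * s0)"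
      unfolding Sq b_def q_def by (simp add: diff_divide_distrib)
    have 4: "om (norm (x - y + \<xi>)) = norm (x - y + \<xi>) - (s\<^sup>2 + 2 * s * q + (norm \<xi>)\<^sup>2) / (4 * s0)"
      unfolding om_def sq ..
    have 5: "om s + w1 * q = s + q - (s\<^sup>2 + 2 * s * q) / (4 * s0)"
      using s0 by (simp add: om_def w1_def field_simps)
    show "om (norm (x - y + \<xi>)) \<le> om s + w1 * (e \<bullet> \<xi>) + (\<xi> \<bullet> S \<xi>) / 2 + t * (norm \<xi>)\<^sup>2"
      using 1 2 5 unfolding 3 4 q_def[symmetric] add_divide_distrib by linarith
  qed
  have "0 < c / (4 * l)" using c l by simp
  from expansion[OF this] obtain d where d: "d > 0" "\<And>\<xi>. norm \<xi> < d \<Longrightarrow>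
      om (norm (x - y + \<xi>)) \<le> om s + w1 * (e \<bullet> \<xi>) + (\<xi> \<bullet> S \<xi>) / 2 + c / (4 * l) * (norm \<xi>)\<^sup>2"
    by blast
  define \<rho> where "\<rho> = min (r - norm (x - x1)) (min ((s0 - s) / 2) (d / 4))"
  have \<rho>: "\<rho> > 0" "\<rho> \<le> r - norm (x - x1)" "2 * \<rho> \<le> s0 - s" "2 * \<rho> < d"
    using x_in s_lt d(1) by (auto simp: \<rho>_def min_def)
  \<comment> \<open>The Hessian of the penalty in both variables, raised by \<open>2 * c\<close>.
    Half of this pays for the Taylor error of \<open>om\<close>, the other half is the strictness
    \<open>c / 2\<close> required by \<open>theorem_on_sums\<close>.\<close>
  define Q where "Q \<zeta> = (l *\<^sub>R S (fst \<zeta> - snd \<zeta>) + (2 * m + 2 * c) *\<^sub>R fst \<zeta>, - (l *\<^sub>R S (fst \<zeta> - snd \<zeta>)) + (2 * c) *\<^sub>R snd \<zeta>)"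
    for \<zeta> :: "(real^'n) \<times> (real^'n)"
  define P1 where "P1 = (l * w1) *\<^sub>R e + (2 * m) *\<^sub>R (x - x1)"
  define P2 where "P2 = - ((l * w1) *\<^sub>R e)"
  have linQ: "linear Q"
  proof (rule linearI)
    fix \<zeta> \<xi> :: "(real^'n) \<times> (real^'n)" and t :: real
    have "fst (\<zeta> + \<xi>) - snd (\<zeta> + \<xi>) = (fst \<zeta> - snd \<zeta>) + (fst \<xi> - snd \<xi>)" by simp
    then show "Q (\<zeta> + \<xi>) = Q \<zeta> + Q \<xi>"
      unfolding Q_def by (simp only: Sadd) (simp add: algebra_simps)
    have "fst (t *\<^sub>R \<zeta>) - snd (t *\<^sub>R \<zeta>) = t *\<^sub>R (fst \<zeta> - snd \<zeta>)" by (simp add: algebra_simps)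
    then show "Q (t *\<^sub>R \<zeta>) = t *\<^sub>R Q \<zeta>"
      unfolding Q_def by (simp only: Sscale) (simp add: algebra_simps)
  qed
  have symQ: "Q \<zeta> \<bullet> \<xi> = \<zeta> \<bullet> Q \<xi>" for \<zeta> \<xi>
  proof -
    have "Q \<zeta> \<bullet> \<xi> = l * (S (fst \<zeta> - snd \<zeta>) \<bullet> (fst \<xi> - snd \<xi>)) + (2 * m + 2 * c) * (fst \<zeta> \<bullet> fst \<xi>) + 2 * c * (snd \<zeta> \<bullet> snd \<xi>)"
      by (simp add: Q_def inner_prod_def inner_add_left inner_diff_left inner_diff_right right_diff_distrib)
    moreover have "\<zeta> \<bullet> Q \<xi> = l * ((fst \<zeta> - snd \<zeta>) \<bullet> S (fst \<xi> - snd \<xi>)) + (2 * m + 2 * c) * (fst \<zeta> \<bullet> fst \<xi>) + 2 * c * (snd \<zeta> \<bullet> snd \<xi>)"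
      by (simp add: Q_def inner_prod_def inner_add_right inner_diff_left inner_diff_right right_diff_distrib)
    ultimately show ?thesis by (simp add: Ssym)
  qed
  have Qq: "(h, k) \<bullet> Q (h, k) = l * ((h - k) \<bullet> S (h - k)) + 2 * m * (norm h)\<^sup>2 + 2 * c * (norm (h, k))\<^sup>2" for h k
    by (simp add: Q_def inner_prod_def inner_add_right inner_diff_left dot_square_norm norm_Pair algebra_simps)
  have contx: "continuous_on (cball x \<rho>) u"
  proof (rule continuous_on_subset[OF cont], rule subsetI)
    fix v assume "v \<in> cball x \<rho>"
    then have "norm (v - x) \<le> \<rho>" by (simp add: dist_norm norm_minus_commute)
    then have "norm (v - x1) \<le> r + s0"
      using norm_triangle_ineq[of "v - x" "x - x1"] \<rho>(2) s0 by simp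
    then show "v \<in> cball x1 (r + s0)" by (simp add: dist_norm norm_minus_commute)
  qed
  have "continuous_on (cball y \<rho>) u"
  proof (rule continuous_on_subset[OF cont], rule subsetI)
    fix v assume "v \<in> cball y \<rho>"
    then have "norm (v - y) \<le> \<rho>" by (simp add: dist_norm norm_minus_commute)
    moreover have "norm (y - x1) \<le> s + norm (x - x1)"
      using norm_triangle_ineq4[of "x - x1" "x - y"] by (simp add: s_def)
    ultimately have "norm (v - x1) \<le> r + s0"
      using norm_triangle_ineq[of "v - y" "y - x1"] \<rho> x_in by simp
    then show "v \<in> cball x1 (r + s0)" by (simp add: dist_norm norm_minus_commute)
  qed
  then have conty: "continuous_on (cball y \<rho>) (\<lambda>v. - u v)" by (intro continuous_intros)
  have bound: "u (x + h) + - u (y + k) \<le> u x + - u y + P1 \<bullet> h + P2 \<bullet> k + ((h, k) \<bullet> Q (h, k)) / 2 - c / 2 * (norm (h, k))\<^sup>2"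
    if h: "norm h \<le> \<rho>" and k: "norm k \<le> \<rho>" for h k
  proof -
    define \<xi> where "\<xi> = h - k"
    have \<xi>: "norm \<xi> \<le> 2 * \<rho>" using norm_triangle_ineq4[of h k] h k by (simp add: \<xi>_def)
    have eq: "x + h - (y + k) = x - y + \<xi>" by (simp add: \<xi>_def algebra_simps)
    have "norm (x + h - x1) \<le> norm (x - x1) + norm h"
      using norm_triangle_ineq[of "x - x1" h] by (simp add: algebra_simps)
    moreover have "norm (x - y + \<xi>) \<le> s + norm \<xi>" unfolding s_def by (rule norm_triangle_ineq)
    ultimately have "(x + h, y + k) \<in> G" using h \<xi> \<rho> by (simp add: G_def eq)
    from zz(2)[OF this] have "\<Phi> (x + h, y + k) \<le> \<Phi> (x, y)" by (simp add: xy)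
    then have 1: "u (x + h) - u (y + k) \<le> u x - u y + l * om (norm (x - y + \<xi>)) - l * om s
        + m * (norm (x + h - x1))\<^sup>2 - m * (norm (x - x1))\<^sup>2"
      by (simp add: \<Phi>_def eq s_def)
    have "l * om (norm (x - y + \<xi>)) \<le> l * (om s + w1 * (e \<bullet> \<xi>) + (\<xi> \<bullet> S \<xi>) / 2 + c / (4 * l) * (norm \<xi>)\<^sup>2)"
      using d(2)[of \<xi>] \<xi> \<rho>(4) l by (intro mult_left_mono) auto
    also have "\<dots> = l * om s + l * w1 * (e \<bullet> \<xi>) + l * (\<xi> \<bullet> S \<xi>) / 2 + c / 4 * (norm \<xi>)\<^sup>2"
      using l by (simp add: algebra_simps)
    finally have 2: "l * om (norm (x - y + \<xi>)) \<le> l * om s + l * w1 * (e \<bullet> \<xi>) + l * (\<xi> \<bullet> S \<xi>) / 2 + c / 4 * (norm \<xi>)\<^sup>2" .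
    have 3: "c / 4 * (norm \<xi>)\<^sup>2 \<le> c / 2 * (norm (h, k))\<^sup>2"
    proof -
      have "(norm \<xi>)\<^sup>2 + (norm (h + k))\<^sup>2 = 2 * (norm (h, k))\<^sup>2"
        unfolding \<xi>_def power2_norm_eq_inner inner_prod_def by (simp add: algebra_simps)
      then have "(norm \<xi>)\<^sup>2 \<le> 2 * (norm (h, k))\<^sup>2" using zero_le_power2[of "norm (h + k)"] by linarith
      then have "c / 4 * (norm \<xi>)\<^sup>2 \<le> c / 4 * (2 * (norm (h, k))\<^sup>2)" using c by (intro mult_left_mono) auto
      then show ?thesis by simp
    qed
    have 4: "m * (norm (x + h - x1))\<^sup>2 - m * (norm (x - x1))\<^sup>2 = 2 * m * ((x - x1) \<bullet> h) + m * (norm h)\<^sup>2"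
    proof -
      have "x + h - x1 = (x - x1) + h" by simp
      then have "(norm (x + h - x1))\<^sup>2 = (norm (x - x1))\<^sup>2 + 2 * ((x - x1) \<bullet> h) + (norm h)\<^sup>2"
        unfolding power2_norm_eq_inner by (simp only: inner_add_left inner_add_right) (simp add: inner_commute)
      then show ?thesis by (simp only:) (simp add: algebra_simps)
    qed
    have 5: "P1 \<bullet> h + P2 \<bullet> k = l * w1 * (e \<bullet> \<xi>) + 2 * m * ((x - x1) \<bullet> h)"
      by (simp add: P1_def P2_def \<xi>_def inner_add_left inner_diff_right algebra_simps)
    have 6: "((h, k) \<bullet> Q (h, k)) / 2 = l * (\<xi> \<bullet> S \<xi>) / 2 + m * (norm h)\<^sup>2 + c * (norm (h, k))\<^sup>2"
      unfolding Qq \<xi>_def by simp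
    show ?thesis using 1 2 3 4 5 unfolding 6 by linarith
  qed
  have c2: "0 < c / 2" using c by simp
  from theorem_on_sums[OF \<rho>(1) contx conty linQ symQ c2 \<delta>(1) bound]
  obtain x' y' p q X Y where near: "norm (x' - x) < \<delta>" "norm (y' - y) < \<delta>" "norm (p - P1) < \<delta>" "norm (q - P2) < \<delta>"
    and XY: "X \<in> Sym" "Y \<in> Sym" and jets: "upper_jet u x' p X" "upper_jet (\<lambda>v. - u v) y' q Y"
    and quad: "\<And>h k. h \<bullet> (X *v h) + k \<bullet> (Y *v k) \<le> (h, k) \<bullet> Q (h, k)"
    by blast
  have x'B: "x' \<in> ball x1 (r + s0)"
    using norm_triangle_ineq[of "x' - x" "x - x1"] near(1) x_in \<delta>(3) s_pos
    by (simp add: dist_norm norm_minus_commute[of x1])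
  have y'B: "y' \<in> ball x1 (r + s0)"
  proof -
    have "norm (y - x1) \<le> s + norm (x - x1)"
      using norm_triangle_ineq4[of "x - x1" "x - y"] by (simp add: s_def)
    then show ?thesis
      using norm_triangle_ineq[of "y' - y" "y - x1"] near(2) x_in \<delta>(3)
      by (simp add: dist_norm norm_minus_commute[of x1])
  qed
  define C where "C = 2 * m + 4 * c"
  have C0: "C \<ge> 0" using m c by (simp add: C_def)
  \<comment> \<open>Equal increments \<open>(v, v)\<close> cancel \<open>S\<close> in the matrix
    bound and show that \<open>N\<close> is nonnegative. Opposite increments \<open>(e, - e)\<close>
    pick up four times the second derivative of \<open>om\<close> and force the trace of
    \<open>N\<close> to be at least \<open>2 * l / s0\<close>. As \<open>- Y\<close> is
    \<open>X - C *\<^sub>R mat 1 + N\<close>, ellipticity turns this trace into the gain in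
    \<open>FY\<close>.\<close>
  define N where "N = C *\<^sub>R mat 1 - X - Y"
  have NS: "N \<in> Sym" unfolding N_def by (intro Sym_diff scaled_identity_Sym XY)
  have Nq: "v \<bullet> (N *v v) = C * (norm v)\<^sup>2 - (v \<bullet> (X *v v) + v \<bullet> (Y *v v))" for v
    by (simp add: N_def matrix_vector_mult_diff_rdistrib scaled_identity_mult inner_diff_right dot_square_norm)
  have nP: "(norm (v, v))\<^sup>2 = 2 * (norm v)\<^sup>2" "(norm (v, - v))\<^sup>2 = 2 * (norm v)\<^sup>2" for v :: "real^'n"
    by (simp_all add: norm_Pair)
  have "0 \<le> v \<bullet> (N *v v)" for v
    using quad[of v v] unfolding Nq Qq nP by (simp add: S_def C_def algebra_simps)
  then have psdN: "psd N" using NS by (simp add: psd_def)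
  have Ne: "2 * l / s0 \<le> e \<bullet> (N *v e)"
  proof -
    have S2: "(e - - e) \<bullet> S (e - - e) = - 2 / s0"
    proof -
      have Se: "e \<bullet> S e = - 1 / (2 * s0)" unfolding Sq ee e by simp
      have "e - - e = 2 *\<^sub>R e" by (simp add: scaleR_2)
      then have "(e - - e) \<bullet> S (e - - e) = 2 * (2 * (- 1 / (2 * s0)))"
        by (simp only: Sscale inner_scaleR_left inner_scaleR_right Se)
      then show ?thesis by simp
    qed
    have Yneg: "(- e) \<bullet> (Y *v (- e)) = e \<bullet> (Y *v e)"
      using matrix_vector_mult_scaleR[of Y "- 1" e] by simp
    have "e \<bullet> (X *v e) + e \<bullet> (Y *v e) \<le> l * (- 2 / s0) + 2 * m + 4 * c"
      using quad[of e "- e"] unfolding Qq nP S2 Yneg e by simp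
    then show ?thesis unfolding Nq C_def e by simp
  qed
  have trN: "2 * l / s0 \<le> trace N" using Ne psd_quadratic_form_le_trace[OF psdN e] by linarith
  have FY: "F X - A * n * C + a * (2 * l / s0) \<le> F (- Y)"
  proof -
    have "F X - A * n * C \<le> F (X - C *\<^sub>R mat 1)"
      unfolding n_def by (rule elliptic_scaled_identity(2)[OF F XY(1) C0])
    moreover have "a * trace N \<le> F (X - C *\<^sub>R mat 1 + N) - F (X - C *\<^sub>R mat 1)"
      using F Sym_diff[OF XY(1) scaled_identity_Sym] NS psdN unfolding elliptic_operator_def by blast
    moreover have "X - C *\<^sub>R mat 1 + N = - Y" by (simp add: N_def)
    moreover have "a * (2 * l / s0) \<le> a * trace N" using trN a_pos by (intro mult_left_mono) auto
    ultimately show ?thesis by simp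
  qed
  have nP2: "norm P2 = l * w1" using l w1 e by (simp add: P2_def)
  have lw: "l / 2 \<le> l * w1" "l * w1 \<le> l" using w1 l by auto
  have nq: "l / 8 \<le> norm q" "norm q \<le> 2 * l"
  proof -
    have "\<bar>norm q - l * w1\<bar> \<le> norm (q - P2)" using norm_triangle_ineq3[of q P2] by (simp only: nP2)
    then show "l / 8 \<le> norm q" "norm q \<le> 2 * l" using near(4) \<delta>(2) lw by linarith+
  qed
  have mx: "norm ((2 * m) *\<^sub>R (x - x1)) \<le> 2 * m * r" using m inG(1) by (simp add: mult_left_mono)
  have pP: "norm (p + P2) \<le> 2 * m * r + \<delta>"
  proof -
    have "p + P2 = (p - P1) + (2 * m) *\<^sub>R (x - x1)" by (simp add: P1_def P2_def)
    then have "norm (p + P2) \<le> norm (p - P1) + norm ((2 * m) *\<^sub>R (x - x1))"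
      by (simp only: norm_triangle_ineq)
    then show ?thesis using near(3) mx by linarith
  qed
  have np: "l / 8 \<le> norm p" "norm p \<le> 2 * l"
  proof -
    have "\<bar>norm p - norm (- P2)\<bar> \<le> norm (p - - P2)" by (rule norm_triangle_ineq3)
    then have "\<bar>norm p - l * w1\<bar> \<le> norm (p + P2)" by (simp only: norm_minus_cancel nP2 diff_minus_eq_add)
    moreover have "2 * m * r \<le> l / 4" using b3 by simp
    ultimately show "l / 8 \<le> norm p" "norm p \<le> 2 * l" using pP \<delta>(2) lw by linarith+
  qed
  have qp: "norm q \<le> norm p + (2 * m * r + 2 * \<delta>)"
  proof -
    have "norm q \<le> norm (q - P2) + norm P2" using norm_triangle_ineq[of "q - P2" P2] by simp
    moreover have "norm P2 \<le> norm (p + P2) + norm p"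
      using norm_triangle_ineq4[of "p + P2" p] by simp
    ultimately show ?thesis using near(4) pP by linarith
  qed
  have p0: "p \<noteq> 0" "q \<noteq> 0" using np nq l by auto
  then have ppos: "norm p > 0" "norm q > 0" by auto
  have "norm p powr \<beta> - norm p powr \<alpha> * F X \<le> K"
    using sub x'B XY(1) p0(1) jets(1) unfolding jet_subsolution_def by blast
  from divide_by_gradient_power(1)[OF ppos(1) this]
  have I1: "norm p powr \<gamma> - F X \<le> K * norm p powr (- \<alpha>)" .
  have "- K \<le> norm q powr \<beta> - norm q powr \<alpha> * F (- Y)"
    using sup y'B XY(2) p0(2) jets(2) unfolding jet_supersolution_def by blast
  from divide_by_gradient_power(2)[OF ppos(2) this]
  have I2: "- K * norm q powr (- \<alpha>) \<le> norm q powr \<gamma> - F (- Y)" .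
  have I3: "K * norm p powr (- \<alpha>) \<le> K * E" "K * norm q powr (- \<alpha>) \<le> K * E"
    unfolding E_def using K powr_minus_alpha_bound[OF l np] powr_minus_alpha_bound[OF l nq]
    by (auto intro: mult_left_mono)
  have D0: "0 \<le> 2 * m * r + 2 * \<delta>" using m r \<delta>(1) by simp
  have I4: "norm q powr \<gamma> - norm p powr \<gamma> \<le> G1 * (2 * m * r + 2 * \<delta>)"
    unfolding G1_def using powr_diff_le[OF _ ppos(1) ppos(2) nq(2) qp D0, of \<gamma>] gamma_gt_1 by simp
  have "G1 * \<delta> \<le> gap / 8" using \<delta>(4) G1 by (simp add: pos_le_divide_eq mult_ac)
  then have I5: "G1 * (2 * m * r + 2 * \<delta>) \<le> G1 * (2 * m * r) + gap / 4" by (simp add: algebra_simps)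
  have I6: "A * n * C = 2 * m * n * A + gap / 4"
    unfolding C_def c_def using A_pos n by (simp add: field_simps)
  have J2: "F (- Y) \<le> norm q powr \<gamma> + K * E" using I2 I3(2) by (simp only: mult_minus_left)
  have J1: "norm p powr \<gamma> - K * E \<le> F X" using I1 I3(1) by linarith
  have J3: "norm q powr \<gamma> - norm p powr \<gamma> \<le> G1 * (2 * m * r) + gap / 4" using I4 I5 by linarith
  have J4: "2 * a * l / s0 = gap + 2 * m * n * A + G1 * (2 * m * r) + 2 * (K * E)"
    by (simp add: gap_def)
  have "a * (2 * l / s0) = 2 * a * l / s0" by simp
  then have "2 * a * l / s0 \<le> F (- Y) - F X + (2 * m * n * A + gap / 4)" using FY unfolding I6 by linarith
  then show False using J1 J2 J3 J4 gap by linarith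
qed

end

text \<open>In the local improvement step below, \<open>k\<close> is the ratio of the range of the doubling argument to
  the distance \<open>d\<close> from the boundary, and \<open>T\<close> is a lower bound of the slope.\<close>

definition large_parameter :: "real \<Rightarrow> real \<Rightarrow> real \<Rightarrow> real \<Rightarrow> real \<Rightarrow> real \<Rightarrow> real \<Rightarrow> real \<Rightarrow> real \<Rightarrow> real \<Rightarrow> bool" where
  "large_parameter \<alpha> \<beta> \<gamma> \<sigma> a A n K D t \<longleftrightarrow> 0 < t \<and>
     (let B = 2 powr (\<sigma> + 1); c1 = 4 * (1 + B);
          c3 = 4 * B * (4 * A * n * (\<sigma> + 1) * c1 powr (\<gamma> - 1));
          k = c3 * t powr (1 - \<gamma>); T = t * D powr (- \<sigma>)
      in 64 * B * k \<le> 1 \<and> 4 * K \<le> (T / c1) powr \<beta> \<and>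
         128 * n * A * B * k\<^sup>2 + 16 * B * \<gamma> * 2 powr (\<gamma> - 1) * c3 * k
           + 2 * K * 8 powr \<bar>\<alpha>\<bar> * c3 * T powr (- \<beta>) < 2 * a)"

lemma eventually_large_parameter:
  assumes "1 < \<gamma>" "0 < \<beta>" "0 < a" "0 < D"
  shows "eventually (large_parameter \<alpha> \<beta> \<gamma> \<sigma> a A n K D) at_top"
proof -
  define B where "B = 2 powr (\<sigma> + 1)"
  define c1 where "c1 = 4 * (1 + B)"
  define c3 where "c3 = 4 * B * (4 * A * n * (\<sigma> + 1) * c1 powr (\<gamma> - 1))"
  define k where "k t = c3 * t powr (1 - \<gamma>)" for t
  define T where "T t = t * D powr (- \<sigma>)" for t
  have B: "B > 0" by (simp add: B_def)
  have c1: "c1 > 0" using B by (simp add: c1_def)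
  have T: "filterlim T at_top at_top"
    unfolding T_def using assms(4)
    by (subst mult.commute) (intro filterlim_tendsto_pos_mult_at_top[OF tendsto_const] filterlim_ident, simp)
  have Tc: "filterlim (\<lambda>t. T t / c1) at_top at_top"
    using filterlim_tendsto_pos_mult_at_top[OF tendsto_const _ T, of "1 / c1"] c1 by simp
  have k0: "(k \<longlongrightarrow> 0) at_top"
  proof -
    have "((\<lambda>t. t powr (1 - \<gamma>)) \<longlongrightarrow> 0) at_top"
      using assms(1) by (intro tendsto_neg_powr filterlim_ident) simp
    then show ?thesis unfolding k_def by (rule tendsto_mult_right_zero)
  qed
  have T0: "((\<lambda>t. T t powr (- \<beta>)) \<longlongrightarrow> 0) at_top"
    using assms(2) by (intro tendsto_neg_powr T) simp
  have "((\<lambda>t. 64 * B * k t) \<longlongrightarrow> 0) at_top" by (rule tendsto_mult_right_zero[OF k0])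
  then have E1: "eventually (\<lambda>t. 64 * B * k t < 1) at_top" by (rule order_tendstoD) simp
  have "((\<lambda>t. (T t / c1) powr (- \<beta>)) \<longlongrightarrow> 0) at_top"
    using assms(2) by (intro tendsto_neg_powr Tc) simp
  then have "eventually (\<lambda>t. (T t / c1) powr (- \<beta>) < 1 / (4 * \<bar>K\<bar> + 1)) at_top"
    by (rule order_tendstoD) (simp add: add_nonneg_pos)
  then have E2: "eventually (\<lambda>t. 4 * K \<le> (T t / c1) powr \<beta>) at_top"
    using filterlim_at_top_dense[THEN iffD1, OF Tc, rule_format, of 0]
  proof eventually_elim
    case (elim t)
    define P where "P = (T t / c1) powr \<beta>"
    have P: "P > 0" using elim(2) unfolding P_def powr_gt_zero by linarith
    have "1 / P < 1 / (4 * \<bar>K\<bar> + 1)" using elim(1) by (simp add: P_def powr_minus_divide)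
    then have "4 * \<bar>K\<bar> + 1 < P" using P by (simp add: field_simps)
    then show ?case unfolding P_def[symmetric] by linarith
  qed
  have "((\<lambda>t. 128 * n * A * B * (k t)\<^sup>2 + 16 * B * \<gamma> * 2 powr (\<gamma> - 1) * c3 * k t
           + 2 * K * 8 powr \<bar>\<alpha>\<bar> * c3 * T t powr (- \<beta>)) \<longlongrightarrow> 128 * n * A * B * 0\<^sup>2 + 16 * B * \<gamma> * 2 powr (\<gamma> - 1) * c3 * 0
           + 2 * K * 8 powr \<bar>\<alpha>\<bar> * c3 * 0) at_top"
    by (intro tendsto_intros k0 T0)
  then have E3: "eventually (\<lambda>t. 128 * n * A * B * (k t)\<^sup>2 + 16 * B * \<gamma> * 2 powr (\<gamma> - 1) * c3 * k t
           + 2 * K * 8 powr \<bar>\<alpha>\<bar> * c3 * T t powr (- \<beta>) < 2 * a) at_top"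
    by (rule order_tendstoD) (use assms(3) in simp)
  show ?thesis
    using E1 E2 E3 eventually_gt_at_top[of "0::real"]
    by eventually_elim (simp add: large_parameter_def Let_def k_def T_def B_def c1_def c3_def)
qed

section \<open>Halving the slope bound and iterating\<close>

context coercive_equation
begin

text \<open>In \<open>H\<close> the factor \<open>2 powr (\<sigma> + 1)\<close> consists of 2 for
  the parameter to be halved and \<open>2 powr \<sigma>\<close> for points of the half ball, which
  may be twice as close to the boundary. The barrier brings the slope down to \<open>l / 2\<close>
  at distances from \<open>s0\<close> on, and this is the information at the edge from which the
  doubling obtains \<open>l\<close> at smaller distances.\<close>

lemma local_improvement:
  fixes u :: "real^'n \<Rightarrow> real"
  assumes cont: "continuous_on (ball x1 d) u"
    and sub: "jet_subsolution \<alpha> \<beta> F K (ball x1 d) u"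
    and sup: "jet_supersolution \<alpha> \<beta> F K (ball x1 d) u"
    and K: "0 \<le> K" and d: "0 < d" "d \<le> D" and \<eta>: "0 < \<eta>"
    and t: "large_parameter \<alpha> \<beta> \<gamma> \<sigma> a A (real CARD('n)) K D t"
    and l: "l = t * d powr (- \<sigma>)"
    and H: "\<And>x z. norm (x - x1) < d / 2 \<Longrightarrow> norm (x - z) \<le> d / 8 \<Longrightarrow> u x - u z \<le> \<eta> + 2 powr (\<sigma> + 1) * l * norm (x - z)"
    and y1: "norm (x1 - y1) \<le> d / 4"
  shows "u x1 - u y1 \<le> \<eta> + l * norm (x1 - y1)"
proof -
  define n where "n = real CARD('n)"
  have n: "n \<ge> 1" using dim_ge_1 by (simp add: n_def)
  define B where "B = 2 powr (\<sigma> + 1)"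
  \<comment> \<open>\<open>c1\<close> makes the final slope of the barrier \<open>l / 4\<close>,
    \<open>c2\<close> makes \<open>\<rho>\<close> an admissible inner radius for it, and
    \<open>c3\<close> makes \<open>s0\<close> long enough that the old bound on the inner sphere
    contributes only \<open>l / 4 * s0\<close>.\<close>
  define c1 where "c1 = 4 * (1 + B)"
  define c2 where "c2 = 4 * A * n * (\<sigma> + 1) * c1 powr (\<gamma> - 1)"
  define c3 where "c3 = 4 * B * c2"
  define k where "k = c3 * t powr (1 - \<gamma>)"
  define T where "T = t * D powr (- \<sigma>)"
  have tt: "0 < t" "64 * B * k \<le> 1" "4 * K \<le> (T / c1) powr \<beta>"
    "128 * n * A * B * k\<^sup>2 + 16 * B * \<gamma> * 2 powr (\<gamma> - 1) * c3 * k + 2 * K * 8 powr \<bar>\<alpha>\<bar> * c3 * T powr (- \<beta>) < 2 * a"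
    using t unfolding large_parameter_def Let_def n_def B_def c1_def c2_def c3_def k_def T_def by blast+
  have B: "B \<ge> 1" using sigma_pos powr_mono[of 0 "\<sigma> + 1" 2] by (simp add: B_def)
  have c1: "c1 > 0" "c1 \<ge> 1" using B by (auto simp: c1_def)
  have c2: "c2 > 0" using A_pos n sigma_pos c1(1) by (simp add: c2_def)
  have c3: "c3 > 0" "c3 \<ge> c2" using c2 B by (auto simp: c3_def mult_le_cancel_right1)
  have l0: "l > 0" using tt(1) d by (simp add: l)
  have D: "D > 0" using d by simp
  have Tl: "T \<le> l"
  proof -
    have "D powr (- \<sigma>) \<le> d powr (- \<sigma>)" using d sigma_pos by (intro powr_mono2') auto
    then show ?thesis unfolding T_def l using tt(1) by (intro mult_left_mono) auto
  qed
  have T0: "T > 0" using tt(1) D by (simp add: T_def)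
  have lam: "l powr (1 - \<gamma>) = t powr (1 - \<gamma>) * d"
  proof -
    have "l powr (1 - \<gamma>) = t powr (1 - \<gamma>) * (d powr (- \<sigma>)) powr (1 - \<gamma>)"
      unfolding l by (simp add: powr_mult)
    also have "(d powr (- \<sigma>)) powr (1 - \<gamma>) = d powr (- \<sigma> * (1 - \<gamma>))" by (simp only: powr_powr)
    also have "- \<sigma> * (1 - \<gamma>) = 1" using sigma by (simp add: algebra_simps)
    finally show ?thesis using d by simp
  qed
  define \<mu> where "\<mu> = l / c1"
  have \<mu>: "\<mu> > 0" using l0 c1 by (simp add: \<mu>_def)
  define \<rho> where "\<rho> = c2 * t powr (1 - \<gamma>) * d"
  define s0 where "s0 = k * d"
  have \<rho>0: "\<rho> > 0" using c2 tt(1) d by (simp add: \<rho>_def)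
  have s0\<rho>: "s0 = 4 * B * \<rho>" by (simp add: s0_def k_def c3_def \<rho>_def)
  have s0: "s0 > 0" "\<rho> \<le> s0" using \<rho>0 B by (auto simp: s0\<rho> mult_le_cancel_right1)
  have s0d: "64 * B * s0 \<le> d"
    using mult_right_mono[OF tt(2), of d] d by (simp add: s0_def mult_ac)
  have s0d8: "s0 \<le> d / 8"
  proof -
    have "64 * s0 \<le> 64 * B * s0" using B s0 by simp
    then show ?thesis using s0d s0 by linarith
  qed
  have \<mu>\<rho>: "4 * A * real CARD('n) * (\<sigma> + 1) * \<mu> powr (1 - \<gamma>) \<le> \<rho>"
  proof -
    have "\<mu> powr (1 - \<gamma>) = l powr (1 - \<gamma>) / c1 powr (1 - \<gamma>)"
      unfolding \<mu>_def by (simp add: powr_divide)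
    also have "\<dots> = l powr (1 - \<gamma>) * c1 powr (\<gamma> - 1)"
      using powr_minus_divide[of c1 "1 - \<gamma>"] by simp
    finally show ?thesis by (simp add: \<rho>_def c2_def lam n_def mult_ac)
  qed
  have K\<mu>: "4 * K \<le> \<mu> powr \<beta>"
  proof -
    have "(T / c1) powr \<beta> \<le> \<mu> powr \<beta>"
      unfolding \<mu>_def using T0 Tl c1 beta_pos by (intro powr_mono2 divide_right_mono) auto
    then show ?thesis using tt(3) by linarith
  qed
  have far: "u x - u z \<le> \<eta> + l / 2 * norm (x - z)"
    if z: "norm (z - x1) \<le> d / 4" and xz: "s0 \<le> norm (x - z)" "norm (x - z) \<le> d / 4" for x z
  proof -
    have cb: "cball z (d / 2) \<subseteq> ball x1 d"
    proof
      fix v assume "v \<in> cball z (d / 2)"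
      then have "norm (v - z) \<le> d / 2" by (simp add: dist_norm norm_minus_commute)
      then have "norm (v - x1) < d" using norm_triangle_ineq[of "v - z" "z - x1"] z d by simp
      then show "v \<in> ball x1 d" by (simp add: dist_norm norm_minus_commute)
    qed
    have "u x \<le> (u z + \<eta> + B * l * \<rho>) + \<mu> * (1 + 2 powr (\<sigma> + 1)) * norm (x - z)"
    proof (rule radial_barrier[where R="d / 2" and \<rho>=\<rho>, OF _ _ K \<mu> \<mu>\<rho> _ K\<mu>])
      show "jet_subsolution \<alpha> \<beta> F K (ball z (d / 2)) u"
        using cb ball_subset_cball by (intro jet_subsolution_subset[OF sub]) blast
      show "continuous_on (cball z (d / 2)) u" by (rule continuous_on_subset[OF cont cb])
      show "\<rho> \<le> d / 2" using s0 s0d8 d by linarith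
      show "\<rho> \<le> norm (x - z)" using s0 xz by linarith
      show "norm (x - z) \<le> d / 2 / 2" using xz by simp
      fix v assume v: "norm (v - z) = \<rho>"
      have "norm (v - x1) < d / 2"
        using norm_triangle_ineq[of "v - z" "z - x1"] z v s0 s0d8 d by simp
      moreover have "norm (v - z) \<le> d / 8" using v s0 s0d8 by linarith
      ultimately have "u v - u z \<le> \<eta> + 2 powr (\<sigma> + 1) * l * norm (v - z)" by (rule H)
      then show "u v \<le> u z + \<eta> + B * l * \<rho>" using v by (simp add: B_def)
    qed
    moreover have mu4: "\<mu> * (1 + 2 powr (\<sigma> + 1)) = l / 4"
    proof -
      have *: "l / (4 * b) * b = l / 4" if "b > 0" for b using that by simp
      show ?thesis unfolding \<mu>_def c1_def B_def[symmetric] by (rule *) (use B in simp)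
    qed
    ultimately have "u x \<le> (u z + \<eta> + B * l * \<rho>) + l / 4 * norm (x - z)" by (simp only: mu4)
    moreover have "B * l * \<rho> = l / 4 * s0" by (simp add: s0\<rho>)
    moreover have "l / 4 * s0 \<le> l / 4 * norm (x - z)" using l0 xz by (intro mult_left_mono) auto
    moreover have "l / 4 * norm (x - z) + l / 4 * norm (x - z) = l / 2 * norm (x - z)" by simp
    ultimately show ?thesis by linarith
  qed
  show ?thesis
  proof (cases "s0 \<le> norm (x1 - y1)")
    case True
    have "u x1 - u y1 \<le> \<eta> + l / 2 * norm (x1 - y1)"
      using y1 True by (intro far) (auto simp: norm_minus_commute)
    moreover have "l / 2 * norm (x1 - y1) \<le> l * norm (x1 - y1)" using l0 by (intro mult_right_mono) auto
    ultimately show ?thesis by linarith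
  next
    case False
    define r where "r = d / 8"
    have r: "r > 0" using d by (simp add: r_def)
    \<comment> \<open>Just large enough for \<open>m * r\<^sup>2\<close> to absorb what the old
      bound allows over distances up to \<open>s0\<close>.\<close>
    define m where "m = B * l * s0 / r\<^sup>2"
    have m: "m \<ge> 0" using B l0 s0 by (simp add: m_def)
    have mr2: "m * r\<^sup>2 = B * l * s0" using r by (simp add: m_def)
    have m_eq: "m = 64 * B * l * s0 / d\<^sup>2" using d by (simp add: m_def r_def power_divide)
    have mr: "m * r = 8 * B * l * s0 / d" using d unfolding m_eq r_def by (simp add: power2_eq_square)
    have cb: "cball x1 (r + s0) \<subseteq> ball x1 d"
      using s0d8 d by (auto simp: r_def)
    show ?thesis
    proof (rule doubling_estimate[where r=r and ?s0.0=s0 and m=m and K=K, OF _ _ _ K r s0(1) l0 m \<eta>])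
      show "continuous_on (cball x1 (r + s0)) u" by (rule continuous_on_subset[OF cont cb])
      show "jet_subsolution \<alpha> \<beta> F K (ball x1 (r + s0)) u"
        using cb ball_subset_cball by (intro jet_subsolution_subset[OF sub]) blast
      show "jet_supersolution \<alpha> \<beta> F K (ball x1 (r + s0)) u"
        using cb ball_subset_cball by (intro jet_supersolution_subset[OF sup]) blast
      show "norm (x1 - y1) \<le> s0" using False by simp
    next
      fix x y assume x: "norm (x - x1) \<le> r" and xy: "norm (x - y) \<le> s0"
      have "u x - u y \<le> \<eta> + B * l * norm (x - y)"
        unfolding B_def using x xy s0d8 d by (intro H) (auto simp: r_def)
      also have "B * l * norm (x - y) \<le> B * l * s0" using xy B l0 by (intro mult_left_mono) auto
      finally show "u x - u y \<le> \<eta> + m * r\<^sup>2" unfolding mr2 by simp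
    next
      fix x y assume x: "norm (x - x1) \<le> r" and xy: "norm (x - y) = s0"
      have "norm (y - x1) \<le> d / 4"
        using norm_triangle_ineq4[of "x - x1" "x - y"] x xy s0d8 by (simp add: r_def)
      then have "u x - u y \<le> \<eta> + l / 2 * norm (x - y)"
        using xy s0d8 d by (intro far) auto
      moreover have "l / 2 * s0 \<le> 3 / 4 * l * s0" using l0 s0 by simp
      ultimately show "u x - u y \<le> \<eta> + 3 / 4 * l * s0" unfolding xy by linarith
    next
      have "l * (64 * B * s0) \<le> l * d" using s0d l0 by (intro mult_left_mono) auto
      then have "8 * (8 * B * l * s0 / d) \<le> l" using d by (simp add: pos_divide_le_eq mult_ac)
      then show "8 * m * r \<le> l" using mr by (simp add: mult.assoc)
    next
      have e1: "2 * m * n * A = (l / s0) * (128 * n * A * B * k\<^sup>2)"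
      proof -
        have "k = s0 / d" using d by (simp add: s0_def)
        then show ?thesis unfolding m_eq using s0 d by (simp add: power2_eq_square)
      qed
      \<comment> \<open>Up to the constant \<open>c3\<close>, the range \<open>s0\<close> is the
        natural length of \<open>l\<close>. This identity turns the gradient term and the term with
        \<open>K\<close> into multiples of \<open>l / s0\<close>.\<close>
      have ls0: "l powr (\<gamma> - 1) * s0 = c3"
      proof -
        have "s0 = c3 * l powr (1 - \<gamma>)" by (simp add: s0_def k_def lam)
        moreover have "l powr (\<gamma> - 1) * l powr (1 - \<gamma>) = 1" using l0 by (simp flip: powr_add)
        ultimately show ?thesis by (simp add: mult_ac)
      qed
      have e2: "\<gamma> * (2 * l) powr (\<gamma> - 1) * (2 * m * r) = (l / s0) * (16 * B * \<gamma> * 2 powr (\<gamma> - 1) * c3 * k)"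
      proof -
        have "\<gamma> * (2 * l) powr (\<gamma> - 1) * (2 * m * r) = \<gamma> * (2 powr (\<gamma> - 1) * l powr (\<gamma> - 1)) * (2 * (m * r))"
          using l0 by (simp add: powr_mult)
        also have "\<dots> = 16 * B * \<gamma> * 2 powr (\<gamma> - 1) * (l powr (\<gamma> - 1) * s0) * l / d"
          unfolding mr by simp
        also have "\<dots> = 16 * B * \<gamma> * 2 powr (\<gamma> - 1) * c3 * l / d" by (simp only: ls0)
        also have "\<dots> = (l / s0) * (16 * B * \<gamma> * 2 powr (\<gamma> - 1) * c3 * k)"
        proof -
          have "k > 0" using c3 tt(1) by (simp add: k_def)
          then show ?thesis using d by (simp add: s0_def)
        qed
        finally show ?thesis .
      qed
      have e3: "2 * K * 8 powr \<bar>\<alpha>\<bar> * l powr (- \<alpha>) \<le> (l / s0) * (2 * K * 8 powr \<bar>\<alpha>\<bar> * c3 * T powr (- \<beta>))"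
      proof -
        have "l powr (- \<beta>) \<le> T powr (- \<beta>)" using T0 Tl beta_pos by (intro powr_mono2') auto
        then have "(l / s0) * (2 * K * 8 powr \<bar>\<alpha>\<bar> * c3 * l powr (- \<beta>)) \<le> (l / s0) * (2 * K * 8 powr \<bar>\<alpha>\<bar> * c3 * T powr (- \<beta>))"
          using l0 s0 K c3 by (intro mult_left_mono) auto
        moreover have "(l / s0) * (2 * K * 8 powr \<bar>\<alpha>\<bar> * c3 * l powr (- \<beta>)) = 2 * K * 8 powr \<bar>\<alpha>\<bar> * l powr (- \<alpha>)"
        proof -
          have "l * (l powr (\<gamma> - 1) * l powr (- \<beta>)) = l powr 1 * (l powr (\<gamma> - 1) * l powr (- \<beta>))"
            using l0 by simp
          also have "\<dots> = l powr (1 + (\<gamma> - 1 + - \<beta>))" by (simp only: powr_add)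
          also have "\<dots> = l powr (- \<alpha>)" by (simp add: beta_eq)
          finally have lp: "l * (l powr (\<gamma> - 1) * l powr (- \<beta>)) = l powr (- \<alpha>)" .
          have "(l / s0) * (2 * K * 8 powr \<bar>\<alpha>\<bar> * c3 * l powr (- \<beta>))
              = 2 * K * 8 powr \<bar>\<alpha>\<bar> * (l * (l powr (\<gamma> - 1) * l powr (- \<beta>)))"
            unfolding ls0[symmetric] using s0 by simp
          then show ?thesis by (simp only: lp)
        qed
        ultimately show ?thesis by linarith
      qed
      have "(l / s0) * (128 * n * A * B * k\<^sup>2 + 16 * B * \<gamma> * 2 powr (\<gamma> - 1) * c3 * k + 2 * K * 8 powr \<bar>\<alpha>\<bar> * c3 * T powr (- \<beta>)) < (l / s0) * (2 * a)"
        using tt(4) l0 s0 by (intro mult_strict_left_mono) auto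
      then have "2 * m * n * A + \<gamma> * (2 * l) powr (\<gamma> - 1) * (2 * m * r) + 2 * K * 8 powr \<bar>\<alpha>\<bar> * l powr (- \<alpha>) < (l / s0) * (2 * a)"
        using e3 unfolding e1 e2 distrib_left by linarith
      then show "2 * m * real CARD('n) * A + \<gamma> * (2 * l) powr (\<gamma> - 1) * (2 * m * r)
        + 2 * K * 8 powr \<bar>\<alpha>\<bar> * l powr (- \<alpha>) < 2 * a * l / s0"
        by (simp add: n_def mult_ac)
    qed
  qed
qed

text \<open>The slack \<open>\<eta>\<close> is what gets the iteration started for a merely continuous \<open>u\<close>; none of the
  thresholds depends on it.\<close>

lemma interior_lipschitz_estimate:
  fixes u :: "real^'n \<Rightarrow> real"
  assumes cont: "continuous_on (cball x0 r) u"
    and sub: "jet_subsolution \<alpha> \<beta> F K (ball x0 r) u"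
    and sup: "jet_supersolution \<alpha> \<beta> F K (ball x0 r) u"
    and K: "0 \<le> K" and r: "0 < r" "r \<le> D" and t0: "0 < t0"
    and t: "\<And>t. t0 \<le> t \<Longrightarrow> large_parameter \<alpha> \<beta> \<gamma> \<sigma> a A (real CARD('n)) K D t"
    and x: "norm (x - x0) < r" and y: "norm (x - y) \<le> (r - norm (x - x0)) / 4"
  shows "u x - u y \<le> 2 * t0 * (r - norm (x - x0)) powr (- \<sigma>) * norm (x - y)"
proof (rule field_le_epsilon)
  fix \<eta> :: real assume \<eta>: "0 < \<eta>"
  define \<delta> where "\<delta> x = r - norm (x - x0)" for x
  define P where "P T \<longleftrightarrow> (\<forall>x y. norm (x - x0) < r \<longrightarrow> norm (x - y) \<le> \<delta> x / 4 \<longrightarrow>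
      u x - u y \<le> \<eta> + T * \<delta> x powr (- \<sigma>) * norm (x - y))" for T
  have mono: "P T'" if "P T" "T \<le> T'" for T T'
    unfolding P_def
  proof (intro allI impI)
    fix x y assume xy: "norm (x - x0) < r" "norm (x - y) \<le> \<delta> x / 4"
    have "T * \<delta> x powr (- \<sigma>) * norm (x - y) \<le> T' * \<delta> x powr (- \<sigma>) * norm (x - y)"
      using that(2) by (intro mult_right_mono) auto
    then show "u x - u y \<le> \<eta> + T' * \<delta> x powr (- \<sigma>) * norm (x - y)"
      using that(1) xy unfolding P_def by force
  qed
  have step: "P (T / 2)" if T: "P T" "2 * t0 \<le> T" for T
    unfolding P_def
  proof (intro allI impI)
    fix x1 y1 assume x1: "norm (x1 - x0) < r" and y1: "norm (x1 - y1) \<le> \<delta> x1 / 4"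
    define d where "d = \<delta> x1"
    have d: "0 < d" "d \<le> D" using x1 r by (auto simp: d_def \<delta>_def) (use norm_ge_zero[of "x1 - x0"] in linarith)
    have sb: "ball x1 d \<subseteq> ball x0 r"
    proof
      fix v assume "v \<in> ball x1 d"
      then have "norm (v - x0) < r"
        using norm_triangle_ineq[of "v - x1" "x1 - x0"] by (simp add: dist_norm norm_minus_commute[of x1] d_def \<delta>_def)
      then show "v \<in> ball x0 r" by (simp add: dist_norm norm_minus_commute)
    qed
    show "u x1 - u y1 \<le> \<eta> + T / 2 * \<delta> x1 powr (- \<sigma>) * norm (x1 - y1)"
      unfolding d_def[symmetric]
    proof (rule local_improvement[where d=d and D=D and K=K and t="T / 2", OF _ _ _ K d \<eta> _ refl])
      show "continuous_on (ball x1 d) u" using sb ball_subset_cball by (intro continuous_on_subset[OF cont]) blast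
      show "jet_subsolution \<alpha> \<beta> F K (ball x1 d) u" by (rule jet_subsolution_subset[OF sub sb])
      show "jet_supersolution \<alpha> \<beta> F K (ball x1 d) u" by (rule jet_supersolution_subset[OF sup sb])
      show "large_parameter \<alpha> \<beta> \<gamma> \<sigma> a A (real CARD('n)) K D (T / 2)" using T by (intro t) simp
      show "norm (x1 - y1) \<le> d / 4" using y1 by (simp add: d_def)
      fix x z assume xz: "norm (x - x1) < d / 2" "norm (x - z) \<le> d / 8"
      have "norm (x - x0) \<le> norm (x - x1) + norm (x1 - x0)"
        using norm_triangle_ineq[of "x - x1" "x1 - x0"] by simp
      then have \<delta>x: "d / 2 \<le> \<delta> x" "norm (x - x0) < r" using xz(1) d by (auto simp: d_def \<delta>_def)
      then have "u x - u z \<le> \<eta> + T * \<delta> x powr (- \<sigma>) * norm (x - z)"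
        using T(1) xz(2) unfolding P_def by auto
      also have "T * \<delta> x powr (- \<sigma>) * norm (x - z) \<le> T * (d / 2) powr (- \<sigma>) * norm (x - z)"
        using \<delta>x d T t0 sigma_pos by (intro mult_right_mono mult_left_mono powr_mono2') auto
      also have "T * (d / 2) powr (- \<sigma>) = 2 powr (\<sigma> + 1) * (T / 2 * d powr (- \<sigma>))"
      proof -
        have "(d / 2) powr (- \<sigma>) = d powr (- \<sigma>) * 2 powr \<sigma>"
          using d by (simp add: powr_divide powr_minus field_simps)
        moreover have "2 powr (\<sigma> + 1) = 2 * 2 powr \<sigma>" by (simp add: powr_add)
        ultimately show ?thesis by simp
      qed
      finally show "u x - u z \<le> \<eta> + 2 powr (\<sigma> + 1) * (T / 2 * d powr (- \<sigma>)) * norm (x - z)" by simp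
    qed
  qed
  have "\<exists>T. P T"
  proof -
    have "uniformly_continuous_on (cball x0 r) u"
      using cont by (intro compact_uniformly_continuous) auto
    then obtain e where e: "e > 0" "\<And>x y. x \<in> cball x0 r \<Longrightarrow> y \<in> cball x0 r \<Longrightarrow> dist y x < e \<Longrightarrow> dist (u y) (u x) < \<eta>"
      unfolding uniformly_continuous_on_def using \<eta> by metis
    have "bounded (u ` cball x0 r)"
      using cont by (auto intro!: compact_imp_bounded compact_continuous_image)
    then obtain M where M: "\<And>x. x \<in> cball x0 r \<Longrightarrow> \<bar>u x\<bar> \<le> M"
      unfolding bounded_iff by (metis image_eqI real_norm_def)
    \<comment> \<open>Distances below \<open>e\<close> are covered by the slack \<eta>, and from
      \<open>e\<close> on the bounded oscillation of \<open>u\<close> is at most a multiple of the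
      distance. This \<open>T\<close> depends on \<open>u\<close> and \<eta>, but the iteration
      forgets it.\<close>
    define T where "T = 2 * \<bar>M\<bar> / e * r powr \<sigma>"
    have "P T"
      unfolding P_def
    proof (intro allI impI)
      fix x y assume x: "norm (x - x0) < r" and xy: "norm (x - y) \<le> \<delta> x / 4"
      have "norm (y - x0) \<le> norm (x - x0) + norm (x - y)"
        using norm_triangle_ineq4[of "x - x0" "x - y"] by simp
      then have "norm (y - x0) \<le> r" using x xy by (simp add: \<delta>_def)
      then have inb: "x \<in> cball x0 r" "y \<in> cball x0 r" using x by (auto simp: dist_norm norm_minus_commute)
      have T0: "0 \<le> T * \<delta> x powr (- \<sigma>) * norm (x - y)" using e r by (simp add: T_def)
      show "u x - u y \<le> \<eta> + T * \<delta> x powr (- \<sigma>) * norm (x - y)"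
      proof (cases "norm (x - y) < e")
        case True
        then have "dist (u y) (u x) < \<eta>" using e(2)[OF inb] by (simp add: dist_norm norm_minus_commute)
        then show ?thesis using T0 unfolding dist_real_def by linarith
      next
        case False
        have "r powr (- \<sigma>) \<le> \<delta> x powr (- \<sigma>)"
          using x sigma_pos by (intro powr_mono2') (auto simp: \<delta>_def)
        then have "T * r powr (- \<sigma>) \<le> T * \<delta> x powr (- \<sigma>)" using e r by (intro mult_left_mono) (auto simp: T_def)
        moreover have "T * r powr (- \<sigma>) = 2 * \<bar>M\<bar> / e"
          using r by (simp add: T_def flip: powr_add)
        ultimately have "2 * \<bar>M\<bar> / e * norm (x - y) \<le> T * \<delta> x powr (- \<sigma>) * norm (x - y)"
          by (intro mult_right_mono) auto
        moreover have "2 * \<bar>M\<bar> / e * e \<le> 2 * \<bar>M\<bar> / e * norm (x - y)"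
          using False e by (intro mult_left_mono) auto
        moreover have "2 * \<bar>M\<bar> / e * e = 2 * \<bar>M\<bar>" using e by simp
        ultimately show ?thesis using M[OF inb(1)] M[OF inb(2)] \<eta> by linarith
      qed
    qed
    then show ?thesis by blast
  qed
  then obtain T where T: "P T" by blast
  \<comment> \<open>Halving is available as long as the new parameter is at least \<open>t0\<close>,
    that is, while the old one is at least \<open>2 * t0\<close>; hence the floor and the factor 2
    in the estimate.\<close>
  have iter: "P (max (T / 2 ^ k) (2 * t0))" for k
  proof (induction k)
    case 0
    show ?case by (rule mono[OF T]) simp
  next
    case (Suc k)
    have "P (max (T / 2 ^ k) (2 * t0) / 2)" by (rule step[OF Suc]) simp
    moreover have "max (T / 2 ^ k) (2 * t0) / 2 \<le> max (T / 2 ^ Suc k) (2 * t0)"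
    proof (cases "T / 2 ^ k \<le> 2 * t0")
      case True
      then show ?thesis using t0 by (simp add: max_absorb2 le_max_iff_disj)
    next
      case False
      then show ?thesis by (simp add: max_absorb1 le_max_iff_disj)
    qed
    ultimately show ?case by (rule mono)
  qed
  obtain k where "\<bar>T\<bar> / (2 * t0) < 2 ^ k" using real_arch_pow[of 2] by auto
  then have "T / 2 ^ k \<le> 2 * t0" using t0 by (simp add: field_simps abs_if split: if_splits)
  then have "P (2 * t0)" using iter[of k] by (simp add: max_def split: if_splits)
  then show "u x - u y \<le> 2 * t0 * (r - norm (x - x0)) powr (- \<sigma>) * norm (x - y) + \<eta>"
    using x y unfolding P_def \<delta>_def by (simp add: add.commute)
qed

end

section \<open>From balls to the domain\<close>

text \<open>A one-sided bound suffices because \<open>y\<close> is reached from \<open>x\<close> by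
  moving against \<open>p\<close>.\<close>

lemma norm_gradient_le:
  fixes u :: "'a::real_inner \<Rightarrow> real"
  assumes p: "GDERIV u x :> p" and d: "0 < d" and C: "0 \<le> C"
    and lip: "\<And>y. norm (x - y) < d \<Longrightarrow> u x - u y \<le> C * norm (x - y)"
  shows "norm p \<le> C"
proof (cases "p = 0")
  case True
  then show ?thesis using C by simp
next
  case False
  show ?thesis
  proof (rule field_le_epsilon)
    fix e :: real assume e: "0 < e"
    have D: "(u has_derivative (\<lambda>h. h \<bullet> p)) (at x)" using p by (simp add: gderiv_def)
    obtain d' where d': "d' > 0" "\<And>y. norm (y - x) < d' \<Longrightarrow> norm (u y - u x - (y - x) \<bullet> p) \<le> e * norm (y - x)"
      using D e unfolding has_derivative_at_alt by blast
    define s where "s = min d d' / (2 * norm p)"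
    have s: "s > 0" using d d' False by (simp add: s_def)
    define y where "y = x - s *\<^sub>R p"
    have ny: "norm (x - y) = s * norm p" using s by (simp add: y_def)
    have "s * norm p = min d d' / 2" using False by (simp add: s_def)
    then have small: "norm (x - y) < d" "norm (y - x) < d'" using d d' ny by (auto simp: norm_minus_commute)
    have "u x - u y \<le> C * (s * norm p)" using lip[OF small(1)] ny by simp
    moreover have "(y - x) \<bullet> p = - (s * (norm p)\<^sup>2)" by (simp add: y_def power2_norm_eq_inner)
    moreover have "\<bar>u y - u x - (y - x) \<bullet> p\<bar> \<le> e * (s * norm p)"
      using d'(2)[OF small(2)] ny by (simp add: norm_minus_commute)
    ultimately have "s * (norm p)\<^sup>2 \<le> C * (s * norm p) + e * (s * norm p)" by linarith
    then have "(s * norm p) * norm p \<le> (s * norm p) * (C + e)" by (simp add: power2_eq_square algebra_simps)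
    then show "norm p \<le> C + e" using s False by simp
  qed
qed


lemma jets_of_viscosity_solution:
  fixes u :: "real^'n \<Rightarrow> real"
  assumes F: "elliptic_operator a A F" and A: "0 < A"
    and vs: "viscosity_solution \<alpha> \<beta> lam F f \<Omega> u" and S: "S \<subseteq> \<Omega>"
    and K: "\<And>x. x \<in> S \<Longrightarrow> \<bar>f x - lam * spow \<alpha> (u x)\<bar> \<le> K"
  shows "jet_subsolution \<alpha> \<beta> F K S u" and "jet_supersolution \<alpha> \<beta> F K S u"
proof -
  have sub: "viscosity_subsolution \<alpha> \<beta> lam F f \<Omega> u" and sup: "viscosity_supersolution \<alpha> \<beta> lam F f \<Omega> u"
    using vs by (auto simp: viscosity_solution_def)
  show "jet_subsolution \<alpha> \<beta> F K S u"
    unfolding jet_subsolution_def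
  proof (intro ballI allI impI)
    fix x p X assume x: "x \<in> S" and jet: "X \<in> Sym" "p \<noteq> 0" "upper_jet u x p X"
    have "norm p powr \<beta> - norm p powr \<alpha> * F X + lam * spow \<alpha> (u x) \<le> f x"
      by (rule subsolution_upper_jet[OF F A sub _ jet]) (use x S in blast)
    then show "norm p powr \<beta> - norm p powr \<alpha> * F X \<le> K" using K[OF x] by linarith
  qed
  show "jet_supersolution \<alpha> \<beta> F K S u"
    unfolding jet_supersolution_def
  proof (intro ballI allI impI)
    fix x p X assume x: "x \<in> S" and jet: "X \<in> Sym" "p \<noteq> 0" "upper_jet (\<lambda>y. - u y) x p X"
    have "f x \<le> norm p powr \<beta> - norm p powr \<alpha> * F (- X) + lam * spow \<alpha> (u x)"
      by (rule supersolution_upper_jet[OF F A sup _ jet]) (use x S in blast)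
    then show "- K \<le> norm p powr \<beta> - norm p powr \<alpha> * F (- X)" using K[OF x] by linarith
  qed
qed

text \<open>At 0 it is \<open>\<alpha> + 1 > 0\<close> that gives continuity. The lemma makes
  \<open>f - lam * spow \<alpha> (u x)\<close> continuous, hence bounded on compact balls, so local
  Lipschitz continuity follows without a global bound.\<close>

lemma continuous_spow:
  assumes "\<alpha> > -1"
  shows "continuous_on UNIV (spow \<alpha>)"
proof -
  have eq: "spow \<alpha> s = sgn s * \<bar>s\<bar> powr (\<alpha> + 1)" for s
    by (cases "s = 0") (auto simp: spow_def rpow_def powr_add sgn_if)
  have "isCont (spow \<alpha>) s" for s
  proof (cases "s = 0")
    case True
    have "((\<lambda>s. \<bar>s\<bar> powr (\<alpha> + 1)) \<longlongrightarrow> 0) (at 0)"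
    proof -
      have "((\<lambda>s::real. \<bar>s\<bar> powr (\<alpha> + 1)) \<longlongrightarrow> \<bar>0\<bar> powr (\<alpha> + 1)) (at 0)"
        by (intro tendsto_powr' tendsto_intros) (use assms in auto)
      then show ?thesis by simp
    qed
    then have "(spow \<alpha> \<longlongrightarrow> 0) (at 0)"
      by (rule Lim_null_comparison[rotated]) (auto simp: eq abs_mult sgn_if intro!: always_eventually)
    then show ?thesis using True by (simp add: isCont_def eq)
  next
    case False
    then have "isCont (\<lambda>s. \<bar>s\<bar> powr \<alpha> * s) s" by (intro continuous_intros) auto
    moreover have "\<forall>\<^sub>F t in nhds s. spow \<alpha> t = \<bar>t\<bar> powr \<alpha> * t"
    proof -
      have "\<forall>\<^sub>F t in nhds s. t \<noteq> 0" using False by (rule t1_space_nhds)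
      then show ?thesis by eventually_elim (auto simp: spow_def rpow_def)
    qed
    ultimately show ?thesis by (simp add: isCont_cong)
  qed
  then show ?thesis by (simp add: continuous_on_eq_continuous_at)
qed

theorem theorem2p4:
  fixes \<alpha> \<beta> a A :: real
  assumes "\<alpha> > -1" and "\<beta> > \<alpha> + 1" and "0 < a" and "a < A"
  shows "\<exists>M :: real \<Rightarrow> real \<Rightarrow> real \<Rightarrow> real. (\<forall>K L d. 0 < M K L d) \<and>
    (\<forall>(\<Omega> :: (real^'n) set) F lam f u L.
       C2_domain \<Omega> \<and> bounded \<Omega> \<and> elliptic_operator a A F \<and> 0 \<le> lam \<and>
       L-lipschitz_on \<Omega> f \<and> continuous_on \<Omega> u \<and> viscosity_solution \<alpha> \<beta> lam F f \<Omega> u \<longrightarrow>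
       locally_lipschitz_on \<Omega> u \<and>
       (bounded ((\<lambda>x. f x - lam * spow \<alpha> (u x)) ` \<Omega>) \<longrightarrow>
        (\<forall>x\<in>\<Omega>. \<forall>p. (GDERIV u x :> p) \<longrightarrow>
           norm p \<le> M (sup_norm_on \<Omega> (\<lambda>x. f x - lam * spow \<alpha> (u x))) L (diameter \<Omega>)
                      / infdist x (frontier \<Omega>) powr (1 / (\<beta> - \<alpha> - 1)))))"
proof -
  define \<gamma> where "\<gamma> = \<beta> - \<alpha>"
  define \<sigma> where "\<sigma> = 1 / (\<beta> - \<alpha> - 1)"
  have par: "\<beta> = \<alpha> + \<gamma>" "\<gamma> > 1" "\<sigma> * (\<gamma> - 1) = 1"
    using assms by (auto simp: \<gamma>_def \<sigma>_def)
  have A0: "0 < A" and \<beta>0: "0 < \<beta>" using assms by auto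
  have \<sigma>0: "\<sigma> > 0" using assms(2) by (simp add: \<sigma>_def)
  have "\<exists>t0>0. \<forall>t\<ge>t0. large_parameter \<alpha> \<beta> \<gamma> \<sigma> a A (real CARD('n)) K D t" if D: "D > 0" for K D
  proof -
    obtain t0 where "\<And>t. t \<ge> t0 \<Longrightarrow> large_parameter \<alpha> \<beta> \<gamma> \<sigma> a A (real CARD('n)) K D t"
      using eventually_large_parameter[OF par(2) \<beta>0 assms(3) D, of \<alpha> \<sigma> A "real CARD('n)" K]
      unfolding eventually_at_top_linorder by blast
    then show ?thesis by (intro exI[of _ "max t0 1"]) auto
  qed
  then have "\<forall>K D. \<exists>t0. D > 0 \<longrightarrow> t0 > 0 \<and> (\<forall>t\<ge>t0. large_parameter \<alpha> \<beta> \<gamma> \<sigma> a A (real CARD('n)) K D t)"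
    by blast
  then obtain t0 where "\<forall>K D. D > 0 \<longrightarrow> t0 K D > 0 \<and>
      (\<forall>t\<ge>t0 K D. large_parameter \<alpha> \<beta> \<gamma> \<sigma> a A (real CARD('n)) K D t)"
    unfolding choice_iff by blast
  then have t0: "\<And>K D. D > 0 \<Longrightarrow> t0 K D > 0"
    "\<And>K D t. D > 0 \<Longrightarrow> t \<ge> t0 K D \<Longrightarrow> large_parameter \<alpha> \<beta> \<gamma> \<sigma> a A (real CARD('n)) K D t"
    by blast+
  \<comment> \<open>The factor \<open>2 powr \<sigma>\<close> pays for working in the ball of half
    the distance, whose closure lies in \<open>\<Omega>\<close>. The diameter bounds all radii and
    thereby yields the lower bound \<open>t * D powr (- \<sigma>)\<close> of the slopes, against
    which \<open>K\<close> is measured in \<open>large_parameter\<close>. The absolute values make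
    \<open>M\<close> positive for all arguments.\<close>
  define M where "M K (L::real) D = 2 * t0 \<bar>K\<bar> (\<bar>D\<bar> + 1) * 2 powr \<sigma>" for K L D
  have M0: "0 < M K L D" for K L D
    unfolding M_def using t0(1)[of "\<bar>D\<bar> + 1" "\<bar>K\<bar>"] by simp
  show ?thesis
  proof (intro exI[of _ M] conjI allI impI M0)
    fix \<Omega> :: "(real^'n) set" and F lam f u L
    assume *: "C2_domain \<Omega> \<and> bounded \<Omega> \<and> elliptic_operator a A F \<and> 0 \<le> lam \<and>
       L-lipschitz_on \<Omega> f \<and> continuous_on \<Omega> u \<and> viscosity_solution \<alpha> \<beta> lam F f \<Omega> u"
    then have op: "open \<Omega>" and bd: "bounded \<Omega>" and F: "elliptic_operator a A F" and f: "L-lipschitz_on \<Omega> f"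
      and u: "continuous_on \<Omega> u" and vs: "viscosity_solution \<alpha> \<beta> lam F f \<Omega> u"
      by (auto simp: C2_domain_def)
    interpret coercive_equation \<alpha> \<beta> \<gamma> \<sigma> a A F
      by unfold_locales (use assms par F in auto)
    define g where "g x = f x - lam * spow \<alpha> (u x)" for x
    have contg: "continuous_on \<Omega> g"
      unfolding g_def
      by (intro continuous_intros lipschitz_on_continuous_on[OF f] continuous_on_compose2[OF continuous_spow[OF assms(1)] u]) auto
    have lip: "u x - u y \<le> 2 * t0 K D * (r - norm (x - x0)) powr (- \<sigma>) * norm (x - y)"
      if "cball x0 r \<subseteq> \<Omega>" "0 < r" "r \<le> D" "\<And>x. x \<in> ball x0 r \<Longrightarrow> \<bar>g x\<bar> \<le> K"
        "norm (x - x0) < r" "norm (x - y) \<le> (r - norm (x - x0)) / 4" for x0 r K D x y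
    proof -
      have D: "D > 0" using that by simp
      have bs: "ball x0 r \<subseteq> \<Omega>" using that(1) ball_subset_cball by blast
      have "0 \<le> K" using that(4)[of x0] that(2) by force
      have jets: "jet_subsolution \<alpha> \<beta> F K (ball x0 r) u" "jet_supersolution \<alpha> \<beta> F K (ball x0 r) u"
        using jets_of_viscosity_solution[OF F A0 vs bs, of K] that(4) unfolding g_def by blast+
      show ?thesis
        by (rule interior_lipschitz_estimate[OF continuous_on_subset[OF u that(1)] jets \<open>0 \<le> K\<close> that(2,3) t0(1)[OF D] t0(2)[OF D] that(5,6)])
    qed
    show "locally_lipschitz_on \<Omega> u"
      unfolding locally_lipschitz_on_def
    proof
      fix x0 assume "x0 \<in> \<Omega>"
      then obtain R where R: "R > 0" "cball x0 R \<subseteq> \<Omega>" using op open_contains_cball by metis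
      have "bounded (g ` cball x0 R)"
        using continuous_on_subset[OF contg R(2)] by (intro compact_imp_bounded compact_continuous_image) auto
      then obtain K where K: "\<And>x. x \<in> cball x0 R \<Longrightarrow> \<bar>g x\<bar> \<le> K"
        unfolding bounded_iff by (metis image_eqI real_norm_def)
      define C where "C = 2 * t0 K R * (R / 2) powr (- \<sigma>)"
      have C0: "C \<ge> 0" using t0(1)[OF R(1), of K] by (simp add: C_def)
      \<comment> \<open>Points of the ball of radius \<open>R / 16\<close> are at most
        \<open>R / 8\<close> apart, which is below a quarter of their distance from the sphere of
        radius \<open>R\<close>; that distance is also at least \<open>R / 2\<close>, as used in
        \<open>C\<close>.\<close>
      have one: "u x - u y \<le> C * norm (x - y)" if x: "x \<in> cball x0 (R / 16)" and y: "y \<in> cball x0 (R / 16)" for x y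
      proof -
        have nx: "norm (x - x0) \<le> R / 16" "norm (y - x0) \<le> R / 16"
          using x y by (auto simp: dist_norm norm_minus_commute)
        have xy: "norm (x - y) \<le> R / 8"
          using norm_triangle_ineq4[of "x - x0" "y - x0"] nx by simp
        have "u x - u y \<le> 2 * t0 K R * (R - norm (x - x0)) powr (- \<sigma>) * norm (x - y)"
          using K nx xy R by (intro lip[OF R(2) R(1)]) auto
        also have "\<dots> \<le> C * norm (x - y)"
          unfolding C_def using nx R(1) \<sigma>0 t0(1)[OF R(1), of K]
          by (intro mult_right_mono mult_left_mono powr_mono2') auto
        finally show ?thesis .
      qed
      have "C-lipschitz_on (cball x0 (R / 16) \<inter> \<Omega>) u"
      proof (rule lipschitz_onI[OF _ C0])
        fix x y assume "x \<in> cball x0 (R / 16) \<inter> \<Omega>" "y \<in> cball x0 (R / 16) \<inter> \<Omega>"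
        then show "dist (u x) (u y) \<le> C * dist x y"
          using one[of x y] one[of y x] by (simp add: dist_real_def dist_norm norm_minus_commute abs_le_iff)
      qed
      then show "\<exists>r>0. \<exists>C. C-lipschitz_on (cball x0 r \<inter> \<Omega>) u" using R(1) by (intro exI[of _ "R / 16"]) auto
    qed
    assume gb: "bounded ((\<lambda>x. f x - lam * spow \<alpha> (u x)) ` \<Omega>)"
    define K where "K = sup_norm_on \<Omega> (\<lambda>x. f x - lam * spow \<alpha> (u x))"
    have gK: "\<bar>g x\<bar> \<le> K" if "x \<in> \<Omega>" for x
    proof -
      obtain b where "\<And>x. x \<in> \<Omega> \<Longrightarrow> \<bar>g x\<bar> \<le> b"
        using gb unfolding bounded_iff g_def by (metis image_eqI real_norm_def)
      then have "bdd_above ((\<lambda>x. \<bar>g x\<bar>) ` \<Omega>)" by (auto simp: bdd_above_def)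
      then show ?thesis unfolding K_def sup_norm_on_def g_def[symmetric] by (rule cSUP_upper[OF that])
    qed
    show "\<forall>x\<in>\<Omega>. \<forall>p. (GDERIV u x :> p) \<longrightarrow>
           norm p \<le> M (sup_norm_on \<Omega> (\<lambda>x. f x - lam * spow \<alpha> (u x))) L (diameter \<Omega>)
                      / infdist x (frontier \<Omega>) powr (1 / (\<beta> - \<alpha> - 1))"
      unfolding K_def[symmetric] \<sigma>_def[symmetric]
    proof (intro ballI allI impI)
      fix x p assume x: "x \<in> \<Omega>" and p: "GDERIV u x :> p"
      have "\<Omega> \<noteq> UNIV" using bd by auto
      then have fr: "frontier \<Omega> \<noteq> {}" using x frontier_eq_empty by blast
      define d where "d = infdist x (frontier \<Omega>)"
      have "x \<notin> frontier \<Omega>" using x op by (simp add: frontier_def interior_open)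
      then have d: "d > 0"
        unfolding d_def using fr by (simp add: infdist_pos_not_in_closed)
      have sub: "ball x d \<subseteq> \<Omega>"
      proof (rule ccontr)
        assume "\<not> ball x d \<subseteq> \<Omega>"
        moreover have "x \<in> ball x d \<inter> \<Omega>" using x d by simp
        ultimately have "ball x d \<inter> frontier \<Omega> \<noteq> {}"
          by (intro connected_Int_frontier connected_ball) blast+
        then obtain z where "dist x z < d" "z \<in> frontier \<Omega>" by auto
        then show False using infdist_le[of z "frontier \<Omega>" x] by (simp add: d_def)
      qed
      define r where "r = d / 2"
      have r: "r > 0" "cball x r \<subseteq> \<Omega>" using d sub by (auto simp: r_def)
      define D where "D = \<bar>diameter \<Omega>\<bar> + 1"
      have rD: "r \<le> D"
      proof -
        obtain e :: "real^'n" where e: "norm e = 1" using norm_axis_1 by blast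
        have "x + r *\<^sub>R e \<in> \<Omega>" using r e by (auto simp: dist_norm)
        then have "dist x (x + r *\<^sub>R e) \<le> diameter \<Omega>" using bd x by (intro diameter_bounded_bound) auto
        then show ?thesis using r(1) e by (simp add: D_def dist_norm)
      qed
      have K0: "K \<ge> 0" using gK[OF x] by linarith
      define C where "C = 2 * t0 K D * r powr (- \<sigma>)"
      have D0: "D > 0" by (simp add: D_def)
      have "norm p \<le> C"
      proof (rule norm_gradient_le[OF p])
        show "0 < r / 4" using r by simp
        show "0 \<le> C" using t0(1)[OF D0, of K] by (simp add: C_def)
        fix y assume "norm (x - y) < r / 4"
        then show "u x - u y \<le> C * norm (x - y)"
          using lip[OF r(2) r(1) rD, of K x y] gK r ball_subset_cball by (force simp: C_def)
      qed
      also have "C = M K L (diameter \<Omega>) / d powr \<sigma>"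
      proof -
        have "r powr (- \<sigma>) = 2 powr \<sigma> / d powr \<sigma>"
          using d by (simp add: r_def powr_divide powr_minus field_simps)
        then show ?thesis using K0 by (simp add: C_def M_def D_def)
      qed
      finally show "norm p \<le> M K L (diameter \<Omega>) / infdist x (frontier \<Omega>) powr \<sigma>" by (simp add: d_def)
    qed
  qed
qed

end
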